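(* Let $S$ be a measurable space, let $P$ and $Q$ be probability kernels from $S$ to $\mathbb{R}^d$ with finite first moments (that is, $\int|x|\,P_\theta(dx)<\infty$ and $\int|x|\,Q_\theta(dx)<\infty$ for all $\theta\in S$), and let $c:\mathbb{R}^d\times\mathbb{R}^d\to(-\infty,\infty]$ be lower semicontinuous and satisfy $$c(x,y)\ge -C(1+|x|+|y|)\qquad\text{for all }x,y\in\mathbb{R}^d$$ for some finite constant $C$. (i) If $P_\theta\le_{\mathrm{cx}}Q_\theta$ for all $\theta\in S$, then there exists a probability kernel $(\theta,B)\mapsto\gamma_\theta(B)$ from $S$ to $\mathbb{R}^d\times\mathbb{R}^d$ such that for every $\theta\in S$, $\gamma_\theta$ is a martingale coupling of $P_\theta$ and $Q_\theta$ which minimises $\mu(c)$ over all martingale couplings $\mu$ of $P_\theta$ and $Q_\theta$. (ii) There exists a probability kernel $(\theta,B)\mapsto\gamma^*_\theta(B)$ from $S$ to $\mathbb{R}^d\times\mathbb{R}^d$ such that for every $\theta\in S$, $\gamma^*_\theta$ is a coupling of $P_\theta$ and $Q_\theta$ which minimises $\mu(c)$ over all couplings $\mu$ of $P_\theta$ and $Q_\theta$.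
   Context: A probability kernel from $S$ to a space $E$ ($E=\mathbb{R}^d$ or $\mathbb{R}^d\times\mathbb{R}^d$) is a map $(\theta,B)\mapsto P_\theta(B)$ such that $P_\theta$ is a Borel probability measure on $E$ for every $\theta\in S$ and $\theta\mapsto P_\theta(B)$ is measurable for every Borel $B\subset E$. For probability measures $\mu,\nu$ on $\mathbb{R}^d$, $\mu\le_{\mathrm{cx}}\nu$ means $\int\phi\,d\mu\le\int\phi\,d\nu$ for all convex $\phi:\mathbb{R}^d\to[0,\infty)$. A coupling of $\mu$ and $\nu$ is a probability measure on $\mathbb{R}^d\times\mathbb{R}^d$ with first marginal $\mu$ and second marginal $\nu$. A martingale coupling is a coupling which is the joint law of some random vectors $(X_1,X_2)$ that are integrable and satisfy $E[X_2\mid X_1]=X_1$ almost surely. For a probability measure $\mu$ on $\mathbb{R}^d\times\mathbb{R}^d$, $\mu(c)=\iint c(x,y)\,\mu(dx\times dy)\in(-\infty,\infty]$; the minimum value of $\mu(c)$ may be $+\infty$. *)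

theory Defs
  imports "HOL-Probability.Probability"
begin

text \<open>
  A probability kernel from \<open>S\<close> to a space \<open>E\<close> with its Borel sigma-algebra is a measurable map
  into \<^const>\<open>prob_algebra\<close> of \<^const>\<open>borel\<close>; the next lemma unfolds this.  On
  \<open>E \<times> E\<close> the measure \<^const>\<open>borel\<close> carries the Borel sigma-algebra of the product topology.
\<close>

lemma prob_kernel_iff:
  fixes K :: "'s \<Rightarrow> 'a :: topological_space measure"
  shows "K \<in> S \<rightarrow>\<^sub>M prob_algebra borel \<longleftrightarrow>
    (\<forall>\<theta>\<in>space S. prob_space (K \<theta>) \<and> sets (K \<theta>) = sets borel) \<and>
    (\<forall>B\<in>sets borel. (\<lambda>\<theta>. measure (K \<theta>) B) \<in> borel_measurable S)"
    (is "?L \<longleftrightarrow> ?R")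
proof
  assume L: ?L
  then have sub: "K \<in> S \<rightarrow>\<^sub>M subprob_algebra borel"
    by (rule measurable_prob_algebraD)
  have "prob_space (K \<theta>) \<and> sets (K \<theta>) = sets borel" if "\<theta> \<in> space S" for \<theta>
    using measurable_space[OF L that] by (simp add: space_prob_algebra)
  moreover have "(\<lambda>\<theta>. measure (K \<theta>) B) \<in> borel_measurable S" if "B \<in> sets borel" for B
    using measurable_compose[OF sub measurable_measure_subprob_algebra[OF that]] .
  ultimately show ?R by blast
next
  assume R: ?R
  have "K \<in> S \<rightarrow>\<^sub>M subprob_algebra borel"
  proof (rule measurable_subprob_algebra)
    fix \<theta> assume "\<theta> \<in> space S"
    then show "subprob_space (K \<theta>)" "sets (K \<theta>) = sets borel"
      using R prob_space_imp_subprob_space by blast+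
  next
    fix B :: "'a set" assume B: "B \<in> sets borel"
    have "(\<lambda>\<theta>. ennreal (measure (K \<theta>) B)) \<in> borel_measurable S"
      using R B by (intro measurable_compose[OF _ measurable_ennreal]) blast
    then show "(\<lambda>\<theta>. emeasure (K \<theta>) B) \<in> borel_measurable S"
    proof (rule measurable_cong[THEN iffD1, rotated])
      fix \<theta> assume "\<theta> \<in> space S"
      then interpret prob_space "K \<theta>" using R by blast
      show "ennreal (measure (K \<theta>) B) = emeasure (K \<theta>) B"
        by (simp add: emeasure_eq_measure)
    qed
  qed
  then show ?L
    using R by (intro measurable_prob_algebraI) blast+
qed

definition convex_order :: "(real ^ 'd) measure \<Rightarrow> (real ^ 'd) measure \<Rightarrow> bool"
    (infix \<open>\<le>\<^sub>c\<^sub>x\<close> 50) where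
  "\<mu> \<le>\<^sub>c\<^sub>x \<nu> \<longleftrightarrow>
    (\<forall>\<phi> :: real ^ 'd \<Rightarrow> real. convex_on UNIV \<phi> \<and> (\<forall>x. 0 \<le> \<phi> x) \<longrightarrow>
      (\<integral>\<^sup>+x. ennreal (\<phi> x) \<partial>\<mu>) \<le> (\<integral>\<^sup>+x. ennreal (\<phi> x) \<partial>\<nu>))"

definition is_coupling ::
  "('a :: topological_space \<times> 'a) measure \<Rightarrow> 'a measure \<Rightarrow> 'a measure \<Rightarrow> bool" where
  "is_coupling \<gamma> \<mu> \<nu> \<longleftrightarrow>
    prob_space \<gamma> \<and> sets \<gamma> = sets borel \<and> distr \<gamma> borel fst = \<mu> \<and> distr \<gamma> borel snd = \<nu>"

definition vec_cond_exp ::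
  "'w measure \<Rightarrow> 'w measure \<Rightarrow> ('w \<Rightarrow> real ^ 'd) \<Rightarrow> 'w \<Rightarrow> real ^ 'd" where
  "vec_cond_exp M F X = (\<lambda>\<omega>. \<chi> i. real_cond_exp M F (\<lambda>\<omega>. X \<omega> $ i) \<omega>)"

text \<open>
  \<open>martingale_pair M X\<^sub>1 X\<^sub>2\<close>: on the probability space \<open>M\<close> the random vectors are integrable and
  \<open>E[X\<^sub>2 | X\<^sub>1] = X\<^sub>1\<close> almost surely; \<open>vimage_algebra (space M) X\<^sub>1 borel\<close> is the sigma-algebra
  generated by \<open>X\<^sub>1\<close>.
\<close>

definition martingale_pair ::
  "'w measure \<Rightarrow> ('w \<Rightarrow> real ^ 'd) \<Rightarrow> ('w \<Rightarrow> real ^ 'd) \<Rightarrow> bool" where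
  "martingale_pair M X\<^sub>1 X\<^sub>2 \<longleftrightarrow>
    prob_space M \<and> integrable M X\<^sub>1 \<and> integrable M X\<^sub>2 \<and>
    (AE \<omega> in M. vec_cond_exp M (vimage_algebra (space M) X\<^sub>1 borel) X\<^sub>2 \<omega> = X\<^sub>1 \<omega>)"

text \<open>
  HOL cannot quantify over the type of the sample space, so it is fixed here to be
  \<open>\<real>\<^sup>d \<times> \<real>\<^sup>d\<close>.  Nothing is lost: by lemma \<open>is_martingale_couplingI\<close> below, a coupling that is the
  law of a martingale pair on a probability space of any type satisfies the definition.
\<close>

definition is_martingale_coupling ::
  "((real ^ 'd) \<times> (real ^ 'd)) measure \<Rightarrow> (real ^ 'd) measure \<Rightarrow> (real ^ 'd) measure \<Rightarrow> bool" where
  "is_martingale_coupling \<gamma> \<mu> \<nu> \<longleftrightarrow>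
    is_coupling \<gamma> \<mu> \<nu> \<and>
    (\<exists>(M :: ((real ^ 'd) \<times> (real ^ 'd)) measure) X\<^sub>1 X\<^sub>2.
      martingale_pair M X\<^sub>1 X\<^sub>2 \<and> \<gamma> = distr M borel (\<lambda>\<omega>. (X\<^sub>1 \<omega>, X\<^sub>2 \<omega>)))"

lemma martingale_pair_distr:
  fixes X\<^sub>1 X\<^sub>2 :: "'w \<Rightarrow> real ^ 'd"
  assumes "martingale_pair M X\<^sub>1 X\<^sub>2"
  shows "martingale_pair (distr M borel (\<lambda>\<omega>. (X\<^sub>1 \<omega>, X\<^sub>2 \<omega>))) fst snd"
proof -
  let ?Z = "\<lambda>\<omega>. (X\<^sub>1 \<omega>, X\<^sub>2 \<omega>)"
  let ?N = "distr M borel ?Z"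
  let ?F = "vimage_algebra (space M) X\<^sub>1 borel"
  let ?G = "vimage_algebra (space ?N) (fst :: (real ^ 'd) \<times> (real ^ 'd) \<Rightarrow> _) borel"
  interpret M: prob_space M using assms by (simp add: martingale_pair_def)
  have i1: "integrable M X\<^sub>1" and i2: "integrable M X\<^sub>2"
    and ae: "AE \<omega> in M. vec_cond_exp M ?F X\<^sub>2 \<omega> = X\<^sub>1 \<omega>"
    using assms by (auto simp: martingale_pair_def)
  have m1 [measurable]: "X\<^sub>1 \<in> borel_measurable M" and m2 [measurable]: "X\<^sub>2 \<in> borel_measurable M"
    using i1 i2 by auto
  have mZ [measurable]: "?Z \<in> M \<rightarrow>\<^sub>M borel" by measurable
  interpret N: prob_space ?N by (rule M.prob_space_distr) (rule mZ)
  have mf [measurable]: "(fst :: (real ^ 'd) \<times> (real ^ 'd) \<Rightarrow> _) \<in> borel \<rightarrow>\<^sub>M borel"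
    and ms [measurable]: "(snd :: (real ^ 'd) \<times> (real ^ 'd) \<Rightarrow> _) \<in> borel \<rightarrow>\<^sub>M borel"
    by (auto intro!: borel_measurable_continuous_onI continuous_intros)
  have subF: "subalgebra M ?F"
    using m1 by (auto simp: subalgebra_def sets_vimage_algebra2 measurable_sets dest: measurable_space)
  have subG: "subalgebra ?N ?G"
    by (auto simp: subalgebra_def sets_vimage_algebra2) (metis measurable_sets_borel mf)
  interpret SF: finite_measure_subalgebra M ?F by unfold_locales (rule subF)
  interpret SG: finite_measure_subalgebra ?N ?G by unfold_locales (rule subG)
  have mfi [measurable]: "(\<lambda>z :: (real ^ 'd) \<times> (real ^ 'd). fst z $ i) \<in> borel_measurable borel"
    and msi [measurable]: "(\<lambda>z :: (real ^ 'd) \<times> (real ^ 'd). snd z $ i) \<in> borel_measurable borel" for i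
    by (intro borel_measurable_continuous_onI continuous_intros)+
  have int1: "integrable M (\<lambda>\<omega>. X\<^sub>1 \<omega> $ i)" and int2: "integrable M (\<lambda>\<omega>. X\<^sub>2 \<omega> $ i)" for i
    using i1 i2 by (auto intro: integrable_bounded_linear[OF bounded_linear_vec_nth])
  have nf: "integrable ?N fst" and ns: "integrable ?N snd"
    using i1 i2 by (simp_all add: integrable_distr_eq)
  have intf: "integrable ?N (\<lambda>z. fst z $ i)" and ints: "integrable ?N (\<lambda>z. snd z $ i)" for i
    using nf ns by (auto intro: integrable_bounded_linear[OF bounded_linear_vec_nth])
  have "AE z in ?N. real_cond_exp ?N ?G (\<lambda>z. snd z $ i) z = fst z $ i" for i
  proof (rule SG.real_cond_exp_charact)
    fix A assume "A \<in> sets ?G"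
    then obtain B where B [measurable]: "B \<in> sets borel" and A: "A = fst -` B"
      by (auto simp: sets_vimage_algebra2)
    let ?A' = "X\<^sub>1 -` B \<inter> space M"
    have A': "?A' \<in> sets ?F" by (auto simp: sets_vimage_algebra2)
    have A'M: "?A' \<in> sets M" by measurable
    have AN: "A \<in> sets borel" unfolding A using mf B by (metis measurable_sets_borel)
    have ind: "indicator A (?Z \<omega>) = (indicator ?A' \<omega> :: real)" if "\<omega> \<in> space M" for \<omega>
      using that by (auto simp: A indicator_def)
    have "(\<integral>z\<in>A. snd z $ i \<partial>?N) = (\<integral>\<omega>. indicator A (?Z \<omega>) *\<^sub>R (snd (?Z \<omega>) $ i) \<partial>M)"
      unfolding set_lebesgue_integral_def using AN
      by (intro integral_distr mZ borel_measurable_scaleR borel_measurable_indicator mfi msi)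
    also have "\<dots> = (\<integral>\<omega>\<in>?A'. X\<^sub>2 \<omega> $ i \<partial>M)"
      unfolding set_lebesgue_integral_def using ind by (intro Bochner_Integration.integral_cong) auto
    also have "\<dots> = (\<integral>\<omega>\<in>?A'. real_cond_exp M ?F (\<lambda>\<omega>. X\<^sub>2 \<omega> $ i) \<omega> \<partial>M)"
      by (rule SF.real_cond_exp_intA[OF int2 A'])
    also have "\<dots> = (\<integral>\<omega>\<in>?A'. X\<^sub>1 \<omega> $ i \<partial>M)"
    proof (rule set_lebesgue_integral_cong_AE[OF A'M])
      show "AE x\<in>?A' in M. real_cond_exp M ?F (\<lambda>\<omega>. X\<^sub>2 \<omega> $ i) x = X\<^sub>1 x $ i"
        using ae by eventually_elim (auto simp: vec_cond_exp_def vec_eq_iff)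
    qed (use int1 in auto)
    also have "\<dots> = (\<integral>\<omega>. indicator A (?Z \<omega>) *\<^sub>R (fst (?Z \<omega>) $ i) \<partial>M)"
      unfolding set_lebesgue_integral_def using ind by (intro Bochner_Integration.integral_cong) auto
    also have "\<dots> = (\<integral>z\<in>A. fst z $ i \<partial>?N)"
      unfolding set_lebesgue_integral_def using AN
      by (intro integral_distr[symmetric] mZ borel_measurable_scaleR borel_measurable_indicator mfi msi)
    finally show "(\<integral>z\<in>A. snd z $ i \<partial>?N) = (\<integral>z\<in>A. fst z $ i \<partial>?N)" .
  next
    have "(fst :: (real ^ 'd) \<times> (real ^ 'd) \<Rightarrow> _) \<in> ?G \<rightarrow>\<^sub>M borel"
      by (intro measurable_vimage_algebra1) auto
    then show "(\<lambda>z. fst z $ i) \<in> borel_measurable ?G"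
      by (rule measurable_compose)
        (auto intro!: borel_measurable_continuous_onI continuous_intros)
  qed (use intf ints in auto)
  then have "AE z in ?N. \<forall>i. real_cond_exp ?N ?G (\<lambda>z. snd z $ i) z = fst z $ i"
    by (simp add: AE_all_countable)
  then have "AE z in ?N. vec_cond_exp ?N ?G snd z = fst z"
    by eventually_elim (simp add: vec_cond_exp_def vec_eq_iff)
  then show ?thesis
    using nf ns N.prob_space_axioms by (simp add: martingale_pair_def)
qed

lemma is_martingale_couplingI:
  fixes X\<^sub>1 X\<^sub>2 :: "'w \<Rightarrow> real ^ 'd"
  assumes "is_coupling \<gamma> \<mu> \<nu>" "martingale_pair M X\<^sub>1 X\<^sub>2"
    and "\<gamma> = distr M borel (\<lambda>\<omega>. (X\<^sub>1 \<omega>, X\<^sub>2 \<omega>))"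
  shows "is_martingale_coupling \<gamma> \<mu> \<nu>"
proof -
  have "martingale_pair \<gamma> fst snd"
    using martingale_pair_distr[OF assms(2)] assms(3) by simp
  moreover have "\<gamma> = distr \<gamma> borel (\<lambda>z. (fst z, snd z))"
    using distr_id2[of borel \<gamma>] assms(1) by (simp add: is_coupling_def id_def)
  ultimately show ?thesis
    unfolding is_martingale_coupling_def using assms(1) by blast
qed

definition lower_semicontinuous :: "('a :: topological_space \<Rightarrow> ereal) \<Rightarrow> bool" where
  "lower_semicontinuous f \<longleftrightarrow> (\<forall>x. f x \<le> Liminf (at x) f)"

text \<open>
  The integral of the positive part minus the integral of the negative part.  The convention
  \<open>\<infinity> - \<infinity> = \<infinity>\<close> of \<^typ>\<open>ereal\<close> is irrelevant when the negative part is integrable, as it is for a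
  cost bounded below by \<open>- C (1 + |x| + |y|)\<close> under a coupling of measures with finite first
  moments.
\<close>

definition ereal_integral :: "'a measure \<Rightarrow> ('a \<Rightarrow> ereal) \<Rightarrow> ereal" where
  "ereal_integral \<mu> f =
    enn2ereal (\<integral>\<^sup>+x. e2ennreal (f x) \<partial>\<mu>) - enn2ereal (\<integral>\<^sup>+x. e2ennreal (- f x) \<partial>\<mu>)"

end

theory Submission
  imports Defs
begin

text \<open>
  Couplings and martingale couplings of \<open>P\<close> and \<open>Q\<close> are the solutions of countably many linear
  constraints \<open>\<mu>(f\<^sub>i) \<le> t\<^sub>i\<close> with continuous \<open>f\<^sub>i\<close> of linear growth.  The moment constraints make
  approximate solutions tight and uniformly integrable, so by compactness the constraints can be
  solved iff any finitely many of them can be solved approximately by a uniform distribution on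
  finitely many points of a fixed countable dense set.  This has two consequences.  First, by
  separation, a martingale coupling can fail to exist only if there is a dual certificate, and that
  would yield a convex function violating \<open>P \<le>\<^sub>c\<^sub>x Q\<close>.  Second, solvability is a measurable condition on the
  numbers \<open>t\<^sub>i\<close>, so the minimum of \<open>\<mu>(h)\<close> is measurable in the parameter for every lower
  semicontinuous \<open>h\<close> of linear growth from below.  Minimising first \<open>c\<close> and then, one after the other, the
  members of a countable measure-determining family leaves a single minimiser, which is therefore
  a measurable function of the parameter.
\<close>

section \<open>Sequential compactness for measures with bounded first moment\<close>

text \<open>Compactness gives a minimiser for each parameter; the obstacle is to choose it
  measurably. Only optimal values are followed through the parameter, and a measure is picked once,
  at the end, when nothing is left to choose. This requires every value to be an attained minimum:
  then "the infimum is at most y" is the solvability of one system of constraints, not a condition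
  on uncountably many candidates. The cost enters as a supremum of continuous functions, so that a
  bound on \<mu>(c), finite or infinite, is again a list of linear constraints. For exact solutions
  the moment bounds follow from the marginals, but an approximate solution sees only finitely many
  bounded test functions, and a vanishing mass far away could still carry a fixed amount of first
  moment. Weak compactness is carried over from the real line by a continuous curve through the
  whole space. The curve has a measurable right inverse of linear growth, so a bounded first moment
  of the measures makes their images on the line tight.\<close>

definition pulse :: "real \<Rightarrow> real" where
  "pulse t = max 0 (min 1 (1/2 - cos (pi * t)))"

text \<open>For a 0-1 sequence this is the point of the Cantor set whose ternary digits are
  \<open>2 * b k\<close>. The gaps of the Cantor set leave room for a continuous function to read
  off the digits.\<close>

definition ternary :: "(nat \<Rightarrow> real) \<Rightarrow> real" where
  "ternary b = (\<Sum>k. 2 * b k / 3 ^ Suc k)"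

lemma ternary_summable:
  fixes b :: "nat \<Rightarrow> real"
  assumes "\<And>k. 0 \<le> b k \<and> b k \<le> 1"
  shows "summable (\<lambda>k. 2 * b k / 3 ^ Suc k)"
proof (rule summable_comparison_test')
  show "summable (\<lambda>k. 2 / 3 * (1 / 3 :: real) ^ k)"
    by (intro summable_mult summable_geometric) simp
  show "norm (2 * b n / 3 ^ Suc n) \<le> 2 / 3 * (1 / 3 :: real) ^ n" if "n \<ge> 0" for n
    using assms[of n] by (simp add: field_simps power_divide)
qed

lemma ternary_bounds:
  fixes b :: "nat \<Rightarrow> real"
  assumes "\<And>k. 0 \<le> b k \<and> b k \<le> 1"
  shows "0 \<le> ternary b" "ternary b \<le> 1"
proof -
  note s = ternary_summable[OF assms]
  show "0 \<le> ternary b"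
    unfolding ternary_def by (rule suminf_nonneg[OF s]) (use assms in simp)
  have g: "(\<lambda>k. 2 / 3 * (1 / 3 :: real) ^ k) sums (2 / 3 * (1 / (1 - 1 / 3)))"
    by (intro sums_mult geometric_sums) simp
  have "ternary b \<le> (\<Sum>k. 2 / 3 * (1 / 3 :: real) ^ k)"
    unfolding ternary_def
  proof (rule suminf_le[OF _ s])
    show "2 * b n / 3 ^ Suc n \<le> 2 / 3 * (1 / 3) ^ n" for n
      using assms[of n] by (simp add: field_simps power_divide)
    show "summable (\<lambda>k. 2 / 3 * (1 / 3 :: real) ^ k)" using g by (rule sums_summable)
  qed
  also have "\<dots> = 1" using sums_unique[OF g] by simp
  finally show "ternary b \<le> 1" .
qed

text \<open>Multiplication by \<open>3 ^ k\<close> moves digit \<open>k\<close> directly behind the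
  point. What stands before the point is an even integer, since all digits are 0 or 2, and
  disappears by the period 2 of \<open>cos (pi * t)\<close>. The remainder lies in [0, 1/3] or in
  [2/3, 1] according to the digit. There \<open>pulse\<close>, a cosine version of Schoenberg's
  function, is constantly 0 or 1, because the cosine is 1/2 at \<open>pi / 3\<close> and -1/2 at
  \<open>2 * pi / 3\<close>.\<close>

lemma pulse_ternary:
  fixes b :: "nat \<Rightarrow> real"
  assumes b: "\<And>k. b k = 0 \<or> b k = 1"
  shows "pulse (3 ^ k * (2 * real N + ternary b)) = b k"
proof -
  have b01: "0 \<le> b k \<and> b k \<le> 1" for k using b[of k] by auto
  define r where "r = ternary (\<lambda>i. b (i + Suc k)) / 3"
  have r: "0 \<le> r" "r \<le> 1 / 3"
    using ternary_bounds[of "\<lambda>i. b (i + Suc k)"] b01 by (auto simp: r_def)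
  have "ternary b = (\<Sum>i. 2 * b (i + Suc k) / 3 ^ Suc (i + Suc k)) + (\<Sum>i<Suc k. 2 * b i / 3 ^ Suc i)"
    unfolding ternary_def by (rule suminf_split_initial_segment[OF ternary_summable[OF b01]])
  also have "(\<Sum>i. 2 * b (i + Suc k) / 3 ^ Suc (i + Suc k)) = ternary (\<lambda>i. b (i + Suc k)) / 3 ^ Suc k"
    unfolding ternary_def
    by (subst suminf_divide[symmetric, OF ternary_summable]) (use b01 in \<open>auto simp: power_add field_simps\<close>)
  finally have "3 ^ k * ternary b = r + 3 ^ k * (\<Sum>i<Suc k. 2 * b i / 3 ^ Suc i)"
    by (simp add: r_def algebra_simps)
  also have "3 ^ k * (\<Sum>i<Suc k. 2 * b i / 3 ^ Suc i) = 2 * b k / 3 + (\<Sum>i<k. 2 * (b i * 3 ^ (k - Suc i)))"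
  proof -
    have "3 ^ k * (2 * b i / 3 ^ Suc i) = 2 * (b i * 3 ^ (k - Suc i))" if "i < k" for i
      using power_add[of "3::real" "Suc i" "k - Suc i"] that by (simp add: field_simps)
    then show ?thesis by (simp add: distrib_left sum_distrib_left)
  qed
  finally have e: "3 ^ k * ternary b = r + 2 * b k / 3 + 2 * (\<Sum>i<k. b i * 3 ^ (k - Suc i))"
    by (simp add: sum_distrib_left)
  obtain c :: "nat \<Rightarrow> nat" where c: "\<And>k. b k = real (c k)"
  proof
    show "b k = real (if b k = 0 then 0 else 1)" for k using b[of k] by auto
  qed
  define M where "M = (\<Sum>i<k. c i * 3 ^ (k - Suc i)) + 3 ^ k * N"
  have M: "3 ^ k * (2 * real N + ternary b) = r + 2 * b k / 3 + 2 * real M"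
    unfolding distrib_left e by (simp add: M_def c)
  define u where "u = r + 2 * b k / 3"
  have "cos (pi * (3 ^ k * (2 * real N + ternary b))) = cos (pi * u + 2 * real M * pi)"
    unfolding M u_def by (simp add: algebra_simps)
  also have "\<dots> = cos (pi * u)"
    using cos_int_2pin[of "int M"] sin_int_2pin[of "int M"] unfolding cos_add by (simp add: mult.commute mult.left_commute)
  finally have co: "cos (pi * (3 ^ k * (2 * real N + ternary b))) = cos (pi * u)" .
  show ?thesis
  proof (cases "b k = 0")
    case True
    then have "cos (pi * u) \<ge> cos (pi / 3)"
      using r by (intro cos_monotone_0_pi_le) (auto simp: u_def)
    then show ?thesis unfolding pulse_def co using True by (simp add: cos_60)
  next
    case False
    then have bk: "b k = 1" using b[of k] by auto
    then have "cos (pi * u) \<le> cos (2 * pi / 3)"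
      using r by (intro cos_monotone_0_pi_le) (auto simp: u_def field_simps)
    then show ?thesis unfolding pulse_def co using bk by (simp add: cos_120)
  qed
qed

definition binary_digit :: "real \<Rightarrow> nat \<Rightarrow> real" where
  "binary_digit y i = real_of_int \<lfloor>2 * (2 ^ i * y)\<rfloor> - 2 * real_of_int \<lfloor>2 ^ i * y\<rfloor>"

lemma binary_digit_cases: "binary_digit y i = 0 \<or> binary_digit y i = 1"
proof -
  have "\<lfloor>2 * (2 ^ i * y)\<rfloor> = 2 * \<lfloor>2 ^ i * y\<rfloor> \<or> \<lfloor>2 * (2 ^ i * y)\<rfloor> = 2 * \<lfloor>2 ^ i * y\<rfloor> + 1"
    by linarith
  then show ?thesis unfolding binary_digit_def by auto
qed

text \<open>The partial sums telescope to \<open>2 ^ n * y\<close> rounded down and divided by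
  \<open>2 ^ n\<close>. At \<open>y = 1\<close> all digits would be 0, hence the strict upper
  bound.\<close>

lemma binary_digit_sums:
  assumes "0 \<le> y" "y < 1"
  shows "(\<lambda>i. binary_digit y i / 2 ^ Suc i) sums y"
proof -
  have part: "(\<Sum>i<n. binary_digit y i / 2 ^ Suc i) = real_of_int \<lfloor>2 ^ n * y\<rfloor> / 2 ^ n" for n
  proof (induction n)
    case 0
    have "\<lfloor>y\<rfloor> = 0" using assms by linarith
    then show ?case by simp
  next
    case (Suc n)
    then show ?case by (simp add: binary_digit_def field_simps mult.assoc)
  qed
  have "(\<lambda>n. real_of_int \<lfloor>2 ^ n * y\<rfloor> / 2 ^ n) \<longlonglongrightarrow> y"
  proof (rule real_tendsto_sandwich)
    show "\<forall>\<^sub>F n in sequentially. y - (1/2) ^ n \<le> real_of_int \<lfloor>2 ^ n * y\<rfloor> / 2 ^ n"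
    proof (rule always_eventually, rule allI)
      fix n show "y - (1/2) ^ n \<le> real_of_int \<lfloor>2 ^ n * y\<rfloor> / 2 ^ n"
        using divide_right_mono[OF real_of_int_floor_add_one_ge[of "2 ^ n * y"], of "2 ^ n"]
        by (simp add: add_divide_distrib power_divide)
    qed
    show "\<forall>\<^sub>F n in sequentially. real_of_int \<lfloor>2 ^ n * y\<rfloor> / 2 ^ n \<le> y"
      by (rule always_eventually) (simp add: field_simps)
    show "(\<lambda>n. y - (1/2) ^ n) \<longlonglongrightarrow> y"
      using tendsto_diff[OF tendsto_const[of y] LIMSEQ_power_zero[of "1/2::real"]] by simp
  qed simp
  then show ?thesis unfolding sums_def part .
qed

text \<open>Constant N on [2N, 2N + 1], rising linearly to N + 1 on [2N + 1, 2N + 2]. On a flat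
  piece the curve runs through a cube of fixed size; the ramps join consecutive sizes continuously.
  The pieces start at even integers because \<open>pulse\<close> has period 2.\<close>

definition staircase :: "real \<Rightarrow> real" where
  "staircase t = real_of_int \<lfloor>t / 2\<rfloor> + max 0 (t - 2 * real_of_int \<lfloor>t / 2\<rfloor> - 1)"

lemma staircase_lipschitz:
  assumes "a \<le> b" shows "\<bar>staircase b - staircase a\<bar> \<le> b - a"
proof -
  define i j where "i = \<lfloor>a/2\<rfloor>" and "j = \<lfloor>b/2\<rfloor>"
  have ij: "i \<le> j" unfolding i_def j_def using assms by (intro floor_mono) simp
  have 1: "real_of_int i \<le> a / 2" "a / 2 < real_of_int i + 1" "real_of_int j \<le> b / 2" "b / 2 < real_of_int j + 1"
    unfolding i_def j_def by linarith+
  consider "i = j" | "real_of_int i + 1 \<le> real_of_int j" using ij by linarith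
  then show ?thesis unfolding staircase_def i_def[symmetric] j_def[symmetric]
    using 1 assms by cases (auto simp: max_def abs_if)
qed

lemma continuous_staircase: "continuous_on UNIV staircase"
  unfolding continuous_on_iff
proof (intro ballI allI impI)
  fix x e :: real assume "0 < e"
  then show "\<exists>d>0. \<forall>x'\<in>UNIV. dist x' x < d \<longrightarrow> dist (staircase x') (staircase x) < e"
    using staircase_lipschitz by (intro exI[of _ e]) (smt (verit) dist_real_def)
qed

lemma staircase_flat:
  assumes "0 \<le> u" "u \<le> 1" shows "staircase (2 * real N + u) = real N"
proof -
  have "\<lfloor>(2 * real N + u) / 2\<rfloor> = int N" using assms by (intro floor_unique) auto
  then show ?thesis using assms by (simp add: staircase_def)
qed

text \<open>Schoenberg's space-filling curve, scaled by a staircase so that it fills the whole space: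
  on \<open>[2N, 2N + 1]\<close> it fills the cube \<open>[-N, N]^d\<close>.\<close>

lemma space_filling_curve:
  obtains h :: "real \<Rightarrow> 'a :: euclidean_space" and s :: "'a \<Rightarrow> real"
  where "continuous_on UNIV h" "s \<in> borel_measurable borel" "\<And>x. h (s x) = x"
    "\<And>x. \<bar>s x\<bar> \<le> 3 + 2 * norm x"
proof -
  \<comment> \<open>The binary digits of all coordinates are interleaved into one sequence, indexed
    by pairs of a basis vector and a position.\<close>
  define A where "A = (Basis :: 'a set) \<times> (UNIV :: nat set)"
  have A: "countable A" "A \<noteq> {}" unfolding A_def by (auto simp: countable_finite)
  define h :: "real \<Rightarrow> 'a" where
    "h t = (\<Sum>e\<in>Basis. (staircase t * (2 * (\<Sum>i. pulse (3 ^ to_nat_on A (e, i) * t) / 2 ^ Suc i) - 1)) *\<^sub>R e)" for t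
  \<comment> \<open>The added 1 makes \<open>norm x < N x\<close> strict, so that the rescaled
    coordinates \<open>y x e\<close> stay below 1, as \<open>binary_digit_sums\<close>
    requires.\<close>
  define N where "N x = nat \<lfloor>norm x\<rfloor> + 1" for x :: 'a
  define y where "y x e = ((x \<bullet> e) / real (N x) + 1) / 2" for x e :: 'a
  define b where "b x k = (case from_nat_into A k of (e, i) \<Rightarrow> binary_digit (y x e) i)" for x k
  define s where "s x = 2 * real (N x) + ternary (b x)" for x
  have bc: "b x k = 0 \<or> b x k = 1" for x k
    using binary_digit_cases unfolding b_def by (auto split: prod.splits)
  then have b01: "0 \<le> b x k \<and> b x k \<le> 1" for x k by (metis order.refl zero_le_one)
  have Nr: "real (N x) = real_of_int \<lfloor>norm x\<rfloor> + 1" for x by (simp add: N_def)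
  have Nx: "norm x < real (N x)" for x unfolding Nr by linarith
  have y01: "0 \<le> y x e \<and> y x e < 1" if "e \<in> Basis" for x e
  proof -
    have "\<bar>x \<bullet> e\<bar> < real (N x)" using Basis_le_norm[OF that, of x] Nx[of x] by linarith
    moreover have "0 < real (N x)" unfolding N_def by linarith
    ultimately have "-1 < (x \<bullet> e) / real (N x)" "(x \<bullet> e) / real (N x) < 1"
      by (auto simp: field_simps)
    then show ?thesis unfolding y_def by simp
  qed
  have cont: "continuous_on UNIV h"
  proof -
    have "continuous_on UNIV (\<lambda>t. \<Sum>i. pulse (3 ^ to_nat_on A (e, i) * t) / 2 ^ Suc i)" for e
    proof (rule uniform_limit_theorem)
      show "\<forall>\<^sub>F n in sequentially. continuous_on UNIV (\<lambda>t. \<Sum>i<n. pulse (3 ^ to_nat_on A (e, i) * t) / 2 ^ Suc i)"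
        unfolding pulse_def by (intro always_eventually allI continuous_intros) auto
      show "uniform_limit UNIV (\<lambda>n t. \<Sum>i<n. pulse (3 ^ to_nat_on A (e, i) * t) / 2 ^ Suc i)
              (\<lambda>t. \<Sum>i. pulse (3 ^ to_nat_on A (e, i) * t) / 2 ^ Suc i) sequentially"
      proof (rule Weierstrass_m_test)
        show "norm (pulse (3 ^ to_nat_on A (e, n) * x) / 2 ^ Suc n) \<le> (1/2) ^ Suc n" for n x
          by (simp add: pulse_def field_simps power_divide)
        show "summable (\<lambda>n. (1/2::real) ^ Suc n)" by (subst summable_Suc_iff) (rule summable_geometric, simp)
      qed
    qed simp
    then show ?thesis unfolding h_def by (intro continuous_intros continuous_staircase)
  qed
  have meas: "s \<in> borel_measurable borel"
  proof -
    have "(\<lambda>x. b x k) \<in> borel_measurable borel" for k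
      unfolding b_def y_def Nr binary_digit_def by (cases "from_nat_into A k") simp
    then show ?thesis unfolding s_def Nr ternary_def by measurable
  qed
  have inv: "h (s x) = x" for x
  proof -
    have "staircase (s x) = real (N x)"
      unfolding s_def using ternary_bounds[of "b x"] b01 by (intro staircase_flat) auto
    moreover have "(\<Sum>i. pulse (3 ^ to_nat_on A (e, i) * s x) / 2 ^ Suc i) = y x e" if "e \<in> Basis" for e
    proof -
      have "pulse (3 ^ to_nat_on A (e, i) * s x) = binary_digit (y x e) i" for i
        unfolding s_def using that A by (subst pulse_ternary[OF bc]) (simp add: b_def A_def)
      then show ?thesis using sums_unique[OF binary_digit_sums] y01[OF that, of x] by simp
    qed
    moreover have "real (N x) * (2 * y x e - 1) = x \<bullet> e" for e
    proof -
      have "N x \<noteq> 0" by (simp add: N_def)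
      then show ?thesis by (simp add: y_def field_simps)
    qed
    ultimately show ?thesis unfolding h_def by (simp add: euclidean_representation)
  qed
  \<comment> \<open>The constants come from N x \<le> norm x + 1 and ternary \<le> 1. Linear growth
    of \<open>s\<close> is what transports tightness to the line.\<close>
  have bd: "\<bar>s x\<bar> \<le> 3 + 2 * norm x" for x
  proof -
    have "real_of_int \<lfloor>norm x\<rfloor> \<le> norm x" by simp
    moreover have "0 \<le> real_of_int \<lfloor>norm x\<rfloor>" by simp
    moreover have "0 \<le> ternary (b x)" "ternary (b x) \<le> 1" using ternary_bounds[of "b x"] b01 by auto
    moreover have "\<bar>2 * (a + 1) + t\<bar> \<le> 3 + 2 * n" if "a \<le> n" "0 \<le> a" "0 \<le> t" "t \<le> 1" for a t n :: real
      using that by (simp add: abs_if)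
    ultimately show ?thesis unfolding s_def Nr by blast
  qed
  show ?thesis by (rule that[OF cont meas inv bd])
qed

text \<open>Skorohod's representation is inherited from the real line through the curve.\<close>

lemma moment_bounded_skorohod:
  fixes \<mu> :: "nat \<Rightarrow> 'a :: euclidean_space measure"
  assumes prob: "\<And>n. prob_space (\<mu> n)" and sets: "\<And>n. sets (\<mu> n) = sets borel"
    and int: "\<And>n. integrable (\<mu> n) norm" and bound: "\<And>n. (\<integral>x. norm x \<partial>\<mu> n) \<le> R"
  obtains r :: "nat \<Rightarrow> nat" and \<Omega> :: "real measure" and X :: "nat \<Rightarrow> real \<Rightarrow> 'a" and Y
  where "strict_mono r" "prob_space \<Omega>" "\<And>n. X n \<in> borel_measurable \<Omega>" "Y \<in> borel_measurable \<Omega>"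
    "\<And>n. distr \<Omega> borel (X n) = \<mu> (r n)" "\<And>\<omega>. \<omega> \<in> space \<Omega> \<Longrightarrow> (\<lambda>n. X n \<omega>) \<longlonglongrightarrow> Y \<omega>"
proof -
  obtain h :: "real \<Rightarrow> 'a" and s where h: "continuous_on UNIV h"
    and s [measurable]: "s \<in> borel_measurable borel" and hs: "\<And>x. h (s x) = x"
    and sb: "\<And>x. \<bar>s x\<bar> \<le> 3 + 2 * norm x"
    by (rule space_filling_curve) blast
  have hm [measurable]: "h \<in> borel_measurable borel" by (rule borel_measurable_continuous_onI[OF h])
  define \<nu> where "\<nu> n = distr (\<mu> n) borel s" for n
  note [measurable_cong] = sets
  have spc [simp]: "space (\<mu> n) = UNIV" for n using sets_eq_imp_space_eq[OF sets[of n]] by simp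
  have rd: "real_distribution (\<nu> n)" for n
    unfolding real_distribution_def real_distribution_axioms_def \<nu>_def
    using prob_space.prob_space_distr[OF prob[of n], of s borel] by (simp add: measurable_def[symmetric])
  have R0: "0 \<le> R" using order_trans[OF Bochner_Integration.integral_nonneg bound] by auto
  have "tight \<nu>" unfolding tight_def
  proof (intro conjI allI impI rd)
    fix e :: real assume e: "e > 0"
    \<comment> \<open>Markov's inequality bounds the mass outside the ball of radius
      \<open>a\<close> by R / a < e. Inside it, |s x| < 3 + 2a, which is below K = 4 + 2a.\<close>
    define a where "a = (R + 1) / e"
    have a: "0 < a" using R0 e by (simp add: a_def)
    define K where "K = 4 + 2 * a"
    have K: "K > 0" using a by (simp add: K_def)
    have "measure (\<nu> n) {-K<..K} > 1 - e" for n
    proof -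
      interpret prob_space "\<mu> n" by (rule prob)
      have "measure (\<mu> n) {x \<in> space (\<mu> n). norm x \<ge> a} \<le> (\<integral>x. norm x \<partial>\<mu> n) / a"
        by (rule integral_Markov_inequality_measure[OF int]) (use a in auto)
      also have "\<dots> \<le> R / a" using bound a by (intro divide_right_mono) auto
      also have "\<dots> < e" using R0 e by (simp add: a_def field_simps)
      finally have m: "measure (\<mu> n) {x. norm x \<ge> a} < e" by simp
      have "1 - measure (\<mu> n) {x. norm x \<ge> a} = measure (\<mu> n) (space (\<mu> n) - {x. norm x \<ge> a})"
        by (subst prob_compl) auto
      also have "\<dots> \<le> measure (\<mu> n) (s -` {-K<..K} \<inter> space (\<mu> n))"
      proof (rule finite_measure_mono)
        show "space (\<mu> n) - {x. norm x \<ge> a} \<subseteq> s -` {-K<..K} \<inter> space (\<mu> n)"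
        proof
          fix x assume "x \<in> space (\<mu> n) - {x. norm x \<ge> a}"
          then show "x \<in> s -` {-K<..K} \<inter> space (\<mu> n)" using sb[of x] by (auto simp: K_def abs_le_iff)
        qed
      qed measurable
      also have "\<dots> = measure (\<nu> n) {-K<..K}" unfolding \<nu>_def by (subst measure_distr) auto
      finally show ?thesis using m by linarith
    qed
    then show "\<exists>a b. a < b \<and> (\<forall>n. 1 - e < measure (\<nu> n) {a<..b})" using K by (intro exI[of _ "-K"] exI[of _ K]) auto
  qed
  then obtain r M where r: "strict_mono (r :: nat \<Rightarrow> nat)" and M: "real_distribution M"
    and "weak_conv_m (\<nu> \<circ> id \<circ> r) M"
    using tight_imp_convergent_subsubsequence[of \<nu> id] by (auto simp: strict_mono_id)
  then have w: "weak_conv_m (\<lambda>n. \<nu> (r n)) M" by (simp add: comp_def)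
  obtain \<Omega> :: "real measure" and Z :: "nat \<Rightarrow> real \<Rightarrow> real" and Z' where \<Omega>: "prob_space \<Omega>"
    and Z [measurable]: "\<And>n. Z n \<in> borel_measurable \<Omega>" and dZ: "\<And>n. distr \<Omega> borel (Z n) = \<nu> (r n)"
    and Z' [measurable]: "Z' \<in> borel_measurable \<Omega>" and lim: "\<And>\<omega>. \<omega> \<in> space \<Omega> \<Longrightarrow> (\<lambda>n. Z n \<omega>) \<longlonglongrightarrow> Z' \<omega>"
    using Skorohod[OF rd M w] by force
  \<comment> \<open>Since \<open>h\<close> inverts \<open>s\<close>, applying \<open>h\<close>
    restores the original laws. The limit \<open>Z'\<close> may leave the range of \<open>s\<close>,
    but \<open>h\<close> is continuous on the whole line; of \<open>s\<close> only measurability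
    matters here.\<close>
  show ?thesis
  proof (rule that[OF r \<Omega>])
    show "(\<lambda>\<omega>. h (Z n \<omega>)) \<in> borel_measurable \<Omega>" for n by measurable
    show "(\<lambda>\<omega>. h (Z' \<omega>)) \<in> borel_measurable \<Omega>" by measurable
    have "distr \<Omega> borel (\<lambda>\<omega>. h (Z n \<omega>)) = distr (\<nu> (r n)) borel h" for n
      unfolding dZ[symmetric] by (subst distr_distr) (auto simp: comp_def)
    also have "\<dots> n = distr (\<mu> (r n)) borel (h \<circ> s)" for n
      unfolding \<nu>_def by (subst distr_distr) auto
    also have "\<dots> n = \<mu> (r n)" for n using distr_id2[OF sets[of "r n", symmetric]] by (simp add: comp_def hs id_def)
    finally show "distr \<Omega> borel (\<lambda>\<omega>. h (Z n \<omega>)) = \<mu> (r n)" for n .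
    show "(\<lambda>n. h (Z n \<omega>)) \<longlonglongrightarrow> h (Z' \<omega>)" if "\<omega> \<in> space \<Omega>" for \<omega>
      using h lim[OF that] by (auto intro: continuous_on_tendsto_compose)
  qed
qed

section \<open>Passage to the limit under the integral\<close>

lemma fatou_eventually:
  fixes f :: "'a \<Rightarrow> real"
  assumes int: "\<And>n. integrable M (F n)" "integrable M f"
    and nonneg: "\<And>n x. x \<in> space M \<Longrightarrow> 0 \<le> F n x"
    and lim: "\<And>x. x \<in> space M \<Longrightarrow> (\<lambda>n. F n x) \<longlonglongrightarrow> f x" and e: "0 < e"
  shows "eventually (\<lambda>n. (\<integral>x. f x \<partial>M) - e < (\<integral>x. F n x \<partial>M)) sequentially"
\<comment> \<open>A negative threshold is split off because the conversion to \<open>ennreal\<close>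
  would truncate it to 0.\<close>
proof (cases "(\<integral>x. f x \<partial>M) - e < 0")
  case True
  then show ?thesis using nonneg
    by (intro always_eventually allI) (meson Bochner_Integration.integral_nonneg order_less_le_trans)
next
  case False
  have f0: "0 \<le> f x" if "x \<in> space M" for x
    using LIMSEQ_le_const[OF lim[OF that]] nonneg[OF that] by blast
  have "ennreal ((\<integral>x. f x \<partial>M) - e) < ennreal (\<integral>x. f x \<partial>M)"
    using False e by (intro ennreal_lessI) auto
  also have "\<dots> = (\<integral>\<^sup>+x. ennreal (f x) \<partial>M)"
    using f0 by (intro nn_integral_eq_integral[symmetric] int) auto
  also have "\<dots> = (\<integral>\<^sup>+x. liminf (\<lambda>n. ennreal (F n x)) \<partial>M)"
    by (intro nn_integral_cong) (metis lim tendsto_ennrealI lim_imp_Liminf trivial_limit_sequentially)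
  also have "\<dots> \<le> liminf (\<lambda>n. \<integral>\<^sup>+x. ennreal (F n x) \<partial>M)"
    using int(1) by (intro nn_integral_liminf) auto
  also have "(\<lambda>n. \<integral>\<^sup>+x. ennreal (F n x) \<partial>M) = (\<lambda>n. ennreal (\<integral>x. F n x \<partial>M))"
    using nonneg by (intro ext nn_integral_eq_integral int) auto
  finally have "eventually (\<lambda>n. ennreal ((\<integral>x. f x \<partial>M) - e) < ennreal (\<integral>x. F n x \<partial>M)) sequentially"
    by (rule less_LiminfD)
  then show ?thesis
    by eventually_elim (use False in \<open>simp add: ennreal_less_iff\<close>)
qed

text \<open>Dominated convergence with a varying dominating function (Pratt's lemma).\<close>

lemma integral_varying_dominated_convergence:
  fixes f g :: "'a \<Rightarrow> real"
  assumes F: "\<And>n. F n \<in> borel_measurable M" and f: "f \<in> borel_measurable M"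
    and G: "\<And>n. integrable M (G n)" and g: "integrable M g"
    and bd: "\<And>n x. x \<in> space M \<Longrightarrow> \<bar>F n x\<bar> \<le> G n x"
    and limF: "\<And>x. x \<in> space M \<Longrightarrow> (\<lambda>n. F n x) \<longlonglongrightarrow> f x"
    and limG: "\<And>x. x \<in> space M \<Longrightarrow> (\<lambda>n. G n x) \<longlonglongrightarrow> g x"
    and limsup: "\<And>e. e > 0 \<Longrightarrow> eventually (\<lambda>n. (\<integral>x. G n x \<partial>M) \<le> (\<integral>x. g x \<partial>M) + e) sequentially"
  shows "integrable M f" "(\<lambda>n. \<integral>x. F n x \<partial>M) \<longlonglongrightarrow> (\<integral>x. f x \<partial>M)"
proof -
  have iF: "integrable M (F n)" for n
  proof (rule Bochner_Integration.integrable_bound[OF G[of n] F], rule AE_I2)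
    show "norm (F n x) \<le> norm (G n x)" if "x \<in> space M" for x using bd[OF that, of n] by simp
  qed
  have fg: "\<bar>f x\<bar> \<le> g x" if "x \<in> space M" for x
    by (rule LIMSEQ_le[OF tendsto_rabs[OF limF] limG]) (use that bd in auto)
  show iF': "integrable M f"
  proof (rule Bochner_Integration.integrable_bound[OF g f], rule AE_I2)
    show "norm (f x) \<le> norm (g x)" if "x \<in> space M" for x using fg[OF that] by simp
  qed
  show "(\<lambda>n. \<integral>x. F n x \<partial>M) \<longlonglongrightarrow> (\<integral>x. f x \<partial>M)"
  proof (rule tendstoI)
    fix e :: real assume e: "e > 0"
    have nn: "0 \<le> G n x + F n x" "0 \<le> G n x - F n x" if "x \<in> space M" for n x
      using bd[OF that, of n] by auto
    \<comment> \<open>Fatou's lemma for the nonnegative functions G + F and G - F bounds the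
      integral of F from both sides, in terms of that of G. A one-sided bound on the latter then
      suffices; each step costs e / 2.\<close>
    have "eventually (\<lambda>n. (\<integral>x. g x + f x \<partial>M) - e / 2 < (\<integral>x. G n x + F n x \<partial>M)) sequentially"
    proof (rule fatou_eventually)
      show "0 < e / 2" using e by simp
    qed (use G g iF iF' nn in \<open>auto intro!: tendsto_add limF limG\<close>)
    moreover have "eventually (\<lambda>n. (\<integral>x. g x - f x \<partial>M) - e / 2 < (\<integral>x. G n x - F n x \<partial>M)) sequentially"
    proof (rule fatou_eventually)
      show "0 < e / 2" using e by simp
    qed (use G g iF iF' nn in \<open>auto intro!: tendsto_diff limF limG\<close>)
    moreover have "eventually (\<lambda>n. (\<integral>x. G n x \<partial>M) \<le> (\<integral>x. g x \<partial>M) + e / 2) sequentially"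
      using limsup[of "e/2"] e by simp
    ultimately show "eventually (\<lambda>n. dist (\<integral>x. F n x \<partial>M) (\<integral>x. f x \<partial>M) < e) sequentially"
    proof eventually_elim
      case (elim n)
      then show ?case using G[of n] g iF[of n] iF' by (simp add: dist_real_def abs_less_iff)
    qed
  qed
qed

section \<open>A countable family of test functions\<close>

text \<open>The functions are approximations from below of the indicators of the finite intersections of
  a countable base.\<close>

lemma countable_test_functions:
  "\<exists>(t :: nat \<Rightarrow> 'a :: {metric_space, second_countable_topology} \<Rightarrow> real) (\<U> :: 'a set set).
    Int_stable \<U> \<and> UNIV \<in> \<U> \<and> sets borel = sigma_sets UNIV \<U> \<and>
    (\<forall>j. continuous_on UNIV (t j)) \<and> (\<forall>j x. 0 \<le> t j x \<and> t j x \<le> 1) \<and>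
    (\<forall>U\<in>\<U>. \<exists>j. \<forall>x. (\<lambda>k :: nat. t (j k) x) \<longlonglongrightarrow> indicator U x)"
proof -
  obtain B :: "'a set set" where B: "countable B" "topological_basis B"
    using ex_countable_basis by auto
  define \<U> where "\<U> = Inter ` {F. finite F \<and> F \<subseteq> B}"
  have cU: "countable \<U>" unfolding \<U>_def
    using countable_Collect_finite_subset[OF B(1)] by (simp add: conj_commute)
  have UU: "UNIV \<in> \<U>" unfolding \<U>_def by (rule image_eqI[of _ _ "{}"]) auto
  have open_U: "open U" if "U \<in> \<U>" for U
    using that topological_basis_open[OF B(2)] by (auto simp: \<U>_def intro!: open_Inter)
  have BU: "B \<subseteq> \<U>"
  proof
    fix b assume "b \<in> B" then show "b \<in> \<U>" unfolding \<U>_def by (intro image_eqI[of _ _ "{b}"]) auto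
  qed
  have st: "Int_stable \<U>"
  proof (rule Int_stableI)
    fix a b assume "a \<in> \<U>" "b \<in> \<U>"
    then obtain F G where "finite F" "F \<subseteq> B" "a = \<Inter>F" "finite G" "G \<subseteq> B" "b = \<Inter>G" by (auto simp: \<U>_def)
    then show "a \<inter> b \<in> \<U>" unfolding \<U>_def by (intro image_eqI[of _ _ "F \<union> G"]) auto
  qed
  have sb: "sets borel = sigma_sets UNIV \<U>"
  proof
    have "sets borel = sigma_sets UNIV B" unfolding borel_eq_countable_basis[OF B] by (rule sets_measure_of) simp
    then show "sets borel \<subseteq> sigma_sets UNIV \<U>" using sigma_sets_mono'[OF BU] by auto
    show "sigma_sets UNIV \<U> \<subseteq> sets borel"
      using open_U by (intro sets.sigma_sets_subset[of _ borel, simplified]) auto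
  qed
  \<comment> \<open>The whole space is treated apart since \<open>infdist\<close> to the empty set
    is 0 by convention.\<close>
  define \<phi> where "\<phi> U k x = (if U = UNIV then 1 else min 1 (real k * infdist x (- U)))" for U :: "'a set" and k :: nat and x
  define t where "t j = (case prod_decode j of (i, k) \<Rightarrow> \<phi> (from_nat_into \<U> i) k)" for j
  have c\<phi>: "continuous_on UNIV (\<phi> U k)" for U k unfolding \<phi>_def by (cases "U = UNIV") (auto intro!: continuous_intros)
  have b\<phi>: "0 \<le> \<phi> U k x \<and> \<phi> U k x \<le> 1" for U k x by (auto simp: \<phi>_def infdist_nonneg)
  have l\<phi>: "(\<lambda>k. \<phi> U k x) \<longlonglongrightarrow> indicator U x" if "open U" for U x
  proof (cases "U = UNIV")
    case True then show ?thesis by (simp add: \<phi>_def)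
  next
    case False
    show ?thesis
    proof (cases "x \<in> U")
      case True
      have "infdist x (- U) \<noteq> 0" using False True that in_closed_iff_infdist_zero[of "-U" x] by auto
      then have pos: "0 < infdist x (- U)" using infdist_nonneg[of x "-U"] by linarith
      obtain K :: nat where K: "real K * infdist x (- U) > 1" using reals_Archimedean3[OF pos] by blast
      have "eventually (\<lambda>k. \<phi> U k x = 1) sequentially"
        using eventually_ge_at_top[of K]
      proof eventually_elim
        case (elim k)
        then have "real K * infdist x (- U) \<le> real k * infdist x (- U)" using pos by (intro mult_right_mono) auto
        then show ?case using K False by (simp add: \<phi>_def)
      qed
      then show ?thesis using True by (simp add: tendsto_eventually)
    next
      case nx: False
      then have "infdist x (- U) = 0" by (intro infdist_zero) auto
      then show ?thesis using nx False by (simp add: \<phi>_def)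
    qed
  qed
  have "\<exists>j. \<forall>x. (\<lambda>k :: nat. t (j k) x) \<longlonglongrightarrow> indicator U x" if U: "U \<in> \<U>" for U
  proof -
    obtain i where "U = from_nat_into \<U> i" using from_nat_into_surj[OF cU U] by auto
    then have "t (prod_encode (i, k)) x = \<phi> U k x" for k x by (simp add: t_def)
    then show ?thesis using l\<phi>[OF open_U[OF U]] by (intro exI[of _ "\<lambda>k. prod_encode (i, k)"]) simp
  qed
  moreover have "continuous_on UNIV (t j)" "0 \<le> t j x \<and> t j x \<le> 1" for j x
    using c\<phi> b\<phi> by (auto simp: t_def split: prod.splits)
  ultimately show ?thesis using st UU sb by blast
qed

text \<open>One fixed choice for each type: the same constant tests the marginals on the space and
  the joint laws on its square.\<close>

definition test_fun :: "nat \<Rightarrow> 'a :: {metric_space, second_countable_topology} \<Rightarrow> real" where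
  "test_fun = (SOME t. \<exists>\<U>.
    Int_stable \<U> \<and> UNIV \<in> \<U> \<and> sets borel = sigma_sets UNIV \<U> \<and>
    (\<forall>j. continuous_on UNIV (t j)) \<and> (\<forall>j x. 0 \<le> t j x \<and> t j x \<le> 1) \<and>
    (\<forall>U\<in>\<U>. \<exists>j. \<forall>x. (\<lambda>k :: nat. t (j k) x) \<longlonglongrightarrow> indicator U x))"

lemma test_fun_spec:
  "\<exists>\<U> :: 'a :: {metric_space, second_countable_topology} set set.
    Int_stable \<U> \<and> UNIV \<in> \<U> \<and> sets borel = sigma_sets UNIV \<U> \<and>
    (\<forall>j. continuous_on UNIV (test_fun j :: 'a \<Rightarrow> real)) \<and> (\<forall>j x. 0 \<le> test_fun j (x :: 'a) \<and> test_fun j x \<le> 1) \<and>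
    (\<forall>U\<in>\<U>. \<exists>j. \<forall>x. (\<lambda>k :: nat. test_fun (j k) x) \<longlonglongrightarrow> indicator U x)"
  unfolding test_fun_def by (rule someI_ex[OF countable_test_functions])

lemma continuous_test_fun: "continuous_on UNIV (test_fun j)"
  using test_fun_spec by blast

lemma test_fun_bounds: "0 \<le> test_fun j x" "test_fun j x \<le> 1"
  using test_fun_spec by blast+

lemma abs_test_fun: "\<bar>test_fun j x\<bar> = test_fun j x"
  by (simp add: test_fun_bounds)

lemma test_fun_measurable [measurable]: "test_fun j \<in> borel_measurable borel"
  by (rule borel_measurable_continuous_onI[OF continuous_test_fun])

lemma integrable_test_fun:
  assumes "prob_space M" "f \<in> borel_measurable M"
  shows "integrable M (\<lambda>x. test_fun j (f x))"
proof -
  interpret prob_space M by fact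
  show ?thesis using assms(2) by (intro integrable_const_bound[of _ 1]) (auto simp: test_fun_bounds)
qed

section \<open>Determination of measures, kernels and conditional expectations by the test
  functions\<close>

lemma integral_test_fun_tendsto:
  fixes f :: "'b \<Rightarrow> real" and X :: "'b \<Rightarrow> 'a :: {metric_space, second_countable_topology}"
  assumes f: "integrable M f" and X [measurable]: "X \<in> borel_measurable M"
    and U [measurable]: "U \<in> sets borel"
    and j: "\<And>x. (\<lambda>k :: nat. test_fun (j k) x) \<longlonglongrightarrow> indicator U x"
  shows "(\<lambda>k. \<integral>\<omega>. test_fun (j k) (X \<omega>) * f \<omega> \<partial>M) \<longlonglongrightarrow> (\<integral>\<omega>. indicator U (X \<omega>) * f \<omega> \<partial>M)"
proof (rule integral_dominated_convergence[where w="\<lambda>\<omega>. \<bar>f \<omega>\<bar>"])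
  have [measurable]: "f \<in> borel_measurable M" using f by auto
  show "(\<lambda>\<omega>. indicator U (X \<omega>) * f \<omega>) \<in> borel_measurable M" by measurable
  show "(\<lambda>\<omega>. test_fun (j k) (X \<omega>) * f \<omega>) \<in> borel_measurable M" for k by measurable
  show "AE \<omega> in M. norm (test_fun (j k) (X \<omega>) * f \<omega>) \<le> \<bar>f \<omega>\<bar>" for k
    by (rule AE_I2) (simp add: abs_mult abs_test_fun mult_left_le_one_le test_fun_bounds)
  show "AE \<omega> in M. (\<lambda>k. test_fun (j k) (X \<omega>) * f \<omega>) \<longlonglongrightarrow> indicator U (X \<omega>) * f \<omega>"
    by (rule AE_I2) (rule tendsto_mult_right[OF j])
qed (use f in simp)

text \<open>Dynkin's argument for the signed measure with density \<open>f\<close>, transported by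
  \<open>X\<close>. It vanishes on the intersection-stable generator as a limit of test integrals.
  The complement step needs its total mass to be 0, and this is the generator member
  \<open>UNIV\<close>.\<close>

lemma integral_indicator_times_eq_0:
  fixes f :: "'b \<Rightarrow> real" and X :: "'b \<Rightarrow> 'a :: {metric_space, second_countable_topology}"
  assumes f: "integrable M f" and X [measurable]: "X \<in> borel_measurable M"
    and 0: "\<And>j. (\<integral>\<omega>. test_fun j (X \<omega>) * f \<omega> \<partial>M) = 0" and B: "B \<in> sets borel"
  shows "(\<integral>\<omega>. indicator B (X \<omega>) * f \<omega> \<partial>M) = 0"
proof -
  obtain \<U> :: "'a set set" where U: "Int_stable \<U>" "UNIV \<in> \<U>" "sets borel = sigma_sets UNIV \<U>"
    and lim: "\<And>U. U \<in> \<U> \<Longrightarrow> \<exists>j. \<forall>x. (\<lambda>k :: nat. test_fun (j k) x) \<longlonglongrightarrow> indicator U x"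
    using test_fun_spec by blast
  have fm [measurable]: "f \<in> borel_measurable M" using f by auto
  have Usets: "U \<in> sets borel" if "U \<in> \<U>" for U using that U(3) by (auto intro: sigma_sets.Basic)
  have base: "(\<integral>\<omega>. indicator U (X \<omega>) * f \<omega> \<partial>M) = 0" if U': "U \<in> \<U>" for U
  proof -
    obtain j where j: "\<And>x. (\<lambda>k :: nat. test_fun (j k) x) \<longlonglongrightarrow> indicator U x" using lim[OF U'] by blast
    have "(\<lambda>k. \<integral>\<omega>. test_fun (j k) (X \<omega>) * f \<omega> \<partial>M) \<longlonglongrightarrow> (\<integral>\<omega>. indicator U (X \<omega>) * f \<omega> \<partial>M)"
      by (rule integral_test_fun_tendsto[OF f X Usets[OF U'] j])
    then show ?thesis unfolding 0 by (simp add: LIMSEQ_const_iff)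
  qed
  have PU: "\<U> \<subseteq> Pow UNIV" by simp
  have "B \<in> sigma_sets UNIV \<U>" using B U(3) by simp
  then show ?thesis
  proof (induction rule: sigma_sets_induct_disjoint[OF U(1) PU, consumes 1, case_names basic empty compl union])
    case (basic A) then show ?case by (rule base)
  next
    case empty then show ?case by simp
  next
    case (compl A)
    then have [measurable]: "A \<in> sets borel" using U(3) by simp
    have "(\<integral>\<omega>. indicator (UNIV - A) (X \<omega>) * f \<omega> \<partial>M) = (\<integral>\<omega>. f \<omega> - indicator A (X \<omega>) * f \<omega> \<partial>M)"
      by (intro Bochner_Integration.integral_cong) (auto simp: indicator_def)
    also have "\<dots> = 0"
      using base[OF U(2)] compl f integrable_mult_indicator[OF _ f, of "X -` A \<inter> space M"]
      by (subst Bochner_Integration.integral_diff)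
        (auto intro!: Bochner_Integration.integrable_bound[OF f] simp: indicator_def)
    finally show ?case .
  next
    case (union A)
    then have [measurable]: "\<And>i. A i \<in> sets borel" using U(3) by auto
    have [measurable]: "\<Union>(range A) \<in> sets borel" by (intro sets.countable_UN) auto
    have "(\<lambda>n. \<integral>\<omega>. (\<Sum>i<n. indicator (A i) (X \<omega>)) * f \<omega> \<partial>M) \<longlonglongrightarrow> (\<integral>\<omega>. indicator (\<Union>(range A)) (X \<omega>) * f \<omega> \<partial>M)"
    proof (rule integral_dominated_convergence[where w="\<lambda>\<omega>. \<bar>f \<omega>\<bar>"])
      have ind: "(\<lambda>i. indicator (A i) x :: real) sums indicator (\<Union>(range A)) x" for x
        using union(1) by (intro indicator_sums) (auto simp: disjoint_family_on_def)
      then show "AE \<omega> in M. (\<lambda>n. (\<Sum>i<n. indicator (A i) (X \<omega>)) * f \<omega>) \<longlonglongrightarrow> indicator (\<Union>(range A)) (X \<omega>) * f \<omega>"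
        by (intro AE_I2 tendsto_mult tendsto_const) (simp add: sums_def)
      have "(\<Sum>i<n. indicator (A i) x :: real) \<le> indicator (\<Union>(range A)) x" for n x
        using sum_le_suminf[OF sums_summable[OF ind], of "{..<n}"] sums_unique[OF ind, of x] by simp
      then have "(\<Sum>i<n. indicator (A i) x :: real) \<le> 1" for n x
        by (rule order_trans) (simp add: indicator_def)
      then show "AE \<omega> in M. norm ((\<Sum>i<n. indicator (A i) (X \<omega>)) * f \<omega>) \<le> \<bar>f \<omega>\<bar>" for n
        by (intro AE_I2) (auto simp: abs_mult sum_nonneg intro!: mult_left_le_one_le)
    qed (use f in auto)
    moreover have "(\<integral>\<omega>. (\<Sum>i<n. indicator (A i) (X \<omega>)) * f \<omega> \<partial>M) = 0" for n
    proof -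
      have "(\<integral>\<omega>. (\<Sum>i<n. indicator (A i) (X \<omega>)) * f \<omega> \<partial>M) = (\<Sum>i<n. \<integral>\<omega>. indicator (A i) (X \<omega>) * f \<omega> \<partial>M)"
        unfolding sum_distrib_right
        by (intro Bochner_Integration.integral_sum Bochner_Integration.integrable_bound[OF f]) (auto simp: indicator_def)
      also have "\<dots> = 0" using union by simp
      finally show ?thesis .
    qed
    ultimately show ?case by (simp add: LIMSEQ_const_iff)
  qed
qed

lemma prob_eqI_test_fun:
  fixes M N :: "'a :: {metric_space, second_countable_topology} measure"
  assumes M: "prob_space M" "sets M = sets borel" and N: "prob_space N" "sets N = sets borel"
    and eq: "\<And>j. (\<integral>x. test_fun j x \<partial>M) = (\<integral>x. test_fun j x \<partial>N)"
  shows "M = N"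
proof -
  obtain \<U> :: "'a set set" where U: "Int_stable \<U>" "UNIV \<in> \<U>" "sets borel = sigma_sets UNIV \<U>"
    and lim: "\<And>U. U \<in> \<U> \<Longrightarrow> \<exists>j. \<forall>x. (\<lambda>k :: nat. test_fun (j k) x) \<longlonglongrightarrow> indicator U x"
    using test_fun_spec by blast
  interpret M: prob_space M by fact
  interpret N: prob_space N by fact
  note [measurable_cong] = M(2) N(2)
  show ?thesis
  proof (rule measure_eqI_generator_eq[OF U(1), of UNIV _ _ "\<lambda>_. UNIV"])
    fix A assume A: "A \<in> \<U>"
    then have [measurable]: "A \<in> sets borel" using U(3) by (auto intro: sigma_sets.Basic)
    obtain j where j: "\<And>x. (\<lambda>k :: nat. test_fun (j k) x) \<longlonglongrightarrow> indicator A x" using lim[OF A] by blast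
    have "(\<lambda>k. \<integral>x. test_fun (j k) x \<partial>M) \<longlonglongrightarrow> (\<integral>x. indicator A x \<partial>M)"
      using integral_test_fun_tendsto[OF _ _ _ j, of M "\<lambda>_. 1" "\<lambda>x. x"] by simp
    moreover have "(\<lambda>k. \<integral>x. test_fun (j k) x \<partial>N) \<longlonglongrightarrow> (\<integral>x. indicator A x \<partial>N)"
      using integral_test_fun_tendsto[OF _ _ _ j, of N "\<lambda>_. 1" "\<lambda>x. x"] by simp
    ultimately have "(\<integral>x. indicator A x \<partial>M) = (\<integral>x. indicator A x \<partial>N :: real)"
      unfolding eq by (rule LIMSEQ_unique)
    then show "emeasure M A = emeasure N A"
      using sets_eq_imp_space_eq[OF M(2)] sets_eq_imp_space_eq[OF N(2)]
      by (simp add: M.emeasure_eq_measure N.emeasure_eq_measure)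
  qed (use U M N in auto)
qed

lemma measurable_prob_algebra_test_fun:
  fixes K :: "'s \<Rightarrow> 'a :: {metric_space, second_countable_topology} measure"
  assumes K: "\<And>\<theta>. \<theta> \<in> space S \<Longrightarrow> prob_space (K \<theta>) \<and> sets (K \<theta>) = sets borel"
    and m: "\<And>j. (\<lambda>\<theta>. \<integral>x. test_fun j x \<partial>K \<theta>) \<in> borel_measurable S"
  shows "K \<in> S \<rightarrow>\<^sub>M prob_algebra borel"
proof -
  obtain \<U> :: "'a set set" where U: "Int_stable \<U>" "UNIV \<in> \<U>" "sets borel = sigma_sets UNIV \<U>"
    and lim: "\<And>U. U \<in> \<U> \<Longrightarrow> \<exists>j. \<forall>x. (\<lambda>k :: nat. test_fun (j k) x) \<longlonglongrightarrow> indicator U x"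
    using test_fun_spec by blast
  show ?thesis
  proof (rule measurable_prob_algebra_generated[OF U(3) U(1)])
    fix A assume A: "A \<in> \<U>"
    then have [measurable]: "A \<in> sets borel" using U(3) by (auto intro: sigma_sets.Basic)
    obtain j where j: "\<And>x. (\<lambda>k :: nat. test_fun (j k) x) \<longlonglongrightarrow> indicator A x" using lim[OF A] by blast
    have "(\<lambda>\<theta>. measure (K \<theta>) A) \<in> borel_measurable S"
    proof (rule borel_measurable_LIMSEQ_metric[OF m])
      fix \<theta> assume \<theta>: "\<theta> \<in> space S"
      interpret prob_space "K \<theta>" using K[OF \<theta>] by blast
      have [measurable_cong]: "sets (K \<theta>) = sets borel" using K[OF \<theta>] by blast
      have "(\<lambda>k. \<integral>x. test_fun (j k) x \<partial>K \<theta>) \<longlonglongrightarrow> (\<integral>x. indicator A x \<partial>K \<theta>)"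
        using integral_test_fun_tendsto[OF _ _ _ j, of "K \<theta>" "\<lambda>_. 1" "\<lambda>x. x"] by simp
      moreover have "space (K \<theta>) = UNIV" using K[OF \<theta>] sets_eq_imp_space_eq[of "K \<theta>" borel] by simp
      ultimately show "(\<lambda>k. \<integral>x. test_fun (j k) x \<partial>K \<theta>) \<longlonglongrightarrow> measure (K \<theta>) A" by simp
    qed
    then have "(\<lambda>\<theta>. ennreal (measure (K \<theta>) A)) \<in> borel_measurable S" by measurable
    then show "(\<lambda>\<theta>. emeasure (K \<theta>) A) \<in> borel_measurable S"
      by (rule measurable_cong[THEN iffD1, rotated])
        (use K in \<open>auto simp: finite_measure.emeasure_eq_measure prob_space.finite_measure\<close>)
  qed (use K in auto)
qed

section \<open>Separation and finite averages\<close>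

text \<open>The proof is the Hilbert space argument: a minimising sequence for the distance is Cauchy by
  the parallelogram law, and its limit gives the separating functional.\<close>

lemma midpoint_separation:
  fixes A :: "(nat \<Rightarrow> real) set" and t :: "nat \<Rightarrow> real"
  assumes ne: "A \<noteq> {}"
    and mid: "\<And>a b. a \<in> A \<Longrightarrow> b \<in> A \<Longrightarrow> \<exists>c\<in>A. \<forall>i<n. c i = (a i + b i) / 2"
    and e: "0 < e" and far: "\<And>a. a \<in> A \<Longrightarrow> \<exists>i<n. e < \<bar>a i - t i\<bar>"
  obtains l \<delta> where "0 < \<delta>" "\<And>a. a \<in> A \<Longrightarrow> \<delta> \<le> (\<Sum>i<n. l i * (a i - t i))"
proof -
  define q where "q a = (\<Sum>i<n. (a i - t i)\<^sup>2)" for a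
  define m where "m = Inf (q ` A)"
  have qe: "e\<^sup>2 \<le> q a" if "a \<in> A" for a
  proof -
    obtain i where i: "i < n" "e < \<bar>a i - t i\<bar>" using far[OF \<open>a \<in> A\<close>] by auto
    have "e\<^sup>2 \<le> (a i - t i)\<^sup>2" using i e abs_le_square_iff[of e "a i - t i"] by simp
    also have "\<dots> \<le> q a" unfolding q_def using i by (intro member_le_sum) auto
    finally show ?thesis .
  qed
  have bdd: "bdd_below (q ` A)" using qe by (auto simp: bdd_below_def)
  have "e\<^sup>2 \<le> m" unfolding m_def using qe ne by (intro cInf_greatest) auto
  then have m0: "0 < m" using e by (smt (verit) zero_less_power)
  have mq: "m \<le> q a" if "a \<in> A" for a unfolding m_def using that bdd by (intro cInf_lower) auto
  have "\<exists>a\<in>A. q a < m + 1 / real (Suc k)" for k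
  proof -
    have "Inf (q ` A) < m + 1 / real (Suc k)" unfolding m_def by simp
    then show ?thesis using cInf_lessD[of "q ` A"] ne by auto
  qed
  then obtain a where a: "\<And>k. a k \<in> A" and aq: "\<And>k. q (a k) < m + 1 / real (Suc k)" by metis
  \<comment> \<open>The midpoint of two almost minimal vectors is again at squared distance at least
    \<open>m\<close>; by the parallelogram law little room is left for their difference.\<close>
  have para: "(\<Sum>i<n. (a k i - a l i)\<^sup>2) \<le> 2 / real (Suc k) + 2 / real (Suc l)" for k l
  proof -
    obtain c where c: "c \<in> A" "\<forall>i<n. c i = (a k i + a l i) / 2" using mid[OF a a] by blast
    have "q c = (\<Sum>i<n. (a k i - t i)\<^sup>2 / 2 + (a l i - t i)\<^sup>2 / 2 - (a k i - a l i)\<^sup>2 / 4)"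
    proof -
      have "((x + y) / 2 - z)\<^sup>2 = (x - z)\<^sup>2 / 2 + (y - z)\<^sup>2 / 2 - (x - y)\<^sup>2 / 4" for x y z :: real
        by (simp add: power2_eq_square field_simps)
      then show ?thesis unfolding q_def by (intro sum.cong refl) (metis c(2) lessThan_iff)
    qed
    also have "\<dots> = q (a k) / 2 + q (a l) / 2 - (\<Sum>i<n. (a k i - a l i)\<^sup>2) / 4"
      by (simp add: q_def sum.distrib sum_subtractf sum_divide_distrib)
    finally show ?thesis using mq[OF c(1)] aq[of k] aq[of l] by simp
  qed
  have conv: "convergent (\<lambda>k. a k i)" if i: "i < n" for i
  proof (rule Cauchy_convergent, rule metric_CauchyI)
    fix d :: real assume d: "0 < d"
    obtain K where K: "4 / real (Suc K) < d\<^sup>2"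
    proof -
      obtain K where "4 / d\<^sup>2 < real K" using reals_Archimedean2 by blast
      then have "4 / d\<^sup>2 < real (Suc K)" by simp
      then show ?thesis using d that[of K] by (simp add: field_simps)
    qed
    show "\<exists>M. \<forall>m\<ge>M. \<forall>n\<ge>M. dist (a m i) (a n i) < d"
    proof (intro exI[of _ K] allI impI)
      fix k l assume kl: "K \<le> k" "K \<le> l"
      have "(a k i - a l i)\<^sup>2 \<le> (\<Sum>i<n. (a k i - a l i)\<^sup>2)" using i by (intro member_le_sum) auto
      also note para[of k l]
      also have "2 / real (Suc k) + 2 / real (Suc l) \<le> 2 / real (Suc K) + 2 / real (Suc K)"
        using kl by (intro add_mono divide_left_mono) auto
      also have "\<dots> < d\<^sup>2" using K by simp
      finally show "dist (a k i) (a l i) < d"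
        using d abs_le_square_iff[of d "a k i - a l i"] by (auto simp: dist_real_def not_le[symmetric])
    qed
  qed
  define u where "u i = lim (\<lambda>k. a k i) - t i" for i
  have u: "(\<lambda>k. a k i - t i) \<longlonglongrightarrow> u i" if "i < n" for i
    unfolding u_def using conv[OF that] by (intro tendsto_diff tendsto_const) (simp add: convergent_LIMSEQ_iff)
  have qu: "(\<lambda>k. q (a k)) \<longlonglongrightarrow> (\<Sum>i<n. (u i)\<^sup>2)"
    unfolding q_def by (intro tendsto_sum tendsto_power u) auto
  have um: "(\<Sum>i<n. (u i)\<^sup>2) \<le> m"
  proof (rule LIMSEQ_le[OF qu])
    show "(\<lambda>k. m + 1 / real (Suc k)) \<longlonglongrightarrow> m" using LIMSEQ_Suc[OF lim_const_over_n[of 1]] tendsto_add[OF tendsto_const[of m]] by force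
    show "\<exists>N. \<forall>n\<ge>N. q (a n) \<le> m + 1 / real (Suc n)" using aq less_imp_le by blast
  qed
  have mu: "m \<le> (\<Sum>i<n. (u i)\<^sup>2)" by (rule LIMSEQ_le_const[OF qu]) (use mq a in auto)
  \<comment> \<open>Iterated midpoints with the fixed endpoint \<open>b\<close> yield the dyadic
    weights \<open>1 / 2 ^ j\<close>. These tend to 0, which is all that the first variation below
    asks of convexity.\<close>
  have step: "\<exists>c\<in>A. \<forall>i<n. c i = (1 - 1 / 2 ^ j) * b i + 1 / 2 ^ j * b' i" if b: "b \<in> A" "b' \<in> A" for b b' j
  proof (induction j)
    case 0 then show ?case using b by auto
  next
    case (Suc j)
    then obtain c where c: "c \<in> A" "\<forall>i<n. c i = (1 - 1 / 2 ^ j) * b i + 1 / 2 ^ j * b' i" by auto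
    obtain d where "d \<in> A" "\<forall>i<n. d i = (b i + c i) / 2" using mid[OF b(1) c(1)] by auto
    then show ?case using c(2) by (intro bexI[of _ d]) (auto simp: field_simps)
  qed
  show ?thesis
  proof (rule that[OF m0])
    fix b assume b: "b \<in> A"
    define v where "v i = b i - t i" for i
    \<comment> \<open>The limit \<open>u + t\<close> need not belong to the set, so minimality is
      tested along the sequence \<open>a k\<close> and only then passed to \<open>u\<close>.
      Dividing by the weight and letting it tend to 0 shows that \<open>u\<close> has a nonnegative
      inner product with \<open>v - u\<close>; hence \<open>u\<close> separates, with gap
      \<open>m\<close>.\<close>
    have "m \<le> (\<Sum>i<n. ((1 - 1 / 2 ^ j) * u i + 1 / 2 ^ j * v i)\<^sup>2)" for j :: nat
    proof (rule LIMSEQ_le_const)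
      show "(\<lambda>k. \<Sum>i<n. ((1 - 1 / 2 ^ j) * (a k i - t i) + 1 / 2 ^ j * v i)\<^sup>2) \<longlonglongrightarrow>
          (\<Sum>i<n. ((1 - 1 / 2 ^ j) * u i + 1 / 2 ^ j * v i)\<^sup>2)"
        by (intro tendsto_intros u) auto
      have "m \<le> (\<Sum>i<n. ((1 - 1 / 2 ^ j) * (a k i - t i) + 1 / 2 ^ j * v i)\<^sup>2)" for k
      proof -
        obtain c where c: "c \<in> A" "\<forall>i<n. c i = (1 - 1 / 2 ^ j) * a k i + 1 / 2 ^ j * b i"
          using step[OF a b] by blast
        have "q c = (\<Sum>i<n. ((1 - 1 / 2 ^ j) * (a k i - t i) + 1 / 2 ^ j * v i)\<^sup>2)"
        proof -
          have "(1 - s) * x + s * y - z = (1 - s) * (x - z) + s * (y - z)" for s x y z :: real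
            by (simp add: algebra_simps)
          then show ?thesis unfolding q_def v_def by (intro sum.cong refl) (metis c(2) lessThan_iff)
        qed
        then show ?thesis using mq[OF c(1)] by simp
      qed
      then show "\<exists>N. \<forall>k\<ge>N. m \<le> (\<Sum>i<n. ((1 - 1 / 2 ^ j) * (a k i - t i) + 1 / 2 ^ j * v i)\<^sup>2)" by blast
    qed
    also have "(\<Sum>i<n. ((1 - 1 / 2 ^ j) * u i + 1 / 2 ^ j * v i)\<^sup>2) =
        (\<Sum>i<n. (u i)\<^sup>2) + 1 / 2 ^ j * (2 * (\<Sum>i<n. u i * (v i - u i)) + 1 / 2 ^ j * (\<Sum>i<n. (v i - u i)\<^sup>2))" for j :: nat
    proof -
      have "((1 - s) * x + s * y)\<^sup>2 = x\<^sup>2 + s * (2 * (x * (y - x)) + s * (y - x)\<^sup>2)" for s x y :: real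
        by (simp add: power2_eq_square algebra_simps)
      then show ?thesis by (simp only: sum.distrib sum_distrib_left[symmetric])
    qed
    finally have scaled: "0 \<le> 1 / 2 ^ j * (2 * (\<Sum>i<n. u i * (v i - u i)) + 1 / 2 ^ j * (\<Sum>i<n. (v i - u i)\<^sup>2))" for j :: nat
      using um by (smt (verit))
    have *: "0 \<le> 2 * (\<Sum>i<n. u i * (v i - u i)) + (1 / 2) ^ j * (\<Sum>i<n. (v i - u i)\<^sup>2)" for j :: nat
    proof -
      have "0 \<le> y" if "0 \<le> 1 / 2 ^ j * y" for y :: real
        using mult_left_mono[OF that, of "2 ^ j"] by simp
      then show ?thesis unfolding power_one_over using scaled by blast
    qed
    have "(\<lambda>j. 2 * (\<Sum>i<n. u i * (v i - u i)) + (1 / 2) ^ j * (\<Sum>i<n. (v i - u i)\<^sup>2)) \<longlonglongrightarrow>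
        2 * (\<Sum>i<n. u i * (v i - u i)) + 0 * (\<Sum>i<n. (v i - u i)\<^sup>2)"
      by (intro tendsto_intros LIMSEQ_power_zero) simp
    then have "0 \<le> 2 * (\<Sum>i<n. u i * (v i - u i))"
      using LIMSEQ_le_const[of _ _ 0] * by fastforce
    then have "(\<Sum>i<n. (u i)\<^sup>2) \<le> (\<Sum>i<n. u i * v i)"
      by (simp add: right_diff_distrib sum_subtractf power2_eq_square)
    then show "m \<le> (\<Sum>i<n. u i * (b i - t i))" using mu by (simp add: v_def)
  qed
qed

section \<open>Uniform distributions on finite lists of dense points\<close>

definition dense_point :: "nat \<Rightarrow> 'a :: second_countable_topology" where
  "dense_point = (SOME z. \<forall>X. open X \<longrightarrow> X \<noteq> {} \<longrightarrow> (\<exists>k. z k \<in> X))"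

lemma dense_point: 
  assumes "open X" "X \<noteq> {}" shows "\<exists>k. dense_point k \<in> (X :: 'a :: second_countable_topology set)"
proof -
  obtain D :: "'a set" where D: "countable D" "\<forall>X. open X \<longrightarrow> X \<noteq> {} \<longrightarrow> (\<exists>d\<in>D. d \<in> X)"
    using countable_dense_exists by auto
  then have "D \<noteq> {}" using open_UNIV by blast
  then have "\<forall>X. open X \<longrightarrow> X \<noteq> {} \<longrightarrow> (\<exists>k. from_nat_into D k \<in> X)"
    using D from_nat_into_surj[OF D(1)] by metis
  then show ?thesis
    unfolding dense_point_def using someI_ex[of "\<lambda>z :: nat \<Rightarrow> 'a. \<forall>X. open X \<longrightarrow> X \<noteq> {} \<longrightarrow> (\<exists>k. z k \<in> X)"] assms by blast
qed

text \<open>Lists of indices form a countable type, so that a quantifier over them preserves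
  measurability. Repeated entries provide rational weights.\<close>

definition list_avg :: "('a :: second_countable_topology \<Rightarrow> real) \<Rightarrow> nat list \<Rightarrow> real" where
  "list_avg f l = (\<Sum>k\<leftarrow>l. f (dense_point k)) / real (length l)"

definition list_measure :: "nat list \<Rightarrow> 'a :: second_countable_topology measure" where
  "list_measure l = distr (measure_pmf (pmf_of_set {..<length l})) borel (\<lambda>i. dense_point (l ! i))"

lemma list_measure:
  assumes "l \<noteq> []"
  shows "prob_space (list_measure l)" "sets (list_measure l) = sets borel"
    and "f \<in> borel_measurable borel \<Longrightarrow> integrable (list_measure l) (f :: 'a :: second_countable_topology \<Rightarrow> real)"
    and "f \<in> borel_measurable borel \<Longrightarrow> (\<integral>x. f x \<partial>list_measure l) = list_avg f l"
proof -
  show "prob_space (list_measure l)" unfolding list_measure_def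
    by (intro measure_pmf.prob_space_distr) simp
  show "sets (list_measure l) = sets borel" by (simp add: list_measure_def)
  have fin: "finite (set_pmf (pmf_of_set {..<length l}))"
    using assms by (subst set_pmf_of_set) (auto simp: lessThan_empty_iff)
  assume f: "f \<in> borel_measurable borel"
  show "integrable (list_measure l) f" unfolding list_measure_def
    by (subst integrable_distr_eq[OF _ f]) (auto intro: integrable_measure_pmf_finite[OF fin])
  have "(\<integral>x. f x \<partial>list_measure l) = (\<integral>i. f (dense_point (l ! i)) \<partial>measure_pmf (pmf_of_set {..<length l}))"
    unfolding list_measure_def by (subst integral_distr[OF _ f]) auto
  also have "\<dots> = (\<Sum>i<length l. f (dense_point (l ! i))) / real (length l)"
    using assms by (subst integral_pmf_of_set) auto
  also have "\<dots> = list_avg f l"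
    by (simp add: list_avg_def sum_list_sum_nth atLeast0LessThan)
  finally show "(\<integral>x. f x \<partial>list_measure l) = list_avg f l" .
qed

text \<open>Each list is repeated as often as the other one is long. Both halves then have the same
  length and count equally in the average.\<close>

lemma list_avg_midpoint:
  assumes "l1 \<noteq> []" "l2 \<noteq> []"
  obtains l where "l \<noteq> []" "\<And>f. list_avg f l = (list_avg f l1 + list_avg f l2) / 2"
proof
  let ?l = "concat (replicate (length l2) l1) @ concat (replicate (length l1) l2)"
  show "?l \<noteq> []" using assms by auto
  have 1: "sum_list (map g (concat (replicate n l))) = real n * sum_list (map g l)" for g :: "nat \<Rightarrow> real" and n l
    by (induction n) (auto simp: algebra_simps)
  have 2: "length (concat (replicate n l)) = n * length l" for n and l :: "nat list"
    by (induction n) auto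
  show "list_avg f ?l = (list_avg f l1 + list_avg f l2) / 2" for f
    using assms unfolding list_avg_def map_append sum_list_append 1 length_append 2
    by (simp add: field_simps)
qed

text \<open>Otherwise the vector \<open>t\<close> could be separated from the vectors of averages.
  Singleton lists turn the separating functional into a pointwise inequality at the dense points,
  continuity extends it to the whole space, and \<open>dual\<close> then contradicts the positive
  gap. So a moment problem is approximately solvable as soon as its target satisfies every linear
  inequality that holds pointwise.\<close>

lemma list_avg_approximation:
  fixes f :: "nat \<Rightarrow> 'a :: second_countable_topology \<Rightarrow> real"
  assumes cont: "\<And>i. i < n \<Longrightarrow> continuous_on UNIV (f i)" and e: "0 < e"
    and dual: "\<And>l a. (\<And>x. a \<le> (\<Sum>i<n. l i * f i x)) \<Longrightarrow> a \<le> (\<Sum>i<n. l i * t i)"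
  obtains l where "l \<noteq> []" "\<And>i. i < n \<Longrightarrow> \<bar>list_avg (f i) l - t i\<bar> \<le> e"
proof (rule ccontr)
  note found = that
  assume "\<not> thesis"
  then have far: "\<exists>i<n. e < \<bar>list_avg (f i) l - t i\<bar>" if "l \<noteq> []" for l
    using that found[of l] by (meson not_le)
  let ?A = "(\<lambda>l i. list_avg (f i) l) ` {l. l \<noteq> []}"
  obtain w \<delta> where \<delta>: "0 < \<delta>" and w: "\<And>a. a \<in> ?A \<Longrightarrow> \<delta> \<le> (\<Sum>i<n. w i * (a i - t i))"
  proof (rule midpoint_separation[of ?A n e t])
    show "?A \<noteq> {}" by blast
    show "\<exists>c\<in>?A. \<forall>i<n. c i = (a i + b i) / 2" if ab: "a \<in> ?A" "b \<in> ?A" for a b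
    proof -
      obtain l1 l2 where l: "l1 \<noteq> []" "l2 \<noteq> []" "a = (\<lambda>i. list_avg (f i) l1)" "b = (\<lambda>i. list_avg (f i) l2)"
        using ab by auto
      obtain l where "l \<noteq> []" "\<And>f :: 'a \<Rightarrow> real. list_avg f l = (list_avg f l1 + list_avg f l2) / 2"
        using list_avg_midpoint[OF l(1,2)] by blast
      then show ?thesis using l by (intro bexI[of _ "\<lambda>i. list_avg (f i) l"]) auto
    qed
  qed (use e far in auto)
  have z: "\<delta> + (\<Sum>i<n. w i * t i) \<le> (\<Sum>i<n. w i * f i (dense_point k))" for k
  proof -
    have "(\<lambda>i. list_avg (f i) [k]) \<in> ?A" by (rule image_eqI[of _ _ "[k]"]) auto
    then have "\<delta> \<le> (\<Sum>i<n. w i * (list_avg (f i) [k] - t i))" by (rule w)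
    then show ?thesis by (simp add: list_avg_def right_diff_distrib sum_subtractf)
  qed
  have "\<delta> + (\<Sum>i<n. w i * t i) \<le> (\<Sum>i<n. w i * f i x)" for x
  proof (rule ccontr)
    assume "\<not> ?thesis"
    then have "{x. (\<Sum>i<n. w i * f i x) < \<delta> + (\<Sum>i<n. w i * t i)} \<noteq> {}" by (auto simp: not_le)
    moreover have "open {x. (\<Sum>i<n. w i * f i x) < \<delta> + (\<Sum>i<n. w i * t i)}"
      by (intro open_Collect_less continuous_intros cont) auto
    ultimately show False using dense_point[of "{x. (\<Sum>i<n. w i * f i x) < \<delta> + (\<Sum>i<n. w i * t i)}"] z
      by (auto simp: not_le[symmetric])
  qed
  then have "\<delta> + (\<Sum>i<n. w i * t i) \<le> (\<Sum>i<n. w i * t i)" by (rule dual)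
  then show False using \<delta> by simp
qed

section \<open>Lower semicontinuous costs\<close>

text \<open>The Lipschitz regularisation: the truncation of \<open>b\<close> at height
  \<open>k\<close> is replaced by its infimal convolution with \<open>k\<close> times the distance.
  The truncation keeps the values real and bounded even where \<open>b\<close> is infinite; lower
  semicontinuity gives back \<open>b\<close> in the limit.\<close>

lemma lower_semicontinuous_approximation:
  fixes b :: "'a :: metric_space \<Rightarrow> ereal"
  assumes lsc: "lower_semicontinuous b" and nonneg: "\<And>x. 0 \<le> b x"
  obtains \<beta> :: "nat \<Rightarrow> 'a \<Rightarrow> real"
  where "\<And>k. continuous_on UNIV (\<beta> k)" "\<And>k x. 0 \<le> \<beta> k x \<and> \<beta> k x \<le> real k"
    "\<And>x. incseq (\<lambda>k. \<beta> k x)" "\<And>x. (SUP k. ereal (\<beta> k x)) = b x"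
proof -
  define B where "B k w = real_of_ereal (min (b w) (ereal (real k)))" for k :: nat and w
  have eB: "ereal (B k w) = min (b w) (ereal (real k))" for k w
    using nonneg[of w] unfolding B_def by (cases "b w") (auto simp: min_def)
  have B0: "0 \<le> B k w" for k w using nonneg[of w] by (simp add: B_def real_of_ereal_pos)
  have Bk: "B k w \<le> real k" for k w
    using eB[of k w] by (metis ereal_less_eq(3) min.cobounded2)
  have Bb: "ereal (B k w) \<le> b w" for k w using eB[of k w] by simp
  have Bmono: "B k w \<le> B l w" if "k \<le> l" for k l w
  proof -
    have "ereal (B k w) \<le> ereal (B l w)" unfolding eB using that by (intro min.mono) auto
    then show ?thesis by simp
  qed
  define \<beta> where "\<beta> k x = (INF w. B k w + real k * dist x w)" for k x
  have bdd: "bdd_below (range (\<lambda>w. B k w + real k * dist x w))" for k x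
    using B0 by (auto intro!: bdd_belowI[of _ 0])
  have low: "\<beta> k x \<le> B k w + real k * dist x w" for k x w
    unfolding \<beta>_def by (rule cINF_lower[OF bdd]) simp
  have great: "r \<le> \<beta> k x" if "\<And>w. r \<le> B k w + real k * dist x w" for r k x
    unfolding \<beta>_def by (rule cINF_greatest) (use that in auto)
  have lip: "\<beta> k x \<le> \<beta> k y + real k * dist x y" for k x y
  proof -
    have "\<beta> k x - real k * dist x y \<le> B k w + real k * dist y w" for w
    proof -
      have "\<beta> k x \<le> B k w + real k * dist x w" by (rule low)
      also have "real k * dist x w \<le> real k * (dist x y + dist y w)"
        by (intro mult_left_mono dist_triangle) auto
      finally show ?thesis by (simp add: algebra_simps)
    qed
    then have "\<beta> k x - real k * dist x y \<le> \<beta> k y" by (rule great)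
    then show ?thesis by simp
  qed
  have \<beta>b: "ereal (\<beta> k x) \<le> b x" for k x
    using low[of k x x] Bb[of k x] by (simp add: order_trans[of "ereal (\<beta> k x)" "ereal (B k x)"])
  show ?thesis
  proof (rule that)
    show "continuous_on UNIV (\<beta> k)" for k
      unfolding continuous_on_iff
    proof (intro ballI allI impI)
      fix x :: 'a and e :: real assume e: "0 < e"
      \<comment> \<open>The Lipschitz constant \<open>k\<close> may be 0; \<open>k + 1\<close>
        avoids the division by zero.\<close>
      have "dist (\<beta> k y) (\<beta> k x) < e" if "dist y x < e / (real k + 1)" for y
      proof -
        have "\<bar>\<beta> k y - \<beta> k x\<bar> \<le> real k * dist y x"
          using lip[of k x y] lip[of k y x] by (simp add: dist_commute abs_le_iff)
        also have "\<dots> \<le> (real k + 1) * dist y x" by (intro mult_right_mono) auto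
        also have "\<dots> < e" using that by (simp add: field_simps)
        finally show ?thesis by (simp add: dist_real_def)
      qed
      then show "\<exists>d>0. \<forall>x'\<in>UNIV. dist x' x < d \<longrightarrow> dist (\<beta> k x') (\<beta> k x) < e"
        using e by (intro exI[of _ "e / (real k + 1)"]) auto
    qed
    show "0 \<le> \<beta> k x \<and> \<beta> k x \<le> real k" for k x
      using great[of 0 k x] B0 low[of k x x] Bk[of k x] by auto
    show "incseq (\<lambda>k. \<beta> k x)" for x
    proof (rule incseq_SucI, rule great)
      fix k w
      have "\<beta> k x \<le> B k w + real k * dist x w" by (rule low)
      also have "\<dots> \<le> B (Suc k) w + real (Suc k) * dist x w" by (intro add_mono Bmono mult_right_mono) auto
      finally show "\<beta> k x \<le> B (Suc k) w + real (Suc k) * dist x w" .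
    qed
    show "(SUP k. ereal (\<beta> k x)) = b x" for x
    proof (rule antisym)
      show "(SUP k. ereal (\<beta> k x)) \<le> b x" using \<beta>b by (intro SUP_least)
      show "b x \<le> (SUP k. ereal (\<beta> k x))"
      proof (rule dense_le)
        fix y assume y: "y < b x"
        show "y \<le> (SUP k. ereal (\<beta> k x))"
        proof (cases "y \<le> 0")
          case True
          have "ereal 0 \<le> ereal (\<beta> 0 x)" using great[of 0 0 x] B0 by simp
          also have "\<dots> \<le> (SUP k. ereal (\<beta> k x))" by (rule SUP_upper) simp
          finally show ?thesis using True by (simp add: zero_ereal_def[symmetric] order_trans)
        next
          case False
          then obtain r where r: "y = ereal r" "0 < r" using y by (cases y) auto
          have "y < Liminf (at x) b" using y lsc by (auto simp: lower_semicontinuous_def intro: less_le_trans)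
          then have "eventually (\<lambda>w. y < b w) (at x)" by (rule less_LiminfD)
          then obtain d where d: "0 < d" "\<And>w. w \<noteq> x \<Longrightarrow> dist w x < d \<Longrightarrow> y < b w"
            by (auto simp: eventually_at)
          \<comment> \<open>With \<open>k > r\<close> the truncation does not cut below
            \<open>r\<close> inside the ball of radius \<open>d\<close>; with
            \<open>k > r / d\<close> the distance penalty alone exceeds \<open>r\<close> outside
            it.\<close>
          obtain k :: nat where k: "max r (r / d) < real k" using reals_Archimedean2 by blast
          have "r \<le> B k w + real k * dist x w" for w
          proof (cases "dist w x < d")
            case True
            then have "y < b w" using d(2)[of w] y by (cases "w = x") auto
            then have "ereal r \<le> ereal (B k w)" unfolding eB using r k by auto
            then show ?thesis by (simp add: add_increasing2)
          next
            case False
            have "r \<le> real k * d" using k d(1) by (simp add: field_simps)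
            also have "\<dots> \<le> real k * dist x w" using False by (intro mult_left_mono) (auto simp: dist_commute)
            finally show ?thesis using B0[of k w] by simp
          qed
          then have "y \<le> ereal (\<beta> k x)" unfolding r(1) using great by simp
          also have "\<dots> \<le> (SUP k. ereal (\<beta> k x))" by (rule SUP_upper) simp
          finally show ?thesis .
        qed
      qed
    qed
  qed
qed

text \<open>Adding the integrable \<open>g\<close> makes the cost nonnegative, and monotone
  convergence applies to the approximations. The equivalence replaces a bound on a possibly infinite
  integral by countably many bounds on integrals of real functions, which fit the system of linear
  constraints.\<close>

lemma ereal_integral_le_iff:
  fixes c :: "'a \<Rightarrow> ereal" and g :: "'a \<Rightarrow> real"
  assumes g: "integrable M g" "\<And>x. 0 \<le> g x" and c: "\<And>x. - ereal (g x) \<le> c x"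
    and cm: "c \<in> borel_measurable M"
    and \<beta>: "\<And>k. integrable M (\<beta> k)" "\<And>k x. 0 \<le> \<beta> k x" "\<And>x. incseq (\<lambda>k. \<beta> k x)"
      "\<And>x. (SUP k. ereal (\<beta> k x)) = c x + ereal (g x)"
  shows "ereal_integral M c \<le> w \<longleftrightarrow> (\<forall>k :: nat. ereal (\<integral>x. \<beta> k x - g x \<partial>M) \<le> w)"
proof -
  define Cp where "Cp = (\<integral>\<^sup>+x. e2ennreal (c x) \<partial>M)"
  define Cn where "Cn = (\<integral>\<^sup>+x. e2ennreal (- c x) \<partial>M)"
  define Bp where "Bp = (\<integral>\<^sup>+x. e2ennreal (c x + ereal (g x)) \<partial>M)"
  define G where "G = (\<integral>x. g x \<partial>M)"
  have G: "ennreal G = (\<integral>\<^sup>+x. ennreal (g x) \<partial>M)"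
    unfolding G_def using g by (intro nn_integral_eq_integral[symmetric]) auto
  have G0: "0 \<le> G" unfolding G_def using g by simp
  have cm' [measurable]: "c \<in> borel_measurable M" "g \<in> borel_measurable M" using cm g by auto
  have CnG: "Cn \<le> ennreal G" unfolding Cn_def G
  proof (intro nn_integral_mono)
    fix x show "e2ennreal (- c x) \<le> ennreal (g x)"
    proof -
      have "- c x \<le> ereal (g x)" using c[of x] by (cases "c x") auto
      then show ?thesis using e2ennreal_mono[of "- c x" "ereal (g x)"] by simp
    qed
  qed
  obtain n where n: "Cn = ennreal n" "0 \<le> n" using CnG by (cases Cn) (auto simp: top_unique)
  \<comment> \<open>Positive and negative parts are arranged so that both sides are sums. Nothing is
    subtracted before the integrals of \<open>g\<close> and of the negative part are known to be
    finite.\<close>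
  have pt: "e2ennreal (c x) + ennreal (g x) = e2ennreal (c x + ereal (g x)) + e2ennreal (- c x)" for x
  proof (cases "c x")
    case (real r)
    have "- g x \<le> r" using c[of x] real by simp
    then show ?thesis using g(2)[of x] real
      by (cases "0 \<le> r") (simp_all add: ennreal_neg ennreal_plus[symmetric] del: ennreal_plus)
  next
    case PInf then show ?thesis by (simp add: e2ennreal_infty)
  next
    case MInf then show ?thesis using c[of x] by simp
  qed
  have "Cp + ennreal G = Bp + Cn"
    unfolding Cp_def G Bp_def Cn_def using pt by (simp add: nn_integral_add[symmetric])
  then have key: "enn2ereal Cp - enn2ereal Cn = enn2ereal Bp - ereal G"
  proof (cases Bp)
    case top
    then have "Cp = top" using \<open>Cp + ennreal G = Bp + Cn\<close> by (cases Cp) (auto simp: ennreal_plus[symmetric] simp del: ennreal_plus)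
    then show ?thesis using top n by simp
  next
    case (real b)
    then obtain p where p: "Cp = ennreal p" "0 \<le> p" using \<open>Cp + ennreal G = Bp + Cn\<close> n
      by (cases Cp) (auto simp: ennreal_plus[symmetric] simp del: ennreal_plus)
    have "p + G = b + n" using \<open>Cp + ennreal G = Bp + Cn\<close> p real n G0
      by (simp add: ennreal_plus[symmetric] del: ennreal_plus)
    then show ?thesis using p real n by (simp add: enn2ereal_ennreal)
  qed
  have \<beta>e: "e2ennreal (c x + ereal (g x)) = (SUP k. ennreal (\<beta> k x))" for x
    unfolding \<beta>(4)[symmetric]
  proof -
    have "(\<lambda>k. e2ennreal (ereal (\<beta> k x))) \<longlonglongrightarrow> e2ennreal (SUP k. ereal (\<beta> k x))"
      using \<beta>(3)[of x] by (intro continuous_on_tendsto_compose[OF continuous_on_e2ennreal[of UNIV] LIMSEQ_SUP])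
        (auto simp: incseq_def)
    moreover have "(\<lambda>k. ennreal (\<beta> k x)) \<longlonglongrightarrow> (SUP k. ennreal (\<beta> k x))"
      using \<beta>(3)[of x] by (intro LIMSEQ_SUP) (auto simp: incseq_def intro!: ennreal_leI)
    ultimately show "e2ennreal (SUP k. ereal (\<beta> k x)) = (SUP k. ennreal (\<beta> k x))"
      by (intro LIMSEQ_unique) simp_all
  qed
  have "Bp = (SUP k. \<integral>\<^sup>+x. ennreal (\<beta> k x) \<partial>M)"
    unfolding Bp_def \<beta>e using \<beta>(1,3)
    by (intro nn_integral_monotone_convergence_SUP) (auto simp: incseq_def le_fun_def intro!: ennreal_leI)
  also have "\<dots> = (SUP k. ennreal (\<integral>x. \<beta> k x \<partial>M))"
    using \<beta> by (intro SUP_cong nn_integral_eq_integral) auto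
  finally have Bp: "Bp = (SUP k. ennreal (\<integral>x. \<beta> k x \<partial>M))" .
  have i0: "0 \<le> (\<integral>x. \<beta> k x \<partial>M)" for k using \<beta>(2) by simp
  have inc: "(\<integral>x. \<beta> k x \<partial>M) \<le> (\<integral>x. \<beta> l x \<partial>M)" if "k \<le> l" for k l
    using \<beta>(1,3) that by (intro integral_mono) (auto simp: incseq_def)
  have "(\<lambda>k. ennreal (\<integral>x. \<beta> k x \<partial>M)) \<longlonglongrightarrow> Bp"
    unfolding Bp using inc by (intro LIMSEQ_SUP) (auto simp: incseq_def intro!: ennreal_leI)
  then have "(\<lambda>k. ereal (\<integral>x. \<beta> k x \<partial>M)) \<longlonglongrightarrow> enn2ereal Bp"
    using tendsto_enn2erealI[of "\<lambda>k. ennreal (\<integral>x. \<beta> k x \<partial>M)" Bp] i0 by (simp add: enn2ereal_ennreal)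
  moreover have "(\<lambda>k. ereal (\<integral>x. \<beta> k x \<partial>M)) \<longlonglongrightarrow> (SUP k. ereal (\<integral>x. \<beta> k x \<partial>M))"
    using inc by (intro LIMSEQ_SUP) (auto simp: incseq_def)
  ultimately have "enn2ereal Bp = (SUP k. ereal (\<integral>x. \<beta> k x \<partial>M))"
    by (rule LIMSEQ_unique)
  then have "ereal_integral M c \<le> w \<longleftrightarrow> (SUP k. ereal (\<integral>x. \<beta> k x \<partial>M)) - ereal G \<le> w"
    unfolding ereal_integral_def Cp_def[symmetric] Cn_def[symmetric] key by simp
  also have "\<dots> \<longleftrightarrow> (\<forall>k. ereal (\<integral>x. \<beta> k x \<partial>M) \<le> w + ereal G)"
    by (simp add: ereal_minus_le SUP_le_iff)
  also have "\<dots> \<longleftrightarrow> (\<forall>k. ereal (\<integral>x. \<beta> k x - g x \<partial>M) \<le> w)"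
    using \<beta>(1) g(1) by (cases w) (auto simp: G_def algebra_simps)
  finally show ?thesis .
qed

section \<open>Couplings as solutions of countably many linear constraints\<close>

definition weight :: "'a :: real_normed_vector \<times> 'b :: real_normed_vector \<Rightarrow> real" where
  "weight z = 1 + norm (fst z) + norm (snd z)"

text \<open>The class of integrands whose integrals pass to a weak limit once the first moments
  converge.\<close>

definition linear_growth :: "('a :: real_normed_vector \<times> 'b :: real_normed_vector \<Rightarrow> real) \<Rightarrow> bool" where
  "linear_growth f \<longleftrightarrow> continuous_on UNIV f \<and> (\<exists>K. \<forall>z. \<bar>f z\<bar> \<le> K * weight z)"

lemma weight_ge_1: "1 \<le> weight z"
  by (simp add: weight_def)

lemma continuous_weight: "continuous_on UNIV weight"
  unfolding weight_def by (intro continuous_intros)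

lemma linear_growthI:
  assumes "continuous_on UNIV f" "\<And>z. \<bar>f z\<bar> \<le> K * weight z" shows "linear_growth f"
  using assms unfolding linear_growth_def by blast

lemma linear_growth_bound:
  assumes "linear_growth f" obtains K where "0 \<le> K" "\<And>z. \<bar>f z\<bar> \<le> K * weight z"
proof -
  obtain K where K: "\<And>z. \<bar>f z\<bar> \<le> K * weight z" using assms unfolding linear_growth_def by blast
  show ?thesis
  proof
    show "\<bar>f z\<bar> \<le> max 0 K * weight z" for z
      using K[of z] weight_ge_1[of z] mult_right_mono[of K "max 0 K" "weight z"] by linarith
  qed simp
qed

lemma linear_growth_measurable:
  "linear_growth f \<Longrightarrow> f \<in> borel_measurable borel"
  unfolding linear_growth_def by (blast intro: borel_measurable_continuous_onI)

lemma fst_borel [measurable]: "fst \<in> borel \<rightarrow>\<^sub>M borel"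
  and snd_borel [measurable]: "snd \<in> borel \<rightarrow>\<^sub>M borel"
  by (auto intro!: borel_measurable_continuous_onI continuous_intros)

lemma weight_measurable [measurable]: "weight \<in> borel_measurable borel"
  by (rule borel_measurable_continuous_onI[OF continuous_weight])

lemma linear_growth_integrable:
  fixes M :: "('a :: real_normed_vector \<times> 'b :: real_normed_vector) measure"
  assumes f: "linear_growth f" and M: "sets M = sets borel" and g: "integrable M weight"
  shows "integrable M f"
proof -
  obtain K where K: "\<And>z. \<bar>f z\<bar> \<le> K * weight z" using linear_growth_bound[OF f] by metis
  have fm: "f \<in> borel_measurable M"
    using linear_growth_measurable[OF f] measurable_cong_sets[OF M refl] by blast
  show ?thesis
  proof (rule Bochner_Integration.integrable_bound[OF _ fm])
    show "integrable M (\<lambda>z. K * weight z)" using g by simp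
    show "AE z in M. norm (f z) \<le> norm (K * weight z)"
    proof (rule AE_I2)
      fix z show "norm (f z) \<le> norm (K * weight z)" using K[of z] by simp
    qed
  qed
qed

section \<open>Couplings and the martingale property in terms of integrals\<close>

lemma is_couplingD:
  assumes "is_coupling \<mu> P Q"
  shows "prob_space \<mu>" "sets \<mu> = sets borel"
    and "f \<in> borel_measurable borel \<Longrightarrow> (\<integral>z. f (fst z) \<partial>\<mu>) = (\<integral>x. f x \<partial>P :: real)"
    and "f \<in> borel_measurable borel \<Longrightarrow> (\<integral>z. f (snd z) \<partial>\<mu>) = (\<integral>x. f x \<partial>Q :: real)"
    and "f \<in> borel_measurable borel \<Longrightarrow> integrable \<mu> (\<lambda>z. f (fst z)) \<longleftrightarrow> integrable P f"
    and "f \<in> borel_measurable borel \<Longrightarrow> integrable \<mu> (\<lambda>z. f (snd z)) \<longleftrightarrow> integrable Q f"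
proof -
  show "prob_space \<mu>" and s: "sets \<mu> = sets borel" using assms by (auto simp: is_coupling_def)
  have P: "P = distr \<mu> borel fst" and Q: "Q = distr \<mu> borel snd" using assms by (auto simp: is_coupling_def)
  have [measurable]: "fst \<in> \<mu> \<rightarrow>\<^sub>M borel" "snd \<in> \<mu> \<rightarrow>\<^sub>M borel"
    using fst_borel snd_borel by (simp_all add: measurable_cong_sets[OF s refl])
  assume [measurable]: "f \<in> borel_measurable borel"
  show "(\<integral>z. f (fst z) \<partial>\<mu>) = (\<integral>x. f x \<partial>P)" unfolding P by (rule integral_distr[symmetric]) auto
  show "(\<integral>z. f (snd z) \<partial>\<mu>) = (\<integral>x. f x \<partial>Q)" unfolding Q by (rule integral_distr[symmetric]) auto
  show "integrable \<mu> (\<lambda>z. f (fst z)) \<longleftrightarrow> integrable P f" unfolding P by (rule integrable_distr_eq[symmetric]) auto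
  show "integrable \<mu> (\<lambda>z. f (snd z)) \<longleftrightarrow> integrable Q f" unfolding Q by (rule integrable_distr_eq[symmetric]) auto
qed

lemma is_couplingI_test_fun:
  fixes P Q :: "'a :: {metric_space, second_countable_topology} measure"
  assumes P: "prob_space P" "sets P = sets borel" and Q: "prob_space Q" "sets Q = sets borel"
    and \<mu>: "prob_space \<mu>" "sets \<mu> = sets borel"
    and eq: "\<And>j b. (\<integral>z. test_fun j (if b then fst z else snd z) \<partial>\<mu>) = (\<integral>x. test_fun j x \<partial>(if b then P else Q))"
  shows "is_coupling \<mu> P Q"
proof -
  interpret \<mu>: prob_space \<mu> by (rule \<mu>(1))
  have [measurable]: "fst \<in> \<mu> \<rightarrow>\<^sub>M borel" "snd \<in> \<mu> \<rightarrow>\<^sub>M borel"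
    using fst_borel snd_borel by (simp_all add: measurable_cong_sets[OF \<mu>(2) refl])
  have "distr \<mu> borel fst = P"
    by (rule prob_eqI_test_fun) (use P eq[of _ True] in \<open>auto simp: \<mu>.prob_space_distr integral_distr\<close>)
  moreover have "distr \<mu> borel snd = Q"
    by (rule prob_eqI_test_fun) (use Q eq[of _ False] in \<open>auto simp: \<mu>.prob_space_distr integral_distr\<close>)
  ultimately show ?thesis using \<mu> by (simp add: is_coupling_def)
qed

lemma is_coupling_weight:
  assumes "is_coupling \<mu> P Q" "integrable P norm" "integrable Q norm"
  shows "integrable \<mu> weight" "(\<integral>z. weight z \<partial>\<mu>) = 1 + (\<integral>x. norm x \<partial>P) + (\<integral>y. norm y \<partial>Q)"
proof -
  note c = is_couplingD[OF assms(1)]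
  interpret prob_space \<mu> by (rule c(1))
  have i: "integrable \<mu> (\<lambda>z. norm (fst z))" "integrable \<mu> (\<lambda>z. norm (snd z))"
    using c(5,6)[of norm] assms by auto
  show "integrable \<mu> weight" using i unfolding weight_def by simp
  show "(\<integral>z. weight z \<partial>\<mu>) = 1 + (\<integral>x. norm x \<partial>P) + (\<integral>y. norm y \<partial>Q)"
    unfolding weight_def using i c(3,4)[of norm] by (simp add: prob_space)
qed

lemma vec_nth_borel [measurable]: "(\<lambda>x :: real ^ 'd. x $ i) \<in> borel_measurable borel"
  by (intro borel_measurable_continuous_onI continuous_intros)

lemma integrable_test_fun_mult:
  fixes f :: "'b \<Rightarrow> real" and X :: "'b \<Rightarrow> 'a :: {metric_space, second_countable_topology}"
  assumes f: "integrable M f" and X [measurable]: "X \<in> borel_measurable M"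
  shows "integrable M (\<lambda>\<omega>. test_fun j (X \<omega>) * f \<omega>)"
proof (rule Bochner_Integration.integrable_bound[OF f])
  have [measurable]: "f \<in> borel_measurable M" using f by auto
  show "(\<lambda>\<omega>. test_fun j (X \<omega>) * f \<omega>) \<in> borel_measurable M" by measurable
  show "AE \<omega> in M. norm (test_fun j (X \<omega>) * f \<omega>) \<le> norm (f \<omega>)"
    by (rule AE_I2) (simp add: abs_mult abs_test_fun mult_left_le_one_le test_fun_bounds)
qed

text \<open>The conditional expectation is replaced by orthogonality of the increment to functions
  of the first coordinate. This is linear in the measure and involves continuous functions of linear
  growth only. Test functions suffice because orthogonality extends from them to all indicators of
  events of the first coordinate.\<close>

lemma is_martingale_coupling_iff:
  fixes \<mu> :: "((real ^ 'd) \<times> (real ^ 'd)) measure"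
  assumes c: "is_coupling \<mu> P Q" and P: "integrable P norm" and Q: "integrable Q norm"
  shows "is_martingale_coupling \<mu> P Q \<longleftrightarrow>
    (\<forall>j k. (\<integral>z. test_fun j (fst z) * (snd z $ k - fst z $ k) \<partial>\<mu>) = 0)"
proof -
  note cD = is_couplingD[OF c]
  interpret \<mu>: prob_space \<mu> by (rule cD(1))
  have [measurable_cong]: "sets \<mu> = sets borel" by (rule cD(2))
  have sp: "space \<mu> = UNIV" using sets_eq_imp_space_eq[OF cD(2)] by simp
  have mf [measurable]: "fst \<in> \<mu> \<rightarrow>\<^sub>M borel" and ms [measurable]: "snd \<in> \<mu> \<rightarrow>\<^sub>M borel" by measurable
  let ?G = "vimage_algebra (space \<mu>) (fst :: (real ^ 'd) \<times> (real ^ 'd) \<Rightarrow> _) borel"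
  have "fst -` A \<in> sets \<mu>" if "A \<in> sets borel" for A :: "(real ^ 'd) set"
    using measurable_sets[OF mf that] by (simp add: sp)
  then have subG: "subalgebra \<mu> ?G"
    by (auto simp: subalgebra_def sets_vimage_algebra2 sp)
  interpret G: finite_measure_subalgebra \<mu> ?G by unfold_locales (rule subG)
  have nf: "integrable \<mu> fst" and ns: "integrable \<mu> snd"
    using cD(5,6)[of norm] P Q by (auto simp: integrable_norm_iff)
  have intf: "integrable \<mu> (\<lambda>z. fst z $ i)" and ints: "integrable \<mu> (\<lambda>z. snd z $ i)" for i
    using nf ns by (auto intro: integrable_bounded_linear[OF bounded_linear_vec_nth])
  have fstG: "(fst :: (real ^ 'd) \<times> (real ^ 'd) \<Rightarrow> _) \<in> ?G \<rightarrow>\<^sub>M borel"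
    by (intro measurable_vimage_algebra1) auto
  have fstGi: "(\<lambda>z. fst z $ i) \<in> borel_measurable ?G" for i
    by (rule measurable_compose[OF fstG]) measurable
  show ?thesis
  proof
    assume "is_martingale_coupling \<mu> P Q"
    then obtain M :: "((real ^ 'd) \<times> (real ^ 'd)) measure" and X\<^sub>1 X\<^sub>2
      where "martingale_pair M X\<^sub>1 X\<^sub>2" "\<mu> = distr M borel (\<lambda>\<omega>. (X\<^sub>1 \<omega>, X\<^sub>2 \<omega>))"
      unfolding is_martingale_coupling_def by blast
    then have "martingale_pair \<mu> fst snd" using martingale_pair_distr by blast
    then have ae: "AE z in \<mu>. vec_cond_exp \<mu> ?G snd z = fst z" by (simp add: martingale_pair_def)
    show "\<forall>j k. (\<integral>z. test_fun j (fst z) * (snd z $ k - fst z $ k) \<partial>\<mu>) = 0"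
    proof (intro allI)
      fix j k
      have i2: "integrable \<mu> (\<lambda>z. test_fun j (fst z) * (snd z $ k))"
        and i1: "integrable \<mu> (\<lambda>z. test_fun j (fst z) * (fst z $ k))"
        by (intro integrable_test_fun_mult intf ints mf)+
      have tG: "(\<lambda>z. test_fun j (fst z)) \<in> borel_measurable ?G"
        by (rule measurable_compose[OF fstG]) measurable
      have "(\<integral>z. test_fun j (fst z) * (snd z $ k) \<partial>\<mu>) =
          (\<integral>z. test_fun j (fst z) * real_cond_exp \<mu> ?G (\<lambda>z. snd z $ k) z \<partial>\<mu>)"
        using G.real_cond_exp_intg(2)[OF i2 tG] by simp
      also have "\<dots> = (\<integral>z. test_fun j (fst z) * (fst z $ k) \<partial>\<mu>)"
      proof (rule integral_cong_AE)
        show "AE z in \<mu>. test_fun j (fst z) * real_cond_exp \<mu> ?G (\<lambda>z. snd z $ k) z = test_fun j (fst z) * (fst z $ k)"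
          using ae by eventually_elim (auto simp: vec_cond_exp_def vec_eq_iff)
      qed measurable
      finally show "(\<integral>z. test_fun j (fst z) * (snd z $ k - fst z $ k) \<partial>\<mu>) = 0"
        using i1 i2 by (simp add: right_diff_distrib)
    qed
  next
    assume 0: "\<forall>j k. (\<integral>z. test_fun j (fst z) * (snd z $ k - fst z $ k) \<partial>\<mu>) = 0"
    have "AE z in \<mu>. real_cond_exp \<mu> ?G (\<lambda>z. snd z $ i) z = fst z $ i" for i
    proof (rule G.real_cond_exp_charact)
      fix A assume "A \<in> sets ?G"
      then obtain B where B: "B \<in> sets borel" and A: "A = fst -` B" by (auto simp: sets_vimage_algebra2 sp)
      have [measurable]: "A \<in> sets \<mu>" using measurable_sets[OF mf B] by (simp add: A sp)
      have ind: "indicator B (fst z) = (indicator A z :: real)" for z by (auto simp: A indicator_def)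
      have "(\<integral>z. indicator B (fst z) * (snd z $ i - fst z $ i) \<partial>\<mu>) = 0"
        by (rule integral_indicator_times_eq_0) (use intf ints mf 0 B in auto)
      then have "(\<integral>z. indicator A z *\<^sub>R (snd z $ i) - indicator A z *\<^sub>R (fst z $ i) \<partial>\<mu>) = 0"
        by (simp add: ind right_diff_distrib)
      then show "(\<integral>z\<in>A. snd z $ i \<partial>\<mu>) = (\<integral>z\<in>A. fst z $ i \<partial>\<mu>)"
        using integrable_mult_indicator[OF \<open>A \<in> sets \<mu>\<close> intf[of i]] integrable_mult_indicator[OF \<open>A \<in> sets \<mu>\<close> ints[of i]]
        unfolding set_lebesgue_integral_def by (subst (asm) Bochner_Integration.integral_diff) auto
    qed (use intf ints fstGi in auto)
    then have "AE z in \<mu>. \<forall>i. real_cond_exp \<mu> ?G (\<lambda>z. snd z $ i) z = fst z $ i"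
      by (simp add: AE_all_countable)
    then have "AE z in \<mu>. vec_cond_exp \<mu> ?G snd z = fst z"
      by eventually_elim (simp add: vec_cond_exp_def vec_eq_iff)
    then have "martingale_pair \<mu> fst snd" using nf ns \<mu>.prob_space_axioms by (simp add: martingale_pair_def)
    moreover have "\<mu> = distr \<mu> borel (\<lambda>z. (fst z, snd z))"
      using distr_id2[of borel \<mu>] cD(2) by (simp add: id_def)
    ultimately show "is_martingale_coupling \<mu> P Q" by (rule is_martingale_couplingI[OF c])
  qed
qed

section \<open>The system of constraints and its compactness\<close>

datatype 'd constraint = Marginal bool bool nat | Moment bool | Martingale bool nat 'd | Objective nat nat

instance constraint :: (countable) countable
  by countable_datatype

text \<open>An equality constraint is encoded as two inequalities with opposite signs.\<close>

definition signed :: "bool \<Rightarrow> real \<Rightarrow> real" where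
  "signed s r = (if s then r else - r)"

text \<open>The flag \<open>s\<close> is the sign of an inequality and \<open>b = True\<close>
  selects the first marginal. \<open>Moment\<close> is one-sided, as it has to prevent an excess of
  first moment in the limit. \<open>Objective n k\<close> is the \<open>k\<close>-th member of a
  family bounded jointly by the number \<open>w n\<close>.\<close>

fun constraint_fun ::
  "(nat \<Rightarrow> nat \<Rightarrow> (real ^ 'd) \<times> (real ^ 'd) \<Rightarrow> real) \<Rightarrow> 'd constraint \<Rightarrow> (real ^ 'd) \<times> (real ^ 'd) \<Rightarrow> real" where
  "constraint_fun ob (Marginal s b j) z = signed s (test_fun j (if b then fst z else snd z))"
| "constraint_fun ob (Moment b) z = norm (if b then fst z else snd z)"
| "constraint_fun ob (Martingale s j k) z = signed s (test_fun j (fst z) * (snd z $ k - fst z $ k))"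
| "constraint_fun ob (Objective n k) z = ob n k z"

text \<open>An infinite bound switches a constraint off. The flag \<open>m\<close> thus lets
  couplings and martingale couplings share one system, and objectives not yet minimised stay
  unrestricted.\<close>

fun constraint_bound ::
  "bool \<Rightarrow> (real ^ 'd) measure \<Rightarrow> (real ^ 'd) measure \<Rightarrow> (nat \<Rightarrow> ereal) \<Rightarrow> 'd constraint \<Rightarrow> ereal" where
  "constraint_bound m P Q w (Marginal s b j) = ereal (signed s (\<integral>x. test_fun j x \<partial>(if b then P else Q)))"
| "constraint_bound m P Q w (Moment b) = ereal (\<integral>x. norm x \<partial>(if b then P else Q))"
| "constraint_bound m P Q w (Martingale s j k) = (if m then 0 else \<infinity>)"
| "constraint_bound m P Q w (Objective n k) = w n"

definition coupling_of_kind ::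
  "bool \<Rightarrow> ((real ^ 'd) \<times> (real ^ 'd)) measure \<Rightarrow> (real ^ 'd) measure \<Rightarrow> (real ^ 'd) measure \<Rightarrow> bool" where
  "coupling_of_kind m \<mu> P Q \<longleftrightarrow> is_coupling \<mu> P Q \<and> (m \<longrightarrow> is_martingale_coupling \<mu> P Q)"

definition feasible ::
  "(nat \<Rightarrow> nat \<Rightarrow> (real ^ 'd) \<times> (real ^ 'd) \<Rightarrow> real) \<Rightarrow> bool \<Rightarrow> (real ^ 'd) measure \<Rightarrow> (real ^ 'd) measure
    \<Rightarrow> (nat \<Rightarrow> ereal) \<Rightarrow> ((real ^ 'd) \<times> (real ^ 'd)) measure \<Rightarrow> bool" where
  "feasible ob m P Q w \<mu> \<longleftrightarrow> coupling_of_kind m \<mu> P Q \<and> (\<forall>n k. ereal (\<integral>z. ob n k z \<partial>\<mu>) \<le> w n)"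

lemma constraint_fun_eq:
  "constraint_fun ob (Marginal s b j) = (\<lambda>z. signed s (test_fun j (if b then fst z else snd z)))"
  "constraint_fun ob (Moment b) = (\<lambda>z. norm (if b then fst z else snd z))"
  "constraint_fun ob (Martingale s j k) = (\<lambda>z. signed s (test_fun j (fst z) * (snd z $ k - fst z $ k)))"
  "constraint_fun ob (Objective n l) = ob n l"
  by (auto simp: fun_eq_iff)

lemma linear_growth_constraint_fun:
  fixes ob :: "nat \<Rightarrow> nat \<Rightarrow> (real ^ 'd) \<times> (real ^ 'd) \<Rightarrow> real"
  assumes ob: "\<And>n k. linear_growth (ob n k)"
  shows "linear_growth (constraint_fun ob i)"
proof (cases i)
  case (Marginal s b j)
  have c: "continuous_on UNIV (\<lambda>z :: (real ^ 'd) \<times> (real ^ 'd). test_fun j (if b then fst z else snd z))"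
    by (cases b) (auto intro!: continuous_on_compose2[OF continuous_test_fun] continuous_intros)
  show ?thesis
  proof (rule linear_growthI[where K = 1])
    show "continuous_on UNIV (constraint_fun ob i)"
      using c unfolding Marginal by (cases s) (auto simp: signed_def intro!: continuous_intros)
    show "\<bar>constraint_fun ob i z\<bar> \<le> 1 * weight z" for z
    proof -
      have "\<bar>constraint_fun ob i z\<bar> \<le> 1" unfolding Marginal by (simp add: signed_def test_fun_bounds)
      then show ?thesis using weight_ge_1[of z] by simp
    qed
  qed
next
  case (Moment b)
  then show ?thesis
    by (cases b) (auto intro!: linear_growthI[where K = 1] continuous_intros simp: weight_def)
next
  case (Martingale s j k)
  have c: "continuous_on UNIV (\<lambda>z :: (real ^ 'd) \<times> (real ^ 'd). test_fun j (fst z) * (snd z $ k - fst z $ k))"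
    by (auto intro!: continuous_on_compose2[OF continuous_test_fun] continuous_intros)
  show ?thesis
  proof (rule linear_growthI[where K = 1])
    show "continuous_on UNIV (constraint_fun ob i)"
      using c unfolding Martingale by (cases s) (auto simp: signed_def intro!: continuous_on_minus)
    fix z
    have "\<bar>test_fun j (fst z) * (snd z $ k - fst z $ k)\<bar> \<le> \<bar>snd z $ k - fst z $ k\<bar>"
      unfolding abs_mult by (rule mult_left_le_one_le) (auto simp: test_fun_bounds)
    also have "\<dots> \<le> \<bar>snd z $ k\<bar> + \<bar>fst z $ k\<bar>" by simp
    also have "\<dots> \<le> norm (snd z) + norm (fst z)" by (intro add_mono component_le_norm_cart)
    finally show "\<bar>constraint_fun ob i z\<bar> \<le> 1 * weight z" unfolding Martingale by (simp add: weight_def signed_def)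
  qed
next
  case (Objective n k)
  then show ?thesis using ob by (simp add: constraint_fun_eq)
qed

lemma feasible_iff:
  assumes P: "prob_space P" "sets P = sets borel" "integrable P norm"
    and Q: "prob_space Q" "sets Q = sets borel" "integrable Q norm"
    and \<mu>: "prob_space \<mu>" "sets \<mu> = sets borel"
  shows "feasible ob m P Q w \<mu> \<longleftrightarrow>
    (\<forall>i. ereal (\<integral>z. constraint_fun ob i z \<partial>\<mu>) \<le> constraint_bound m P Q w i)" (is "_ \<longleftrightarrow> ?R")
proof
  assume L: "feasible ob m P Q w \<mu>"
  then have c: "is_coupling \<mu> P Q" by (simp add: feasible_def coupling_of_kind_def)
  note cD = is_couplingD[OF c]
  show ?R
  proof
    fix i show "ereal (\<integral>z. constraint_fun ob i z \<partial>\<mu>) \<le> constraint_bound m P Q w i"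
    proof (cases i)
      case (Marginal s b j) then show ?thesis using cD(3,4)[of "test_fun j"] by (simp add: signed_def)
    next
      case (Moment b) then show ?thesis using cD(3,4)[of norm] by simp
    next
      case (Martingale s j k)
      then show ?thesis
        using L is_martingale_coupling_iff[OF c P(3) Q(3)]
        by (cases s) (auto simp: feasible_def coupling_of_kind_def signed_def)
    next
      case (Objective n k) then show ?thesis using L by (simp add: feasible_def)
    qed
  qed
next
  assume R: ?R
  have eq: "(\<integral>z. test_fun j (if b then fst z else snd z) \<partial>\<mu>) = (\<integral>x. test_fun j x \<partial>(if b then P else Q))" for j b
    using R[rule_format, of "Marginal True b j"] R[rule_format, of "Marginal False b j"]
    unfolding constraint_fun_eq by (simp add: signed_def split: if_splits)
  have c: "is_coupling \<mu> P Q" by (rule is_couplingI_test_fun[OF P(1,2) Q(1,2) \<mu> eq])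
  have "is_martingale_coupling \<mu> P Q" if m
    unfolding is_martingale_coupling_iff[OF c P(3) Q(3)]
  proof (intro allI)
    fix j k show "(\<integral>z. test_fun j (fst z) * (snd z $ k - fst z $ k) \<partial>\<mu>) = 0"
      using R[rule_format, of "Martingale True j k"] R[rule_format, of "Martingale False j k"] that
      unfolding constraint_fun_eq by (simp add: signed_def)
  qed
  moreover have "ereal (\<integral>z. ob n k z \<partial>\<mu>) \<le> w n" for n k using R[rule_format, of "Objective n k"]
    by (simp add: constraint_fun_eq)
  ultimately show "feasible ob m P Q w \<mu>" using c by (simp add: feasible_def coupling_of_kind_def)
qed

lemma ereal_le_if_less:
  assumes "\<And>r. t < ereal r \<Longrightarrow> x \<le> r" shows "ereal x \<le> t"
proof (rule ccontr)
  assume "\<not> ereal x \<le> t"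
  then obtain r where "t < ereal r" "ereal r < ereal x" using ereal_dense2[of t "ereal x"] by (auto simp: not_le)
  then show False using assms[of r] by simp
qed

text \<open>Convergence of the first moments of the marginals provides the uniform integrability by which
  all constraints pass to the limit.\<close>

lemma feasible_compact:
  fixes P Q :: "(real ^ 'd) measure"
  assumes P: "prob_space P" "sets P = sets borel" "integrable P norm"
    and Q: "prob_space Q" "sets Q = sets borel" "integrable Q norm"
    and ob: "\<And>n k. linear_growth (ob n k)"
    and \<mu>: "\<And>n. prob_space (\<mu> n)" "\<And>n. sets (\<mu> n) = sets borel" "\<And>n. integrable (\<mu> n) weight"
    and ev: "\<And>i r. constraint_bound m P Q w i < ereal r \<Longrightarrow>
      eventually (\<lambda>n. (\<integral>z. constraint_fun ob i z \<partial>\<mu> n) \<le> r) sequentially"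
  shows "\<exists>\<nu>. feasible ob m P Q w \<nu>"
proof -
  have mb: "eventually (\<lambda>n. (\<integral>z. norm (if b then fst z else snd z) \<partial>\<mu> n) \<le> (\<integral>x. norm x \<partial>(if b then P else Q)) + e) sequentially"
    if "0 < e" for b e
    using ev[of "Moment b" "(\<integral>x. norm x \<partial>(if b then P else Q)) + e"] that by (simp add: constraint_fun_eq)
  define R where "R = (\<integral>x. norm x \<partial>P) + (\<integral>x. norm x \<partial>Q)"
  have nw: "norm z \<le> weight z" for z :: "(real ^ 'd) \<times> (real ^ 'd)"
    using norm_Pair_le[of "fst z" "snd z"] by (simp add: weight_def)
  have lgf: "linear_growth (\<lambda>z :: (real ^ 'd) \<times> (real ^ 'd). norm (fst z))"
    and lgs: "linear_growth (\<lambda>z :: (real ^ 'd) \<times> (real ^ 'd). norm (snd z))"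
    and lgn: "linear_growth (\<lambda>z :: (real ^ 'd) \<times> (real ^ 'd). norm z)"
    using nw by (auto intro!: linear_growthI[where K=1] continuous_intros simp: weight_def)
  note lgi = linear_growth_integrable[OF _ \<mu>(2) \<mu>(3)]
  have gi: "(\<integral>z. weight z \<partial>\<mu> n) = 1 + (\<integral>z. norm (fst z) \<partial>\<mu> n) + (\<integral>z. norm (snd z) \<partial>\<mu> n)" for n
  proof -
    interpret prob_space "\<mu> n" by (rule \<mu>(1))
    show ?thesis unfolding weight_def using lgi[OF lgf] lgi[OF lgs] by (simp add: prob_space)
  qed
  have gev: "eventually (\<lambda>n. (\<integral>z. weight z \<partial>\<mu> n) \<le> 1 + R + e) sequentially" if "0 < e" for e
  proof -
    have "0 < e / 2" using that by simp
    from mb[OF this, of True] mb[OF this, of False] show ?thesis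
    proof eventually_elim
      case (elim n) then show ?case unfolding gi R_def by simp
    qed
  qed
  \<comment> \<open>Early measures may have large moments; from \<open>N\<close> on the integral of
    \<open>weight\<close> is at most R + 2.\<close>
  obtain N where N: "\<And>n. n \<ge> N \<Longrightarrow> (\<integral>z. weight z \<partial>\<mu> n) \<le> 1 + R + 1"
    using gev[of 1] by (auto simp: eventually_sequentially)
  have nb: "(\<integral>z. norm z \<partial>\<mu> (n + N)) \<le> R + 2" for n
  proof -
    have "(\<integral>z. norm z \<partial>\<mu> (n + N)) \<le> (\<integral>z. weight z \<partial>\<mu> (n + N))"
      using lgi[OF lgn] \<mu>(3) by (intro integral_mono nw) auto
    then show ?thesis using N[of "n + N"] by simp
  qed
  obtain r :: "nat \<Rightarrow> nat" and \<Omega> :: "real measure" and X :: "nat \<Rightarrow> real \<Rightarrow> (real ^ 'd) \<times> (real ^ 'd)" and Y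
    where r: "strict_mono r" and \<Omega>: "prob_space \<Omega>"
      and X [measurable]: "\<And>n. X n \<in> borel_measurable \<Omega>" and Y [measurable]: "Y \<in> borel_measurable \<Omega>"
      and dX: "\<And>n. distr \<Omega> borel (X n) = \<mu> (r n + N)"
      and lim: "\<And>\<omega>. \<omega> \<in> space \<Omega> \<Longrightarrow> (\<lambda>n. X n \<omega>) \<longlonglongrightarrow> Y \<omega>"
    using moment_bounded_skorohod[of "\<lambda>n. \<mu> (n + N)" "R + 2"] \<mu>(1,2) lgi[OF lgn] nb by blast
  interpret \<Omega>: prob_space \<Omega> by (rule \<Omega>)
  define \<nu> where "\<nu> = distr \<Omega> borel Y"
  have \<nu>: "prob_space \<nu>" "sets \<nu> = sets borel" unfolding \<nu>_def by (auto intro: \<Omega>.prob_space_distr)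
  have sub: "filterlim (\<lambda>n. r n + N) sequentially sequentially"
    using filterlim_subseq[OF r] by (intro filterlim_at_top_mono[OF filterlim_subseq[OF r]]) auto
  note evs = eventually_compose_filterlim[OF _ sub]
  have IX: "(\<integral>\<omega>. f (X n \<omega>) \<partial>\<Omega>) = (\<integral>z. f z \<partial>\<mu> (r n + N))" 
    if "f \<in> borel_measurable borel" for f :: "_ \<Rightarrow> real" and n
    unfolding dX[symmetric] using that by (intro integral_distr[symmetric]) auto
  have IY: "(\<integral>\<omega>. f (Y \<omega>) \<partial>\<Omega>) = (\<integral>z. f z \<partial>\<nu>)" if "f \<in> borel_measurable borel" for f :: "_ \<Rightarrow> real"
    unfolding \<nu>_def using that by (intro integral_distr[symmetric]) auto
  have IYc: "(\<integral>\<omega>. constraint_fun ob i (Y \<omega>) \<partial>\<Omega>) = (\<integral>z. constraint_fun ob i z \<partial>\<nu>)" for i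
    by (intro IY linear_growth_measurable linear_growth_constraint_fun ob)
  have XY: "(\<lambda>n. f (X n \<omega>)) \<longlonglongrightarrow> f (Y \<omega>)"
    if "continuous_on UNIV f" "\<omega> \<in> space \<Omega>" for f :: "_ \<Rightarrow> real" and \<omega>
    by (rule continuous_on_tendsto_compose[OF that(1) lim[OF that(2)]]) auto
  have below: "L \<le> q"
    if "(\<lambda>n. \<integral>\<omega>. constraint_fun ob i (X n \<omega>) \<partial>\<Omega>) \<longlonglongrightarrow> L" "constraint_bound m P Q w i < ereal q" for i L q
  proof (rule tendsto_upperbound[OF that(1)])
    have "eventually (\<lambda>n. (\<integral>z. constraint_fun ob i z \<partial>\<mu> (r n + N)) \<le> q) sequentially"
      by (rule evs[OF ev[OF that(2)]])
    then show "eventually (\<lambda>n. (\<integral>\<omega>. constraint_fun ob i (X n \<omega>) \<partial>\<Omega>) \<le> q) sequentially"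
      by (simp add: IX linear_growth_measurable linear_growth_constraint_fun ob)
  qed simp
  \<comment> \<open>The marginal constraints are bounded and converge without any control of
    moments. They must come first: only when the limit is known to be a coupling is its integral of
    \<open>weight\<close> known to be 1 + R, and this is the limit that the dominating functions
    need.\<close>
  have tlim: "(\<lambda>n. \<integral>\<omega>. constraint_fun ob (Marginal s b j) (X n \<omega>) \<partial>\<Omega>) \<longlonglongrightarrow> (\<integral>\<omega>. constraint_fun ob (Marginal s b j) (Y \<omega>) \<partial>\<Omega>)" for s b j
  proof (rule integral_dominated_convergence[where w="\<lambda>_. 1"])
    have lg: "linear_growth (constraint_fun ob (Marginal s b j))" by (intro linear_growth_constraint_fun ob)
    note [measurable] = linear_growth_measurable[OF lg]
    show "(\<lambda>\<omega>. constraint_fun ob (Marginal s b j) (Y \<omega>)) \<in> borel_measurable \<Omega>" by measurable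
    show "(\<lambda>\<omega>. constraint_fun ob (Marginal s b j) (X n \<omega>)) \<in> borel_measurable \<Omega>" for n by measurable
    show "AE \<omega> in \<Omega>. norm (constraint_fun ob (Marginal s b j) (X n \<omega>)) \<le> 1" for n
      by (rule AE_I2) (simp add: signed_def test_fun_bounds)
    show "AE \<omega> in \<Omega>. (\<lambda>n. constraint_fun ob (Marginal s b j) (X n \<omega>)) \<longlonglongrightarrow> constraint_fun ob (Marginal s b j) (Y \<omega>)"
      using lg by (intro AE_I2 XY) (auto simp: linear_growth_def)
  qed simp
  have marg: "ereal (\<integral>z. constraint_fun ob (Marginal s b j) z \<partial>\<nu>) \<le> constraint_bound m P Q w (Marginal s b j)" for s b j
    by (rule ereal_le_if_less) (rule below[OF tlim, unfolded IYc])
  have eq: "(\<integral>z. test_fun j (if b then fst z else snd z) \<partial>\<nu>) = (\<integral>x. test_fun j x \<partial>(if b then P else Q))" for j b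
    using marg[of True b j] marg[of False b j] unfolding constraint_fun_eq by (simp add: signed_def split: if_splits)
  have c: "is_coupling \<nu> P Q" by (rule is_couplingI_test_fun[OF P(1,2) Q(1,2) \<nu> eq])
  note g\<nu> = is_coupling_weight[OF c P(3) Q(3)]
  have gY: "integrable \<Omega> (\<lambda>\<omega>. weight (Y \<omega>))" "(\<integral>\<omega>. weight (Y \<omega>) \<partial>\<Omega>) = 1 + R"
    using g\<nu> unfolding \<nu>_def by (simp_all add: integrable_distr_eq integral_distr R_def)
  have gX: "integrable \<Omega> (\<lambda>\<omega>. weight (X n \<omega>))" for n
    using \<mu>(3)[of "r n + N"] unfolding dX[symmetric] by (simp add: integrable_distr_eq)
  have conv: "(\<lambda>n. \<integral>\<omega>. f (X n \<omega>) \<partial>\<Omega>) \<longlonglongrightarrow> (\<integral>\<omega>. f (Y \<omega>) \<partial>\<Omega>)" if f: "linear_growth f" for f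
  proof -
    obtain K where K: "0 \<le> K" "\<And>z. \<bar>f z\<bar> \<le> K * weight z" using linear_growth_bound[OF f] by metis
    note [measurable] = linear_growth_measurable[OF f]
    show ?thesis
    proof (rule integral_varying_dominated_convergence(2)[where G="\<lambda>n \<omega>. K * weight (X n \<omega>)" and g="\<lambda>\<omega>. K * weight (Y \<omega>)"])
      show "(\<lambda>n. f (X n \<omega>)) \<longlonglongrightarrow> f (Y \<omega>)" if "\<omega> \<in> space \<Omega>" for \<omega>
        using f by (intro XY that) (auto simp: linear_growth_def)
      show "(\<lambda>n. K * weight (X n \<omega>)) \<longlonglongrightarrow> K * weight (Y \<omega>)" if "\<omega> \<in> space \<Omega>" for \<omega>
        by (intro tendsto_mult_left XY continuous_weight that)
      fix e :: real assume e: "0 < e"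
      \<comment> \<open>The tolerance is multiplied by \<open>K\<close>, which may be 0; e / (K + 1)
        remains below \<open>e\<close> after this.\<close>
      have "eventually (\<lambda>n. (\<integral>z. weight z \<partial>\<mu> (r n + N)) \<le> 1 + R + e / (K + 1)) sequentially"
        using K e by (intro evs[OF gev]) auto
      then show "eventually (\<lambda>n. (\<integral>\<omega>. K * weight (X n \<omega>) \<partial>\<Omega>) \<le> (\<integral>\<omega>. K * weight (Y \<omega>) \<partial>\<Omega>) + e) sequentially"
      proof eventually_elim
        case (elim n)
        have "K * (\<integral>z. weight z \<partial>\<mu> (r n + N)) \<le> K * (1 + R + e / (K + 1))"
          using elim K by (intro mult_left_mono)
        also have "\<dots> = K * (1 + R) + e * (K / (K + 1))" by (simp add: algebra_simps)
        also have "e * (K / (K + 1)) \<le> e * 1" using e K by (intro mult_left_mono) auto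
        finally show ?case by (simp add: gY IX)
      qed
    qed (use K gX gY in auto)
  qed
  have "feasible ob m P Q w \<nu>"
    unfolding feasible_iff[OF P Q \<nu>]
  proof (intro allI ereal_le_if_less)
    fix i q assume "constraint_bound m P Q w i < ereal q"
    then show "(\<integral>z. constraint_fun ob i z \<partial>\<nu>) \<le> q"
      using below[OF conv[OF linear_growth_constraint_fun[OF ob]]] unfolding IYc by blast
  qed
  then show ?thesis by blast
qed

text \<open>The right-hand side is measurable in the parameter because the data enter it only through the
  numbers \<^const>\<open>constraint_bound\<close>.\<close>

lemma feasible_iff_list_avg:
  fixes P Q :: "(real ^ 'd) measure"
  assumes P: "prob_space P" "sets P = sets borel" "integrable P norm"
    and Q: "prob_space Q" "sets Q = sets borel" "integrable Q norm"
    and ob: "\<And>n k. linear_growth (ob n k)"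
  shows "(\<exists>\<mu>. feasible ob m P Q w \<mu>) \<longleftrightarrow> (\<forall>N. \<exists>l. l \<noteq> [] \<and>
    (\<forall>i<N. ereal (list_avg (constraint_fun ob (from_nat i)) l) \<le>
      constraint_bound m P Q w (from_nat i) + ereal (1 / real (Suc N))))"
proof
  assume "\<exists>\<mu>. feasible ob m P Q w \<mu>"
  then obtain \<mu> where \<mu>: "feasible ob m P Q w \<mu>" by blast
  then have c: "is_coupling \<mu> P Q" by (simp add: feasible_def coupling_of_kind_def)
  note cD = is_couplingD[OF c]
  interpret prob_space \<mu> by (rule cD(1))
  have le: "ereal (\<integral>z. constraint_fun ob i z \<partial>\<mu>) \<le> constraint_bound m P Q w i" for i
    using \<mu> feasible_iff[OF P Q cD(1,2)] by blast
  have lg: "linear_growth (constraint_fun ob i)" for i by (intro linear_growth_constraint_fun ob)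
  have int: "integrable \<mu> (constraint_fun ob i)" for i
    by (rule linear_growth_integrable[OF lg cD(2) is_coupling_weight(1)[OF c P(3) Q(3)]])
  show "\<forall>N. \<exists>l. l \<noteq> [] \<and> (\<forall>i<N. ereal (list_avg (constraint_fun ob (from_nat i)) l) \<le>
      constraint_bound m P Q w (from_nat i) + ereal (1 / real (Suc N)))"
  proof
    fix N
    obtain l where l: "l \<noteq> []" "\<And>i. i < N \<Longrightarrow>
      \<bar>list_avg (constraint_fun ob (from_nat i)) l - (\<integral>z. constraint_fun ob (from_nat i) z \<partial>\<mu>)\<bar> \<le> 1 / real (Suc N)"
    proof (rule list_avg_approximation[of N "\<lambda>i. constraint_fun ob (from_nat i)" "1 / real (Suc N)"
          "\<lambda>i. \<integral>z. constraint_fun ob (from_nat i) z \<partial>\<mu>"])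
      show "continuous_on UNIV (constraint_fun ob (from_nat i))" for i using lg by (simp add: linear_growth_def)
      fix l :: "nat \<Rightarrow> real" and a assume a: "\<And>z. a \<le> (\<Sum>i<N. l i * constraint_fun ob (from_nat i) z)"
      \<comment> \<open>A pointwise inequality integrates against the feasible measure, so its own
        integrals satisfy the dual condition.\<close>
      have "(\<integral>z. a \<partial>\<mu>) \<le> (\<integral>z. (\<Sum>i<N. l i * constraint_fun ob (from_nat i) z) \<partial>\<mu>)"
        using a int by (intro integral_mono) auto
      then show "a \<le> (\<Sum>i<N. l i * (\<integral>z. constraint_fun ob (from_nat i) z \<partial>\<mu>))"
        using int by (simp add: prob_space)
    qed auto
    have "ereal (list_avg (constraint_fun ob (from_nat i)) l) \<le>
      constraint_bound m P Q w (from_nat i) + ereal (1 / real (Suc N))" if "i < N" for i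
    proof -
      have "ereal (list_avg (constraint_fun ob (from_nat i)) l) \<le>
          ereal (\<integral>z. constraint_fun ob (from_nat i) z \<partial>\<mu>) + ereal (1 / real (Suc N))"
        using l(2)[OF that] by (simp add: abs_le_iff)
      also have "\<dots> \<le> constraint_bound m P Q w (from_nat i) + ereal (1 / real (Suc N))"
        by (intro add_right_mono le)
      finally show ?thesis .
    qed
    then show "\<exists>l. l \<noteq> [] \<and> (\<forall>i<N. ereal (list_avg (constraint_fun ob (from_nat i)) l) \<le>
      constraint_bound m P Q w (from_nat i) + ereal (1 / real (Suc N)))" using l(1) by blast
  qed
next
  assume "\<forall>N. \<exists>l. l \<noteq> [] \<and> (\<forall>i<N. ereal (list_avg (constraint_fun ob (from_nat i)) l) \<le>
      constraint_bound m P Q w (from_nat i) + ereal (1 / real (Suc N)))"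
  then obtain l where l: "\<And>N. l N \<noteq> []" and le: "\<And>N i. i < N \<Longrightarrow>
      ereal (list_avg (constraint_fun ob (from_nat i)) (l N)) \<le>
      constraint_bound m P Q w (from_nat i) + ereal (1 / real (Suc N))" by metis
  show "\<exists>\<mu>. feasible ob m P Q w \<mu>"
  proof (rule feasible_compact[OF P Q ob, of "\<lambda>N. list_measure (l N)"])
    show "prob_space (list_measure (l N) :: ((real ^ 'd) \<times> (real ^ 'd)) measure)"
      "sets (list_measure (l N) :: ((real ^ 'd) \<times> (real ^ 'd)) measure) = sets borel"
      "integrable (list_measure (l N) :: ((real ^ 'd) \<times> (real ^ 'd)) measure) weight" for N
      using list_measure(1,2)[OF l] list_measure(3)[OF l weight_measurable] by auto
    fix i :: "'d constraint" and r assume r: "constraint_bound m P Q w i < ereal r"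
    have "constraint_fun ob i \<in> borel_measurable borel"
      by (intro linear_growth_measurable linear_growth_constraint_fun ob)
    then have I: "(\<integral>z. constraint_fun ob i z \<partial>list_measure (l N)) = list_avg (constraint_fun ob i) (l N)" for N
      by (rule list_measure(4)[OF l])
    have le': "ereal (list_avg (constraint_fun ob i) (l N)) \<le> constraint_bound m P Q w i + ereal (1 / real (Suc N))"
      if "to_nat i < N" for N using le[OF that] by simp
    show "eventually (\<lambda>N. (\<integral>z. constraint_fun ob i z \<partial>list_measure (l N)) \<le> r) sequentially"
    proof (cases "constraint_bound m P Q w i")
      case (real v)
      then have "v < r" using r by simp
      then have "eventually (\<lambda>N. 1 / real (Suc N) < r - v) sequentially"
        using order_tendstoD(2)[OF LIMSEQ_Suc[OF lim_const_over_n[of 1]], of "r - v"] by simp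
      then show ?thesis using eventually_gt_at_top[of "to_nat i"]
      proof eventually_elim
        case (elim N) then show ?case using le'[of N] real by (simp add: I)
      qed
    next
      case PInf then show ?thesis using r by simp
    next
      case MInf then show ?thesis using le'[of "Suc (to_nat i)"] by simp
    qed
  qed
qed

section \<open>Strassen's theorem\<close>

text \<open>A dual certificate is beaten by the convex function
  \<open>u(y) = sup\<^sub>x (a - \<Phi>(x) - H(x) \<bullet> (y - x))\<close>, for which \<open>a - \<Phi> \<le> u \<le> \<Psi>\<close>.  It is truncated from below
  because the convex order only tests nonnegative functions.\<close>

lemma convex_order_dual:
  fixes P Q :: "(real ^ 'd) measure" and H :: "real ^ 'd \<Rightarrow> real ^ 'd"
  assumes P: "prob_space P" and Q: "prob_space Q"
    and cx: "P \<le>\<^sub>c\<^sub>x Q" and \<Phi>: "integrable P \<Phi>" and \<Psi>: "integrable Q \<Psi>"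
    and le: "\<And>x y. a \<le> \<Phi> x + \<Psi> y + H x \<bullet> (y - x)"
  shows "a \<le> (\<integral>x. \<Phi> x \<partial>P) + (\<integral>y. \<Psi> y \<partial>Q)"
proof -
  interpret P: prob_space P by fact
  interpret Q: prob_space Q by fact
  define u where "u y = (SUP x. a - \<Phi> x - H x \<bullet> (y - x))" for y
  have bdd: "bdd_above (range (\<lambda>x. a - \<Phi> x - H x \<bullet> (y - x)))" for y
    using le[of _ y] by (intro bdd_aboveI[of _ "\<Psi> y"]) (auto simp: algebra_simps)
  have u_ge: "a - \<Phi> x - H x \<bullet> (y - x) \<le> u y" for x y unfolding u_def by (rule cSUP_upper[OF _ bdd]) simp
  have u_le: "u y \<le> \<Psi> y" for y unfolding u_def
    using le[of _ y] by (intro cSUP_least) (auto simp: algebra_simps)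
  \<comment> \<open>The summand \<open>real n\<close> makes the truncated function nonnegative. It
    cancels in the end because both measures have mass 1, and the truncation disappears as n
    grows.\<close>
  define F where "F n x = max (u x) (- real n) + real n" for n x
  have cF: "convex_on UNIV (F n)" for n
  proof (rule convex_onI)
    fix t :: real and x y :: "real ^ 'd" assume t: "0 < t" "t < 1"
    have "u ((1 - t) *\<^sub>R x + t *\<^sub>R y) \<le> (1 - t) * u x + t * u y"
      unfolding u_def[of "(1 - t) *\<^sub>R x + t *\<^sub>R y"]
    proof (rule cSUP_least)
      fix z
      have "a - \<Phi> z - H z \<bullet> ((1 - t) *\<^sub>R x + t *\<^sub>R y - z) =
          (1 - t) * (a - \<Phi> z - H z \<bullet> (x - z)) + t * (a - \<Phi> z - H z \<bullet> (y - z))"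
        by (simp add: algebra_simps inner_diff_right inner_add_right)
      also have "\<dots> \<le> (1 - t) * u x + t * u y" using t u_ge by (intro add_mono mult_left_mono) auto
      finally show "a - \<Phi> z - H z \<bullet> ((1 - t) *\<^sub>R x + t *\<^sub>R y - z) \<le> (1 - t) * u x + t * u y" .
    qed simp
    also have "\<dots> \<le> (1 - t) * max (u x) (- real n) + t * max (u y) (- real n)"
      using t by (intro add_mono mult_left_mono) auto
    moreover have "- real n \<le> (1 - t) * max (u x) (- real n) + t * max (u y) (- real n)"
    proof -
      have "- real n = (1 - t) * (- real n) + t * (- real n)" by (simp add: algebra_simps)
      also have "\<dots> \<le> (1 - t) * max (u x) (- real n) + t * max (u y) (- real n)"
        using t by (intro add_mono mult_left_mono) auto
      finally show ?thesis .
    qed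
    ultimately have "max (u ((1 - t) *\<^sub>R x + t *\<^sub>R y)) (- real n) \<le> (1 - t) * max (u x) (- real n) + t * max (u y) (- real n)"
      by simp
    then show "F n ((1 - t) *\<^sub>R x + t *\<^sub>R y) \<le> (1 - t) * F n x + t * F n y"
      by (simp add: F_def algebra_simps)
  qed simp
  have F0: "0 \<le> F n x" for n x by (simp add: F_def)
  have key: "a - (\<integral>x. \<Phi> x \<partial>P) \<le> (\<integral>y. max (\<Psi> y) (- real n) \<partial>Q)" for n
  proof -
    \<comment> \<open>\<open>F n\<close> is enclosed between \<open>f\<close> and \<open>g\<close>,
      whose integrability is known. It enters only through nonnegative integrals, where monotonicity
      and the convex order apply directly.\<close>
    define f where "f x = max (a - \<Phi> x) (- real n) + real n" for x
    define g where "g y = max (\<Psi> y) (- real n) + real n" for y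
    have fi: "integrable P f" and gi: "integrable Q g" unfolding f_def g_def using \<Phi> \<Psi> by auto
    have f0: "0 \<le> f x" and g0: "0 \<le> g x" for x by (simp_all add: f_def g_def)
    have fF: "f x \<le> F n x" and Fg: "F n x \<le> g x" for x
      using u_ge[of x x] u_le[of x] by (auto simp: f_def F_def g_def)
    have "ennreal (\<integral>x. f x \<partial>P) = (\<integral>\<^sup>+x. ennreal (f x) \<partial>P)"
      using fi f0 by (intro nn_integral_eq_integral[symmetric]) auto
    also have "\<dots> \<le> (\<integral>\<^sup>+x. ennreal (F n x) \<partial>P)" by (intro nn_integral_mono ennreal_leI fF)
    also have "\<dots> \<le> (\<integral>\<^sup>+x. ennreal (F n x) \<partial>Q)"
      using cx cF F0 by (simp add: convex_order_def)
    also have "\<dots> \<le> (\<integral>\<^sup>+x. ennreal (g x) \<partial>Q)" by (intro nn_integral_mono ennreal_leI Fg)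
    also have "\<dots> = ennreal (\<integral>x. g x \<partial>Q)" using gi g0 by (intro nn_integral_eq_integral) auto
    finally have "(\<integral>x. f x \<partial>P) \<le> (\<integral>x. g x \<partial>Q)" using g0 by (simp add: ennreal_le_iff)
    also have "(\<integral>x. g x \<partial>Q) = (\<integral>y. max (\<Psi> y) (- real n) \<partial>Q) + real n"
      unfolding g_def using \<Psi> by (simp add: Q.prob_space)
    finally have "(\<integral>x. f x \<partial>P) \<le> (\<integral>y. max (\<Psi> y) (- real n) \<partial>Q) + real n" .
    moreover have "(\<integral>x. a - \<Phi> x + real n \<partial>P) \<le> (\<integral>x. f x \<partial>P)"
      using \<Phi> fi by (intro integral_mono) (auto simp: f_def)
    ultimately show ?thesis using \<Phi> by (simp add: P.prob_space)
  qed
  have "(\<lambda>n. \<integral>y. max (\<Psi> y) (- real n) \<partial>Q) \<longlonglongrightarrow> (\<integral>y. \<Psi> y \<partial>Q)"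
  proof (rule integral_dominated_convergence[where w="\<lambda>y. \<bar>\<Psi> y\<bar>"])
    show "AE y in Q. (\<lambda>n. max (\<Psi> y) (- real n)) \<longlonglongrightarrow> \<Psi> y"
    proof (rule AE_I2, rule tendsto_eventually)
      fix y
      obtain K :: nat where "- \<Psi> y < real K" using reals_Archimedean2 by blast
      then show "eventually (\<lambda>n. max (\<Psi> y) (- real n) = \<Psi> y) sequentially"
        by (intro eventually_sequentiallyI[of K]) (simp add: max_def)
    qed
    show "AE y in Q. norm (max (\<Psi> y) (- real n)) \<le> \<bar>\<Psi> y\<bar>" for n by (rule AE_I2) auto
  qed (use \<Psi> in auto)
  then have "a - (\<integral>x. \<Phi> x \<partial>P) \<le> (\<integral>y. \<Psi> y \<partial>Q)" by (rule LIMSEQ_le_const) (use key in auto)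
  then show ?thesis by simp
qed

text \<open>This and the next two functions split a constraint into a function of \<open>x\<close>,
  a function of \<open>y\<close> and a multiple of \<open>y - x\<close>. Linear combinations of
  constraints then have the shape treated by \<open>convex_order_dual\<close>.\<close>

fun dual_fst :: "'d constraint \<Rightarrow> real ^ 'd \<Rightarrow> real" where
  "dual_fst (Marginal s b j) x = (if b then signed s (test_fun j x) else 0)"
| "dual_fst (Moment b) x = (if b then norm x else 0)"
| "dual_fst _ x = 0"

fun dual_snd :: "'d constraint \<Rightarrow> real ^ 'd \<Rightarrow> real" where
  "dual_snd (Marginal s b j) y = (if b then 0 else signed s (test_fun j y))"
| "dual_snd (Moment b) y = (if b then 0 else norm y)"
| "dual_snd _ y = 0"

fun dual_slope :: "'d constraint \<Rightarrow> real ^ 'd \<Rightarrow> real ^ 'd" where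
  "dual_slope (Martingale s j k) x = signed s (test_fun j x) *\<^sub>R axis k 1"
| "dual_slope _ x = 0"

lemma dual_fst_eq:
  "dual_fst (Marginal s b j) = (if b then if s then test_fun j else (\<lambda>x. - test_fun j x) else (\<lambda>x. 0))"
  "dual_fst (Moment b) = (if b then norm else (\<lambda>x. 0))"
  "dual_fst (Martingale s j k) = (\<lambda>x. 0)"
  "dual_fst (Objective n l) = (\<lambda>x. 0)"
  by (auto simp: fun_eq_iff signed_def)

lemma dual_snd_eq:
  "dual_snd (Marginal s b j) = (if b then (\<lambda>x. 0) else if s then test_fun j else (\<lambda>x. - test_fun j x))"
  "dual_snd (Moment b) = (if b then (\<lambda>x. 0) else norm)"
  "dual_snd (Martingale s j k) = (\<lambda>x. 0)"
  "dual_snd (Objective n l) = (\<lambda>x. 0)"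
  by (auto simp: fun_eq_iff signed_def)

lemma constraint_fun_dual:
  "constraint_fun (\<lambda>_ _ _. 0) i (x, y) = dual_fst i x + dual_snd i y + dual_slope i x \<bullet> (y - x)"
  by (cases i) (auto simp: inner_axis' signed_def)

text \<open>With a zero objective every bound is the finite number \<open>t i\<close>, and all
  constraints may be approximated as equalities. The dual condition of
  \<open>list_avg_approximation\<close> is then precisely \<open>convex_order_dual\<close>, and
  compactness turns the approximations into a measure.\<close>

lemma strassen:
  fixes P Q :: "(real ^ 'd) measure"
  assumes P: "prob_space P" "sets P = sets borel" "integrable P norm"
    and Q: "prob_space Q" "sets Q = sets borel" "integrable Q norm"
    and cx: "P \<le>\<^sub>c\<^sub>x Q"
  shows "\<exists>\<mu>. is_martingale_coupling \<mu> P Q"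
proof -
  let ?o = "\<lambda>_ _ _. 0 :: real"
  have lg0: "linear_growth (\<lambda>_ :: (real ^ 'd) \<times> (real ^ 'd). 0)"
    by (rule linear_growthI[where K=0]) auto
  have lg: "linear_growth (constraint_fun ?o (i :: 'd constraint))" for i
    by (intro linear_growth_constraint_fun lg0)
  interpret P: prob_space P by (rule P(1))
  interpret Q: prob_space Q by (rule Q(1))
  note [measurable_cong] = P(2) Q(2)
  have tP: "integrable P (test_fun j)" and tQ: "integrable Q (test_fun j)" for j
    using integrable_test_fun[OF P(1), of "\<lambda>x. x" j] integrable_test_fun[OF Q(1), of "\<lambda>x. x" j] by auto
  have iP: "integrable P (dual_fst i)" for i
    by (cases i) (use tP P(3) in \<open>auto simp: dual_fst_eq signed_def\<close>)
  have iQ: "integrable Q (dual_snd i)" for i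
    by (cases i) (use tQ Q(3) in \<open>auto simp: dual_snd_eq signed_def\<close>)
  define t where "t i = (\<integral>x. dual_fst i x \<partial>P) + (\<integral>y. dual_snd i y \<partial>Q)" for i :: "'d constraint"
  have bound: "constraint_bound True P Q (\<lambda>_. 0) i = ereal (t i)" for i
    by (cases i) (auto simp: t_def dual_fst_eq dual_snd_eq signed_def zero_ereal_def)
  have "\<exists>\<mu>. feasible ?o True P Q (\<lambda>_. 0) \<mu>"
    unfolding feasible_iff_list_avg[OF P Q lg0]
  proof
    fix N
    obtain l where l: "l \<noteq> []" "\<And>i. i < N \<Longrightarrow>
      \<bar>list_avg (constraint_fun ?o (from_nat i :: 'd constraint)) l - t (from_nat i)\<bar> \<le> 1 / real (Suc N)"
    proof (rule list_avg_approximation[of N "\<lambda>i. constraint_fun ?o (from_nat i :: 'd constraint)" "1 / real (Suc N)" "\<lambda>i. t (from_nat i)"])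
      show "continuous_on UNIV (constraint_fun ?o (from_nat i :: 'd constraint))" for i
        using lg by (simp add: linear_growth_def)
      fix l :: "nat \<Rightarrow> real" and a
      assume a: "\<And>z. a \<le> (\<Sum>i<N. l i * constraint_fun ?o (from_nat i :: 'd constraint) z)"
      have "a \<le> (\<integral>x. (\<Sum>i<N. l i * dual_fst (from_nat i) x) \<partial>P) + (\<integral>y. (\<Sum>i<N. l i * dual_snd (from_nat i) y) \<partial>Q)"
      proof (rule convex_order_dual[OF P(1) Q(1) cx, where H="\<lambda>x. \<Sum>i<N. l i *\<^sub>R dual_slope (from_nat i) x"])
        fix x y :: "real ^ 'd"
        have "(\<Sum>i<N. l i * constraint_fun ?o (from_nat i :: 'd constraint) (x, y)) =
            (\<Sum>i<N. l i * dual_fst (from_nat i) x) + (\<Sum>i<N. l i * dual_snd (from_nat i) y) +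
            (\<Sum>i<N. l i *\<^sub>R dual_slope (from_nat i) x) \<bullet> (y - x)"
          unfolding constraint_fun_dual by (simp add: distrib_left sum.distrib inner_sum_left)
        then show "a \<le> (\<Sum>i<N. l i * dual_fst (from_nat i) x) + (\<Sum>i<N. l i * dual_snd (from_nat i) y) +
            (\<Sum>i<N. l i *\<^sub>R dual_slope (from_nat i) x) \<bullet> (y - x)" using a[of "(x, y)"] by simp
      qed (use iP iQ in auto)
      also have "\<dots> = (\<Sum>i<N. l i * t (from_nat i))"
        using iP iQ by (simp add: t_def distrib_left sum.distrib)
      finally show "a \<le> (\<Sum>i<N. l i * t (from_nat i))" .
    qed auto
    then show "\<exists>l. l \<noteq> [] \<and> (\<forall>i<N. ereal (list_avg (constraint_fun ?o (from_nat i :: 'd constraint)) l) \<le>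
      constraint_bound True P Q (\<lambda>_. 0) (from_nat i) + ereal (1 / real (Suc N)))"
      unfolding bound by (intro exI[of _ l]) (auto simp: abs_le_iff algebra_simps)
  qed
  then show ?thesis by (auto simp: feasible_def coupling_of_kind_def)
qed

section \<open>Measurable selection of minimisers\<close>

lemma product_is_coupling:
  fixes P Q :: "(real ^ 'd) measure"
  assumes P: "prob_space P" "sets P = sets borel" and Q: "prob_space Q" "sets Q = sets borel"
  shows "is_coupling (P \<Otimes>\<^sub>M Q) P Q"
proof -
  interpret P: prob_space P by (rule P(1))
  interpret Q: prob_space Q by (rule Q(1))
  interpret PQ: pair_prob_space P Q ..
  have s: "sets (P \<Otimes>\<^sub>M Q) = sets borel"
    using sets_pair_measure_cong[OF P(2) Q(2)] arg_cong[OF borel_prod, of sets] by (rule trans)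
  have "distr (P \<Otimes>\<^sub>M Q) borel fst = distr (P \<Otimes>\<^sub>M Q) P fst" by (rule distr_cong) (simp_all add: P)
  then have 1: "distr (P \<Otimes>\<^sub>M Q) borel fst = P" by (simp add: Q.distr_pair_fst)
  have 2: "distr (P \<Otimes>\<^sub>M Q) borel snd = Q"
  proof (rule measure_eqI)
    show "sets (distr (P \<Otimes>\<^sub>M Q) borel snd) = sets Q" by (simp add: Q)
    fix A assume "A \<in> sets (distr (P \<Otimes>\<^sub>M Q) borel snd)"
    then have A: "A \<in> sets borel" "A \<in> sets Q" by (simp_all add: Q)
    have sp: "space P = UNIV" "space Q = UNIV"
      using sets_eq_imp_space_eq[OF P(2)] sets_eq_imp_space_eq[OF Q(2)] by simp_all
    have m: "snd \<in> P \<Otimes>\<^sub>M Q \<rightarrow>\<^sub>M borel" using snd_borel by (simp add: measurable_cong_sets[OF s refl])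
    have "emeasure (distr (P \<Otimes>\<^sub>M Q) borel snd) A = emeasure (P \<Otimes>\<^sub>M Q) (space P \<times> A)"
      by (subst emeasure_distr[OF m A(1)], rule arg_cong[where f="emeasure _"]) (auto simp: space_pair_measure sp)
    also have "\<dots> = emeasure Q A"
      by (subst Q.emeasure_pair_measure_Times) (auto simp: A P.emeasure_space_1)
    finally show "emeasure (distr (P \<Otimes>\<^sub>M Q) borel snd) A = emeasure Q A" .
  qed
  show ?thesis unfolding is_coupling_def using s 1 2 PQ.prob_space_axioms by blast
qed

text \<open>\<open>ob 0\<close> is left free for the cost; the later objectives are the test
  functions, each a constant family in \<open>k\<close>. The convex order is hidden in
  \<open>nonempty\<close>, so that both kinds of coupling are treated together.\<close>

locale kernel_pair =
  fixes S :: "'s measure" and P Q :: "'s \<Rightarrow> (real ^ 'd) measure"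
    and ob :: "nat \<Rightarrow> nat \<Rightarrow> (real ^ 'd) \<times> (real ^ 'd) \<Rightarrow> real" and m :: bool
  assumes P_kernel: "P \<in> S \<rightarrow>\<^sub>M prob_algebra borel" and Q_kernel: "Q \<in> S \<rightarrow>\<^sub>M prob_algebra borel"
    and P_int: "\<And>\<theta>. \<theta> \<in> space S \<Longrightarrow> integrable (P \<theta>) norm"
    and Q_int: "\<And>\<theta>. \<theta> \<in> space S \<Longrightarrow> integrable (Q \<theta>) norm"
    and ob_growth: "\<And>n k. linear_growth (ob n k)"
    and ob_test: "\<And>n k. ob (Suc n) k = test_fun n"
    and nonempty: "\<And>\<theta>. \<theta> \<in> space S \<Longrightarrow> \<exists>\<mu>. coupling_of_kind m \<mu> (P \<theta>) (Q \<theta>)"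
begin

abbreviation solves :: "'s \<Rightarrow> (nat \<Rightarrow> ereal) \<Rightarrow> ((real ^ 'd) \<times> (real ^ 'd)) measure \<Rightarrow> bool" where
  "solves \<theta> w \<mu> \<equiv> feasible ob m (P \<theta>) (Q \<theta>) w \<mu>"

lemma P_prob: "\<theta> \<in> space S \<Longrightarrow> prob_space (P \<theta>)" "\<theta> \<in> space S \<Longrightarrow> sets (P \<theta>) = sets borel"
  and Q_prob: "\<theta> \<in> space S \<Longrightarrow> prob_space (Q \<theta>)" "\<theta> \<in> space S \<Longrightarrow> sets (Q \<theta>) = sets borel"
  using P_kernel Q_kernel by (simp_all add: prob_kernel_iff)

lemmas PQ = P_prob P_int Q_prob Q_int

lemma solvesD:
  assumes "\<theta> \<in> space S" "solves \<theta> w \<mu>"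
  shows "prob_space \<mu>" "sets \<mu> = sets borel" "integrable \<mu> weight"
    and "ereal (\<integral>z. constraint_fun ob i z \<partial>\<mu>) \<le> constraint_bound m (P \<theta>) (Q \<theta>) w i"
proof -
  have c: "is_coupling \<mu> (P \<theta>) (Q \<theta>)" using assms(2) by (simp add: feasible_def coupling_of_kind_def)
  show p: "prob_space \<mu>" "sets \<mu> = sets borel" using is_couplingD[OF c] by auto
  show "integrable \<mu> weight" by (rule is_coupling_weight(1)[OF c PQ(3,6)[OF assms(1)]])
  show "ereal (\<integral>z. constraint_fun ob i z \<partial>\<mu>) \<le> constraint_bound m (P \<theta>) (Q \<theta>) w i"
    using assms(2) feasible_iff[OF PQ[OF assms(1)] p] by blast
qed

text \<open>The assumption on \<open>v\<close> says that the upper limit of \<open>v j n\<close> is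
  at most \<open>w n\<close>. Compactness then tolerates bounds that vary along the sequence,
  including infinite ones.\<close>

lemma solves_limit:
  assumes \<theta>: "\<theta> \<in> space S" and \<mu>: "\<And>j. solves \<theta> (v j) (\<mu> j)"
    and ev: "\<And>n r. w n < ereal r \<Longrightarrow> eventually (\<lambda>j :: nat. v j n < ereal r) sequentially"
  shows "\<exists>\<nu>. solves \<theta> w \<nu>"
proof (rule feasible_compact[OF PQ[OF \<theta>] ob_growth, of \<mu>])
  show "prob_space (\<mu> j)" "sets (\<mu> j) = sets borel" "integrable (\<mu> j) weight" for j
    using solvesD[OF \<theta> \<mu>] by auto
  fix i r assume r: "constraint_bound m (P \<theta>) (Q \<theta>) w i < ereal r"
  have le: "ereal (\<integral>z. constraint_fun ob i z \<partial>\<mu> j) \<le> constraint_bound m (P \<theta>) (Q \<theta>) (v j) i" for j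
    by (rule solvesD(4)[OF \<theta> \<mu>])
  have "eventually (\<lambda>j. constraint_bound m (P \<theta>) (Q \<theta>) (v j) i < ereal r) sequentially"
    using r ev by (cases i) auto
  then show "eventually (\<lambda>j. (\<integral>z. constraint_fun ob i z \<partial>\<mu> j) \<le> r) sequentially"
  proof eventually_elim
    case (elim j)
    then have "ereal (\<integral>z. constraint_fun ob i z \<partial>\<mu> j) < ereal r" using le[of j] by (rule le_less_trans[rotated])
    then show ?case by simp
  qed
qed

lemma solves_mono: "solves \<theta> w \<mu> \<Longrightarrow> (\<And>n. w n \<le> w' n) \<Longrightarrow> solves \<theta> w' \<mu>"
  by (auto simp: feasible_def intro: order_trans)

text \<open>Choose solvable bounds that tend to the infimum and pass to a limit of the corresponding
  measures. The set of bounds contains \<open>w n\<close>, so it is nonempty.\<close>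

lemma solves_Inf:
  assumes \<theta>: "\<theta> \<in> space S" and ex: "\<exists>\<mu>. solves \<theta> w \<mu>"
  shows "\<exists>\<mu>. solves \<theta> (w(n := Inf {r. \<exists>\<mu>. solves \<theta> (w(n := r)) \<mu>})) \<mu>"
proof -
  let ?A = "{r. \<exists>\<mu>. solves \<theta> (w(n := r)) \<mu>}"
  have "w n \<in> ?A" using ex by simp
  then obtain u where u: "\<And>j :: nat. u j \<in> ?A" "u \<longlonglongrightarrow> Inf ?A" using Inf_as_limit[of ?A] by blast
  then obtain \<mu> where \<mu>: "\<And>j. solves \<theta> (w(n := u j)) (\<mu> j)" by simp metis
  show ?thesis
  proof (rule solves_limit[OF \<theta> \<mu>])
    fix i r assume "(w(n := Inf ?A)) i < ereal r"
    then show "eventually (\<lambda>j. (w(n := u j)) i < ereal r) sequentially"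
      using order_tendstoD(2)[OF u(2)] by (cases "i = n") auto
  qed
qed

lemma solvable_measurable:
  assumes w: "\<And>n. (\<lambda>\<theta>. w \<theta> n) \<in> borel_measurable S"
  shows "{\<theta> \<in> space S. \<exists>\<mu>. solves \<theta> (w \<theta>) \<mu>} \<in> sets S"
proof -
  have "(\<lambda>\<theta>. \<integral>x. f x \<partial>K \<theta>) \<in> borel_measurable S"
    if "f \<in> borel_measurable borel" "K \<in> S \<rightarrow>\<^sub>M prob_algebra borel" for f :: "real ^ 'd \<Rightarrow> real" and K
    by (rule measurable_compose[OF measurable_prob_algebraD[OF that(2)] integral_measurable_subprob_algebra[OF that(1)]])
  note K [measurable] = this[OF _ P_kernel] this[OF _ Q_kernel]
  have [measurable]: "(\<lambda>\<theta>. constraint_bound m (P \<theta>) (Q \<theta>) (w \<theta>) i) \<in> borel_measurable S" for i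
  proof (cases i)
    case (Marginal s b j)
    show ?thesis unfolding Marginal by (cases b; cases s) (simp_all add: signed_def K)
  next
    case (Moment b)
    show ?thesis unfolding Moment by (cases b) (simp_all add: K)
  qed (simp_all add: w)
  have "(\<exists>\<mu>. solves \<theta> (w \<theta>) \<mu>) \<longleftrightarrow> (\<forall>N. \<exists>l. l \<noteq> [] \<and>
    (\<forall>i\<in>{..<N}. ereal (list_avg (constraint_fun ob (from_nat i)) l) \<le>
      constraint_bound m (P \<theta>) (Q \<theta>) (w \<theta>) (from_nat i) + ereal (1 / real (Suc N))))"
    if "\<theta> \<in> space S" for \<theta>
    using feasible_iff_list_avg[OF PQ[OF that] ob_growth, where m=m and w="w \<theta>"] unfolding Ball_def lessThan_iff .
  then have "{\<theta> \<in> space S. \<exists>\<mu>. solves \<theta> (w \<theta>) \<mu>} = {\<theta> \<in> space S. \<forall>N. \<exists>l. l \<noteq> [] \<and>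
    (\<forall>i\<in>{..<N}. ereal (list_avg (constraint_fun ob (from_nat i)) l) \<le>
      constraint_bound m (P \<theta>) (Q \<theta>) (w \<theta>) (from_nat i) + ereal (1 / real (Suc N)))}"
    by (intro Collect_cong conj_cong refl)
  also have "\<dots> \<in> sets S" by measurable
  finally show ?thesis .
qed

text \<open>Lexicographic minimisation recorded through its values alone. The earlier minima remain
  as constraints, and the coordinates not yet reached are infinite.\<close>

primrec stage :: "'s \<Rightarrow> nat \<Rightarrow> nat \<Rightarrow> ereal" where
  "stage \<theta> 0 = (\<lambda>_. \<infinity>)"
| "stage \<theta> (Suc n) = (stage \<theta> n)(n := Inf {r. \<exists>\<mu>. solves \<theta> ((stage \<theta> n)(n := r)) \<mu>})"

lemma stage_solvable:
  assumes \<theta>: "\<theta> \<in> space S" shows "\<exists>\<mu>. solves \<theta> (stage \<theta> n) \<mu>"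
proof (induction n)
  case 0 then show ?case using nonempty[OF \<theta>] by (auto simp: feasible_def)
next
  case (Suc n) show ?case unfolding stage.simps by (rule solves_Inf[OF \<theta> Suc.IH])
qed

text \<open>As the infimum is attained, it is at most \<open>y\<close> exactly if the system with
  \<open>y\<close> in place \<open>n\<close> is solvable. The sublevel sets are therefore instances
  of \<open>solvable_measurable\<close>, with the previous stage as measurable data.\<close>

lemma stage_measurable: "(\<lambda>\<theta>. stage \<theta> n i) \<in> borel_measurable S"
proof (induction n arbitrary: i)
  case 0 then show ?case by simp
next
  case (Suc n)
  have "(\<lambda>\<theta>. Inf {r. \<exists>\<mu>. solves \<theta> ((stage \<theta> n)(n := r)) \<mu>}) \<in> borel_measurable S"
  proof (rule borel_measurableI_le)
    fix y
    have "Inf {r. \<exists>\<mu>. solves \<theta> ((stage \<theta> n)(n := r)) \<mu>} \<le> y \<longleftrightarrow> (\<exists>\<mu>. solves \<theta> ((stage \<theta> n)(n := y)) \<mu>)"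
      if \<theta>: "\<theta> \<in> space S" for \<theta>
    proof
      assume le: "Inf {r. \<exists>\<mu>. solves \<theta> ((stage \<theta> n)(n := r)) \<mu>} \<le> y"
      obtain \<mu> where "solves \<theta> ((stage \<theta> n)(n := Inf {r. \<exists>\<mu>. solves \<theta> ((stage \<theta> n)(n := r)) \<mu>})) \<mu>"
        using solves_Inf[OF \<theta> stage_solvable[OF \<theta>]] by blast
      then have "solves \<theta> ((stage \<theta> n)(n := y)) \<mu>" by (rule solves_mono) (use le in auto)
      then show "\<exists>\<mu>. solves \<theta> ((stage \<theta> n)(n := y)) \<mu>" by blast
    qed (simp add: Inf_lower)
    then have "{\<theta> \<in> space S. Inf {r. \<exists>\<mu>. solves \<theta> ((stage \<theta> n)(n := r)) \<mu>} \<le> y} =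
        {\<theta> \<in> space S. \<exists>\<mu>. solves \<theta> ((stage \<theta> n)(n := y)) \<mu>}" by blast
    also have "\<dots> \<in> sets S"
      by (rule solvable_measurable) (use Suc.IH in \<open>simp add: fun_upd_def\<close>)
    finally show "{\<theta> \<in> space S. Inf {r. \<exists>\<mu>. solves \<theta> ((stage \<theta> n)(n := r)) \<mu>} \<le> y} \<in> sets S" .
  qed
  then show ?case using Suc.IH by (cases "i = n") auto
qed

text \<open>The diagonal of the stages: coordinate \<open>n\<close> is set at stage
  \<open>Suc n\<close> and never altered later.\<close>

definition limit_stage :: "'s \<Rightarrow> nat \<Rightarrow> ereal" where
  "limit_stage \<theta> n = stage \<theta> (Suc n) n"

lemma stage_eq: "stage \<theta> n i = (if i < n then limit_stage \<theta> i else \<infinity>)"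
proof (induction n)
  case (Suc n)
  show ?case
  proof (cases "i = n")
    case True then show ?thesis by (simp add: limit_stage_def)
  next
    case False then show ?thesis using Suc by auto
  qed
qed simp

lemma limit_stage_solvable:
  assumes \<theta>: "\<theta> \<in> space S" shows "\<exists>\<mu>. solves \<theta> (limit_stage \<theta>) \<mu>"
proof -
  obtain \<mu> where \<mu>: "\<And>j. solves \<theta> (stage \<theta> j) (\<mu> j)" using stage_solvable[OF \<theta>] by metis
  show ?thesis
  proof (rule solves_limit[OF \<theta> \<mu>])
    fix n r assume "limit_stage \<theta> n < ereal r"
    then show "eventually (\<lambda>j. stage \<theta> j n < ereal r) sequentially"
      by (intro eventually_sequentiallyI[of "Suc n"]) (simp add: stage_eq)
  qed
qed

lemma limit_stage_least:
  assumes c: "coupling_of_kind m \<mu> (P \<theta>) (Q \<theta>)"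
    and le: "\<And>i k. i < n \<Longrightarrow> ereal (\<integral>z. ob i k z \<partial>\<mu>) \<le> limit_stage \<theta> i"
    and y: "\<And>k. ereal (\<integral>z. ob n k z \<partial>\<mu>) \<le> y"
  shows "limit_stage \<theta> n \<le> y"
proof -
  have "solves \<theta> ((stage \<theta> n)(n := y)) \<mu>"
    using c le y by (auto simp: feasible_def stage_eq)
  then show ?thesis by (auto simp: limit_stage_def intro: Inf_lower)
qed

text \<open>The test functions are minimised one after the other, so the minimiser is unique and the
  integrals of the test functions against it are the measurable functions \<open>limit_stage\<close>.\<close>

lemma minimising_kernel:
  "\<exists>\<gamma>. \<gamma> \<in> S \<rightarrow>\<^sub>M prob_algebra borel \<and> (\<forall>\<theta>\<in>space S. coupling_of_kind m (\<gamma> \<theta>) (P \<theta>) (Q \<theta>) \<and>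
    (\<forall>\<mu> y. coupling_of_kind m \<mu> (P \<theta>) (Q \<theta>) \<longrightarrow> (\<forall>k. ereal (\<integral>z. ob 0 k z \<partial>\<mu>) \<le> y) \<longrightarrow>
      (\<forall>k. ereal (\<integral>z. ob 0 k z \<partial>\<gamma> \<theta>) \<le> y)))"
proof -
  define \<gamma> where "\<gamma> \<theta> = (SOME \<mu>. solves \<theta> (limit_stage \<theta>) \<mu>)" for \<theta>
  have \<gamma>: "solves \<theta> (limit_stage \<theta>) (\<gamma> \<theta>)" if "\<theta> \<in> space S" for \<theta>
    unfolding \<gamma>_def using limit_stage_solvable[OF that] by (rule someI_ex)
  have c: "coupling_of_kind m (\<gamma> \<theta>) (P \<theta>) (Q \<theta>)" and le: "ereal (\<integral>z. ob n k z \<partial>\<gamma> \<theta>) \<le> limit_stage \<theta> n"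
    if "\<theta> \<in> space S" for \<theta> n k using \<gamma>[OF that] by (auto simp: feasible_def)
  have eq: "(\<integral>z. test_fun n z \<partial>\<gamma> \<theta>) = real_of_ereal (limit_stage \<theta> (Suc n))" if "\<theta> \<in> space S" for \<theta> n
  proof -
    \<comment> \<open>The chosen measure is a competitor in its own minimisation problem. It
      respects all earlier minima, so its integral cannot fall below the next one; feasibility gives
      the converse.\<close>
    have "limit_stage \<theta> (Suc n) \<le> ereal (\<integral>z. test_fun n z \<partial>\<gamma> \<theta>)"
      by (rule limit_stage_least[OF c[OF that] le[OF that]]) (simp add: ob_test)
    moreover have "ereal (\<integral>z. test_fun n z \<partial>\<gamma> \<theta>) \<le> limit_stage \<theta> (Suc n)"
      using le[OF that, of "Suc n"] by (simp add: ob_test)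
    ultimately have "limit_stage \<theta> (Suc n) = ereal (\<integral>z. test_fun n z \<partial>\<gamma> \<theta>)" by (rule antisym)
    then show ?thesis by simp
  qed
  have "\<gamma> \<in> S \<rightarrow>\<^sub>M prob_algebra borel"
  proof (rule measurable_prob_algebra_test_fun)
    show "prob_space (\<gamma> \<theta>) \<and> sets (\<gamma> \<theta>) = sets borel" if "\<theta> \<in> space S" for \<theta>
      using solvesD(1,2)[OF that \<gamma>[OF that]] by simp
    fix n
    have "(\<lambda>\<theta>. real_of_ereal (limit_stage \<theta> (Suc n))) \<in> borel_measurable S"
      unfolding limit_stage_def using stage_measurable by measurable
    then show "(\<lambda>\<theta>. \<integral>z. test_fun n z \<partial>\<gamma> \<theta>) \<in> borel_measurable S"
      by (rule measurable_cong[THEN iffD1, rotated]) (simp add: eq)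
  qed
  moreover have "ereal (\<integral>z. ob 0 k z \<partial>\<gamma> \<theta>) \<le> y"
    if \<theta>: "\<theta> \<in> space S" and "coupling_of_kind m \<mu> (P \<theta>) (Q \<theta>)" "\<And>k. ereal (\<integral>z. ob 0 k z \<partial>\<mu>) \<le> y"
    for \<theta> \<mu> y k
  proof -
    have "limit_stage \<theta> 0 \<le> y" by (rule limit_stage_least) (use that in auto)
    then show ?thesis using le[OF \<theta>, of 0 k] by simp
  qed
  ultimately show ?thesis using c by blast
qed

end

section \<open>From the lower semicontinuous cost to linear constraints\<close>

lemma lower_semicontinuous_add_continuous:
  fixes c :: "'a :: topological_space \<Rightarrow> ereal" and g :: "'a \<Rightarrow> real"
  assumes c: "lower_semicontinuous c" and g: "continuous_on UNIV g" and fin: "\<And>x. c x \<noteq> - \<infinity>"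
  shows "lower_semicontinuous (\<lambda>x. c x + ereal (g x))"
  unfolding lower_semicontinuous_def le_Liminf_iff
proof (intro allI impI)
  fix x y assume y: "y < c x + ereal (g x)"
  show "eventually (\<lambda>w. y < c w + ereal (g w)) (at x)"
  proof (cases y)
    case (real r)
    have "ereal (r - g x) < c x" using y real by (cases "c x") auto
    then obtain q where q: "ereal (r - g x) < ereal q" "ereal q < c x" using ereal_dense2 by blast
    have "ereal q < Liminf (at x) c" using q(2) c by (auto simp: lower_semicontinuous_def intro: less_le_trans)
    then have 1: "eventually (\<lambda>w. ereal q < c w) (at x)" by (rule less_LiminfD)
    have "(g \<longlongrightarrow> g x) (at x)" using g by (simp add: continuous_on_def)
    moreover have "r - q < g x" using q(1) by simp
    ultimately have 2: "eventually (\<lambda>w. r - q < g w) (at x)" by (rule order_tendstoD(1))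
    from 1 2 show ?thesis
    proof eventually_elim
      case (elim w) then show ?case using real by (cases "c w") auto
    qed
  next
    case PInf then show ?thesis using y by simp
  next
    case MInf then show ?thesis using fin by (intro always_eventually allI) (simp add: less_le)
  qed
qed

theorem proposition5p4:
  fixes S :: "'s measure"
    and P Q :: "'s \<Rightarrow> (real ^ 'd) measure"
    and c :: "(real ^ 'd) \<times> (real ^ 'd) \<Rightarrow> ereal"
  assumes P_kernel: "P \<in> S \<rightarrow>\<^sub>M prob_algebra borel"
    and Q_kernel: "Q \<in> S \<rightarrow>\<^sub>M prob_algebra borel"
    and P_moment: "\<forall>\<theta>\<in>space S. (\<integral>\<^sup>+x. ennreal (norm x) \<partial>P \<theta>) < \<infinity>"
    and Q_moment: "\<forall>\<theta>\<in>space S. (\<integral>\<^sup>+x. ennreal (norm x) \<partial>Q \<theta>) < \<infinity>"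
    and c_range: "\<forall>z. c z \<noteq> - \<infinity>"
    and c_lsc: "lower_semicontinuous c"
    and c_bound: "\<exists>C :: real. \<forall>x y. ereal (- C * (1 + norm x + norm y)) \<le> c (x, y)"
  shows "((\<forall>\<theta>\<in>space S. P \<theta> \<le>\<^sub>c\<^sub>x Q \<theta>) \<longrightarrow>
      (\<exists>\<gamma>. \<gamma> \<in> S \<rightarrow>\<^sub>M prob_algebra borel \<and>
        (\<forall>\<theta>\<in>space S. is_martingale_coupling (\<gamma> \<theta>) (P \<theta>) (Q \<theta>) \<and>
          (\<forall>\<mu>. is_martingale_coupling \<mu> (P \<theta>) (Q \<theta>) \<longrightarrow>
            ereal_integral (\<gamma> \<theta>) c \<le> ereal_integral \<mu> c)))) \<and>
    (\<exists>\<gamma>. \<gamma> \<in> S \<rightarrow>\<^sub>M prob_algebra borel \<and>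
      (\<forall>\<theta>\<in>space S. is_coupling (\<gamma> \<theta>) (P \<theta>) (Q \<theta>) \<and>
        (\<forall>\<mu>. is_coupling \<mu> (P \<theta>) (Q \<theta>) \<longrightarrow>
          ereal_integral (\<gamma> \<theta>) c \<le> ereal_integral \<mu> c)))"
proof -
  have P: "prob_space (P \<theta>)" "sets (P \<theta>) = sets borel" and Q: "prob_space (Q \<theta>)" "sets (Q \<theta>) = sets borel"
    if "\<theta> \<in> space S" for \<theta>
    using P_kernel Q_kernel that by (simp_all add: prob_kernel_iff)
  have iP: "integrable (P \<theta>) norm" and iQ: "integrable (Q \<theta>) norm" if "\<theta> \<in> space S" for \<theta>
  proof -
    have "norm \<in> borel_measurable (P \<theta>)" "norm \<in> borel_measurable (Q \<theta>)"
      by (simp_all add: measurable_cong_sets[OF P(2)[OF that] refl] measurable_cong_sets[OF Q(2)[OF that] refl])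
    then show "integrable (P \<theta>) norm" "integrable (Q \<theta>) norm"
      using P_moment Q_moment that by (auto simp: integrable_iff_bounded)
  qed
  obtain C where C: "\<And>x y. ereal (- C * (1 + norm x + norm y)) \<le> c (x, y)" using c_bound by blast
  \<comment> \<open>The absolute value ensures that \<open>g\<close> is nonnegative also when
    \<open>C\<close> is negative.\<close>
  define g where "g z = \<bar>C\<bar> * weight z" for z :: "(real ^ 'd) \<times> (real ^ 'd)"
  have g0: "0 \<le> g z" for z using weight_ge_1[of z] by (simp add: g_def)
  have cg: "continuous_on UNIV g" unfolding g_def by (intro continuous_intros continuous_weight)
  have c_ge: "- ereal (g z) \<le> c z" for z
  proof -
    have "- g z \<le> - C * (1 + norm (fst z) + norm (snd z))"
      using mult_right_mono[of C "\<bar>C\<bar>" "weight z"] weight_ge_1[of z] by (simp add: g_def weight_def)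
    then have "ereal (- g z) \<le> ereal (- C * (1 + norm (fst z) + norm (snd z)))" by simp
    also have "\<dots> \<le> c z" using C[of "fst z" "snd z"] by simp
    finally show ?thesis by simp
  qed
  define b where "b z = c z + ereal (g z)" for z
  have b_lsc: "lower_semicontinuous b"
    unfolding b_def using lower_semicontinuous_add_continuous[OF c_lsc cg] c_range by blast
  have b0: "0 \<le> b z" for z using c_ge[of z] by (cases "c z") (auto simp: b_def)
  obtain \<beta> where \<beta>: "\<And>k. continuous_on UNIV (\<beta> k)" "\<And>k z. 0 \<le> \<beta> k z \<and> \<beta> k z \<le> real k"
    "\<And>z. incseq (\<lambda>k. \<beta> k z)" "\<And>z. (SUP k. ereal (\<beta> k z)) = b z"
    using lower_semicontinuous_approximation[OF b_lsc b0] by blast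
  have [measurable]: "\<beta> k \<in> borel_measurable borel" "g \<in> borel_measurable borel" for k
    using \<beta>(1) cg by (auto intro: borel_measurable_continuous_onI)
  \<comment> \<open>Measurability of the cost is obtained from its representation by countably many
    continuous functions.\<close>
  have "b \<in> borel_measurable borel" unfolding \<beta>(4)[symmetric] by measurable
  moreover have "c = (\<lambda>z. b z - ereal (g z))"
  proof
    show "c z = b z - ereal (g z)" for z by (cases "c z") (auto simp: b_def)
  qed
  ultimately have cm: "c \<in> borel_measurable borel" by simp
  have lg\<beta>: "linear_growth (\<beta> k)" for k
  proof (rule linear_growthI[OF \<beta>(1)])
    show "\<bar>\<beta> k z\<bar> \<le> real k * weight z" for z
      using \<beta>(2)[of k z] mult_left_mono[OF weight_ge_1[of z], of "real k"] by simp
  qed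
  \<comment> \<open>Subtracting \<open>g\<close> undoes the shift: the integrals of
    \<open>ob 0 k\<close> increase with \<open>k\<close> to \<mu>(c) itself.\<close>
  define ob where "ob n k = (case n of 0 \<Rightarrow> \<lambda>z. \<beta> k z - g z | Suc j \<Rightarrow> test_fun j)" for n k :: nat
  have ob_growth: "linear_growth (ob n k)" for n k
  proof (cases n)
    case 0
    show ?thesis unfolding ob_def 0 nat.case
    proof (rule linear_growthI)
      show "continuous_on UNIV (\<lambda>z. \<beta> k z - g z)" by (intro continuous_intros \<beta>(1) cg)
      fix z
      have "\<bar>\<beta> k z - g z\<bar> \<le> real k * 1 + \<bar>C\<bar> * weight z" using \<beta>(2)[of k z] g0[of z] by (auto simp: g_def abs_le_iff)
      also have "\<dots> \<le> (real k + \<bar>C\<bar>) * weight z"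
        unfolding distrib_right using weight_ge_1[of z] by (intro add_mono mult_left_mono) auto
      finally show "\<bar>\<beta> k z - g z\<bar> \<le> (real k + \<bar>C\<bar>) * weight z" .
    qed
  next
    case (Suc j)
    show ?thesis unfolding ob_def Suc nat.case
    proof (rule linear_growthI[OF continuous_test_fun])
      show "\<bar>test_fun j z\<bar> \<le> 1 * weight z" for z
        using weight_ge_1[of z] test_fun_bounds(2)[of j z] by (simp add: abs_test_fun)
    qed
  qed
  have cost: "ereal_integral \<mu> c \<le> y \<longleftrightarrow> (\<forall>k. ereal (\<integral>z. ob 0 k z \<partial>\<mu>) \<le> y)"
    if \<theta>: "\<theta> \<in> space S" and \<mu>: "is_coupling \<mu> (P \<theta>) (Q \<theta>)" for \<theta> \<mu> y
    unfolding ob_def nat.case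
  proof (rule ereal_integral_le_iff)
    note cD = is_couplingD[OF \<mu>]
    have w: "integrable \<mu> weight" by (rule is_coupling_weight(1)[OF \<mu> iP[OF \<theta>] iQ[OF \<theta>]])
    then show "integrable \<mu> g" unfolding g_def by simp
    show "c \<in> borel_measurable \<mu>" using cm by (simp add: measurable_cong_sets[OF cD(2) refl])
    show "integrable \<mu> (\<beta> k)" for k by (rule linear_growth_integrable[OF lg\<beta> cD(2) w])
    show "(SUP k. ereal (\<beta> k z)) = c z + ereal (g z)" for z using \<beta>(4)[of z] by (simp add: b_def)
  qed (use g0 c_ge \<beta> in auto)
  have main: "\<exists>\<gamma>. \<gamma> \<in> S \<rightarrow>\<^sub>M prob_algebra borel \<and> (\<forall>\<theta>\<in>space S. coupling_of_kind m (\<gamma> \<theta>) (P \<theta>) (Q \<theta>) \<and>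
      (\<forall>\<mu>. coupling_of_kind m \<mu> (P \<theta>) (Q \<theta>) \<longrightarrow> ereal_integral (\<gamma> \<theta>) c \<le> ereal_integral \<mu> c))"
    if ne: "\<And>\<theta>. \<theta> \<in> space S \<Longrightarrow> \<exists>\<mu>. coupling_of_kind m \<mu> (P \<theta>) (Q \<theta>)" for m
  proof -
    interpret kernel_pair S P Q ob m
      by unfold_locales (use P_kernel Q_kernel iP iQ ob_growth ne in \<open>auto simp: ob_def\<close>)
    obtain \<gamma> where \<gamma>: "\<gamma> \<in> S \<rightarrow>\<^sub>M prob_algebra borel"
      and c\<gamma>: "\<And>\<theta>. \<theta> \<in> space S \<Longrightarrow> coupling_of_kind m (\<gamma> \<theta>) (P \<theta>) (Q \<theta>)"
      and min: "\<And>\<theta> \<mu> y. \<theta> \<in> space S \<Longrightarrow> coupling_of_kind m \<mu> (P \<theta>) (Q \<theta>) \<Longrightarrow>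
        \<forall>k. ereal (\<integral>z. ob 0 k z \<partial>\<mu>) \<le> y \<Longrightarrow> \<forall>k. ereal (\<integral>z. ob 0 k z \<partial>\<gamma> \<theta>) \<le> y"
      using minimising_kernel by blast
    \<comment> \<open>The minimality of the kernel speaks of common upper bounds of the family
      \<open>ob 0\<close>. It is used with the cost of the competitor as the bound, possibly
      infinite.\<close>
    have "ereal_integral (\<gamma> \<theta>) c \<le> ereal_integral \<mu> c"
      if \<theta>: "\<theta> \<in> space S" and \<mu>: "coupling_of_kind m \<mu> (P \<theta>) (Q \<theta>)" for \<theta> \<mu>
      using cost[OF \<theta>, of \<mu> "ereal_integral \<mu> c"] cost[OF \<theta>, of "\<gamma> \<theta>" "ereal_integral \<mu> c"]
        min[OF \<theta> \<mu>] \<mu> c\<gamma>[OF \<theta>] by (simp add: coupling_of_kind_def)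
    then show ?thesis using \<gamma> c\<gamma> by blast
  qed
  have k1: "coupling_of_kind True \<mu> P' Q' \<longleftrightarrow> is_martingale_coupling \<mu> P' Q'" for \<mu> and P' Q' :: "(real ^ 'd) measure"
    by (auto simp: coupling_of_kind_def is_martingale_coupling_def)
  have k2: "coupling_of_kind False \<mu> P' Q' \<longleftrightarrow> is_coupling \<mu> P' Q'" for \<mu> and P' Q' :: "(real ^ 'd) measure"
    by (simp add: coupling_of_kind_def)
  show ?thesis
  proof (intro conjI impI)
    assume cx: "\<forall>\<theta>\<in>space S. P \<theta> \<le>\<^sub>c\<^sub>x Q \<theta>"
    show "\<exists>\<gamma>. \<gamma> \<in> S \<rightarrow>\<^sub>M prob_algebra borel \<and>
        (\<forall>\<theta>\<in>space S. is_martingale_coupling (\<gamma> \<theta>) (P \<theta>) (Q \<theta>) \<and>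
          (\<forall>\<mu>. is_martingale_coupling \<mu> (P \<theta>) (Q \<theta>) \<longrightarrow> ereal_integral (\<gamma> \<theta>) c \<le> ereal_integral \<mu> c))"
      by (rule main[of True, unfolded k1]) (use strassen P Q iP iQ cx in blast)
  next
    show "\<exists>\<gamma>. \<gamma> \<in> S \<rightarrow>\<^sub>M prob_algebra borel \<and>
      (\<forall>\<theta>\<in>space S. is_coupling (\<gamma> \<theta>) (P \<theta>) (Q \<theta>) \<and>
        (\<forall>\<mu>. is_coupling \<mu> (P \<theta>) (Q \<theta>) \<longrightarrow> ereal_integral (\<gamma> \<theta>) c \<le> ereal_integral \<mu> c))"
      by (rule main[of False, unfolded k2]) (use product_is_coupling P Q in blast)
  qed
qed

end
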